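(* Let $r>1$ and let $\mathcal A^*$ be an $(r-1)$-connected Poincaré DGCA of degree $n$ over $\mathbb F$, endowed with a Hodge type decomposition whose harmonic subspace $\mathcal H^*$ is adapted to a generating subspace $H^*_{gen}\subseteq H^*_+(\mathcal A^* )$. If $n\le 5r-3$, then $\mathcal H^*$ carries an $A_3$-algebra structure with trivial differential making it $A_\infty$-quasi-isomorphic to $\mathcal A^*$. Moreover, if $n\le 4r-2$, then the ternary multiplication of this $A_3$-algebra vanishes, so in particular $\mathcal A^*$ is formal.
   Context: $\mathbb F$ is a fixed field of characteristic $0$. A DGCA is a (unital) differential graded commutative algebra over $\mathbb F$ with differential $d$ of degree $+1$; $\mathcal A^*_d=\ker d$. Two DGCAs are equivalent if they are connected by a zig-zag of DGCA quasi-isomorphisms; a DGCA is formal if it is equivalent to its cohomology algebra with zero differential. A DGCA is connected if $H^0\cong\mathbb F$, and $s$-connected if moreover $H^k=0$ for $1\le k\le s$. A Poincaré algebra of degree $n$ is a finite dimensional graded commutative algebra $H^*=\bigoplus_{k=0}^nH^k$ with a linear functional $\int\in(H^n)^\vee$ such that the pairing $\langle\alpha^k,\beta^l\rangle=\int\alpha^k\beta^l$ if $k+l=n$, and $0$ otherwise, is non-degenerate. A Poincaré DGCA of degree $n$ is a DGCA $\mathcal A^*=\bigoplus_{k=0}^n\mathcal A^k$ whose cohomology ring is (equipped with the structure of) a Poincaré algebra of degree $n$; it carries the induced pairing $\langle\alpha^k,\beta^l\rangle=\int[\alpha^k\beta^l]$ if $k+l=n$, and $0$ otherwise. A harmonic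 subspace is a graded subspace $\mathcal H^*\subseteq\mathcal A^*_d$ complementary to $d\mathcal A^{*-1}$ in $\mathcal A^*_d$. A Hodge type decomposition is a direct sum decomposition $\mathcal A^*=d\mathcal A^{*-1}\oplus\mathcal H^*\oplus\mathcal B^*$ with $\mathcal H^*$ a harmonic subspace and $\langle\mathcal H^*\oplus\mathcal B^*,\mathcal B^*\rangle=0$. Let $H^*=H^*(\mathcal A^* )$ and $H^*_+=\bigoplus_{k\ge1}H^k$. A generating subspace is a graded subspace $H^*_{gen}\subseteq H^*_+$ with $H^*_+=H^*_{gen}\oplus(H^*_+\cdot H^*_+)$. A partial splitting map is a linear degree-preserving map $\imath_0:H^*_{gen}\to\mathcal A^*_d$ with $[\imath_0(x)]=x$; it extends to an algebra morphism $\imath_0:S^*(H^*_{gen})\to\mathcal A^*_d$ from the graded symmetric algebra. A harmonic subspace $\mathcal H^*$ is $\imath_0$-adapted (adapted to $H^*_{gen}$) if $\mathcal H^*=\imath(H^* )$ for a linear section $\imath:H^*\to\mathcal A^*_d$ of the projection $\mathcal A^*_d\to H^*$ with $\imath|_{H^*_{gen}}=\imath_0$ and $\imath(H^* )\subseteq\imath_0(S^*(H^*_{gen}))$. An $A_3$-algebra is an $A_\infty$-algebra whose multiplications $m_k$ vanish for $k\ge4$. *)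

theory Defs
  imports "HOL-Algebra.Module" "HOL-Algebra.QuotRing" "HOL-Algebra.Ideal_Product"
begin

section \<open>Ground field, graded modules and differential graded algebras\<close>

locale char0_field = field F for F (structure) +
  assumes char_zero: "\<And>k::nat. k > 0 \<Longrightarrow> [k] \<cdot> \<one> \<noteq> \<zero>"

text \<open>
  As usual in \<^theory>\<open>HOL-Algebra.Module\<close>, the multiplication fields of a record that is only used
  as a module are ignored.  Degrees are integers; \<open>grade V k\<close> is the component of degree \<open>k\<close>.
\<close>

record ('f, 'a) graded = "('f, 'a) module" +
  grade :: "int \<Rightarrow> 'a set"

record ('f, 'a) dga = "('f, 'a) graded" +
  diff :: "'a \<Rightarrow> 'a"

text \<open>\<open>decomposition V x c\<close>: \<open>c\<close> is the family of homogeneous components of \<open>x\<close>.\<close>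

definition decomposition :: "('f, 'a, 'e) graded_scheme \<Rightarrow> 'a \<Rightarrow> (int \<Rightarrow> 'a) \<Rightarrow> bool" where
  "decomposition V x c \<longleftrightarrow>
     (\<forall>k. c k \<in> grade V k) \<and> finite {k. c k \<noteq> \<zero>\<^bsub>V\<^esub>} \<and>
     x = (\<Oplus>\<^bsub>V\<^esub>k\<in>{k. c k \<noteq> \<zero>\<^bsub>V\<^esub>}. c k)"

definition component :: "('f, 'a, 'e) graded_scheme \<Rightarrow> int \<Rightarrow> 'a \<Rightarrow> 'a" where
  "component V k x = (THE c. decomposition V x c) k"

locale graded_module = module F V
  for F :: "('f, 'm) ring_scheme" and V :: "('f, 'a, 'e) graded_scheme" +
  assumes grade_submodule: "\<And>k. submodule (grade V k) F V"
    and grade_direct_sum: "\<And>x. x \<in> carrier V \<Longrightarrow> \<exists>!c. decomposition V x c"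

definition restrict_graded ::
  "('f, 'a, 'e) graded_scheme \<Rightarrow> 'a set \<Rightarrow> ('f, 'a, 'e) graded_scheme" where
  "restrict_graded V W = V\<lparr>carrier := W, grade := \<lambda>k. grade V k \<inter> W\<rparr>"

definition graded_subspace ::
  "('f, 'm) ring_scheme \<Rightarrow> ('f, 'a, 'e) graded_scheme \<Rightarrow> 'a set \<Rightarrow> bool" where
  "graded_subspace F V W \<longleftrightarrow> submodule W F V \<and> graded_module F (restrict_graded V W)"

definition direct_sum ::
  "('a, 'e) ring_scheme \<Rightarrow> 'a set \<Rightarrow> 'a set \<Rightarrow> 'a set \<Rightarrow> bool" where
  "direct_sum V W X Y \<longleftrightarrow> W = X <+>\<^bsub>V\<^esub> Y \<and> X \<inter> Y = {\<zero>\<^bsub>V\<^esub>}"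

definition linear_map ::
  "('f, 'm) ring_scheme \<Rightarrow> ('f, 'a, 'e) module_scheme \<Rightarrow> ('f, 'b, 'g) module_scheme
    \<Rightarrow> ('a \<Rightarrow> 'b) \<Rightarrow> bool" where
  "linear_map F V W f \<longleftrightarrow>
     f \<in> carrier V \<rightarrow> carrier W \<and>
     (\<forall>x\<in>carrier V. \<forall>y\<in>carrier V. f (x \<oplus>\<^bsub>V\<^esub> y) = f x \<oplus>\<^bsub>W\<^esub> f y) \<and>
     (\<forall>c\<in>carrier F. \<forall>x\<in>carrier V. f (c \<odot>\<^bsub>V\<^esub> x) = c \<odot>\<^bsub>W\<^esub> f x)"

definition linear_functional_on ::
  "('f, 'm) ring_scheme \<Rightarrow> ('f, 'a, 'e) module_scheme \<Rightarrow> 'a set \<Rightarrow> ('a \<Rightarrow> 'f) \<Rightarrow> bool" where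
  "linear_functional_on F V W f \<longleftrightarrow>
     f \<in> W \<rightarrow> carrier F \<and>
     (\<forall>x\<in>W. \<forall>y\<in>W. f (x \<oplus>\<^bsub>V\<^esub> y) = f x \<oplus>\<^bsub>F\<^esub> f y) \<and>
     (\<forall>c\<in>carrier F. \<forall>x\<in>W. f (c \<odot>\<^bsub>V\<^esub> x) = c \<otimes>\<^bsub>F\<^esub> f x)"

definition finite_dim ::
  "('f, 'm) ring_scheme \<Rightarrow> ('f, 'a, 'e) module_scheme \<Rightarrow> bool" where
  "finite_dim F V \<longleftrightarrow>
     (\<exists>S. finite S \<and> S \<subseteq> carrier V \<and>
        (\<forall>x\<in>carrier V. \<exists>c\<in>S \<rightarrow> carrier F. x = (\<Oplus>\<^bsub>V\<^esub>s\<in>S. c s \<odot>\<^bsub>V\<^esub> s)))"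

text \<open>\<open>signed V e x\<close> is $(-1)^e x$.\<close>

definition signed :: "('a, 'e) ring_scheme \<Rightarrow> int \<Rightarrow> 'a \<Rightarrow> 'a" where
  "signed V e x = (if even e then x else \<ominus>\<^bsub>V\<^esub> x)"

locale graded_comm_algebra = graded_module F A + ring A
  for F :: "('f, 'm) ring_scheme" and A :: "('f, 'a, 'e) graded_scheme" +
  assumes smult_mult_left: "\<And>c x y. \<lbrakk>c \<in> carrier F; x \<in> carrier A; y \<in> carrier A\<rbrakk>
      \<Longrightarrow> (c \<odot>\<^bsub>A\<^esub> x) \<otimes>\<^bsub>A\<^esub> y = c \<odot>\<^bsub>A\<^esub> (x \<otimes>\<^bsub>A\<^esub> y)"
    and smult_mult_right: "\<And>c x y. \<lbrakk>c \<in> carrier F; x \<in> carrier A; y \<in> carrier A\<rbrakk>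
      \<Longrightarrow> x \<otimes>\<^bsub>A\<^esub> (c \<odot>\<^bsub>A\<^esub> y) = c \<odot>\<^bsub>A\<^esub> (x \<otimes>\<^bsub>A\<^esub> y)"
    and one_grade: "\<one>\<^bsub>A\<^esub> \<in> grade A 0"
    and mult_grade: "\<And>k l x y. \<lbrakk>x \<in> grade A k; y \<in> grade A l\<rbrakk>
      \<Longrightarrow> x \<otimes>\<^bsub>A\<^esub> y \<in> grade A (k + l)"
    and graded_comm: "\<And>k l x y. \<lbrakk>x \<in> grade A k; y \<in> grade A l\<rbrakk>
      \<Longrightarrow> x \<otimes>\<^bsub>A\<^esub> y = signed A (k * l) (y \<otimes>\<^bsub>A\<^esub> x)"

text \<open>DGCAs are concentrated in non-negative degrees.\<close>

locale dgca = graded_comm_algebra F A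
  for F :: "('f, 'm) ring_scheme" and A :: "('f, 'a) dga" +
  assumes nonneg_graded: "\<And>k. k < 0 \<Longrightarrow> grade A k = {\<zero>\<^bsub>A\<^esub>}"
    and diff_linear: "linear_map F A A (diff A)"
    and diff_grade: "\<And>k x. x \<in> grade A k \<Longrightarrow> diff A x \<in> grade A (k + 1)"
    and diff_diff: "\<And>x. x \<in> carrier A \<Longrightarrow> diff A (diff A x) = \<zero>\<^bsub>A\<^esub>"
    and Leibniz: "\<And>k x y. \<lbrakk>x \<in> grade A k; y \<in> carrier A\<rbrakk>
      \<Longrightarrow> diff A (x \<otimes>\<^bsub>A\<^esub> y) = diff A x \<otimes>\<^bsub>A\<^esub> y \<oplus>\<^bsub>A\<^esub> signed A k (x \<otimes>\<^bsub>A\<^esub> diff A y)"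


section \<open>Quotients and cohomology\<close>

text \<open>\<open>R Quot I\<close> together with the induced scalar multiplication.\<close>

definition quot_alg :: "('f, 'a, 'e) module_scheme \<Rightarrow> 'a set \<Rightarrow> ('f, 'a set) module" where
  "quot_alg R I =
     \<lparr>carrier = carrier (R Quot I), mult = mult (R Quot I), one = one (R Quot I),
      zero = zero (R Quot I), add = add (R Quot I),
      smult = (\<lambda>c X. \<Union>x\<in>X. I +>\<^bsub>R\<^esub> (c \<odot>\<^bsub>R\<^esub> x))\<rparr>"

definition cocycles :: "('a, 'e) ring_scheme \<Rightarrow> ('a \<Rightarrow> 'a) \<Rightarrow> 'a set" where
  "cocycles V d = {x \<in> carrier V. d x = \<zero>\<^bsub>V\<^esub>}"

definition coboundaries :: "('a, 'e) ring_scheme \<Rightarrow> ('a \<Rightarrow> 'a) \<Rightarrow> 'a set" where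
  "coboundaries V d = d ` carrier V"

definition coh_space ::
  "('f, 'a, 'e) module_scheme \<Rightarrow> ('a \<Rightarrow> 'a) \<Rightarrow> ('f, 'a set) module" where
  "coh_space V d = quot_alg (V\<lparr>carrier := cocycles V d\<rparr>) (coboundaries V d)"

definition coh_map ::
  "('b, 'g) ring_scheme \<Rightarrow> ('b \<Rightarrow> 'b) \<Rightarrow> ('a \<Rightarrow> 'b) \<Rightarrow> 'a set \<Rightarrow> 'b set" where
  "coh_map W e f X = (\<Union>x\<in>X. coboundaries W e +>\<^bsub>W\<^esub> f x)"

definition coh_class :: "('f, 'a) dga \<Rightarrow> 'a \<Rightarrow> 'a set" where
  "coh_class A x = coboundaries A (diff A) +>\<^bsub>A\<^esub> x"

text \<open>The cohomology algebra, regarded as a DGCA with zero differential.\<close>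

definition cohomology :: "('f, 'a) dga \<Rightarrow> ('f, 'a set) dga" where
  "cohomology A = (let H = coh_space A (diff A) in
     \<lparr>carrier = carrier H, mult = mult H, one = one H, zero = zero H, add = add H,
      smult = smult H,
      grade = (\<lambda>k. coh_class A ` (cocycles A (diff A) \<inter> grade A k)),
      diff = (\<lambda>_. zero H)\<rparr>)"

abbreviation closed_subalgebra :: "('f, 'a) dga \<Rightarrow> ('f, 'a) dga" where
  "closed_subalgebra A \<equiv> restrict_graded A (cocycles A (diff A))"


section \<open>Equivalence and formality\<close>

definition alg_hom ::
  "('f, 'm) ring_scheme \<Rightarrow> ('f, 'a, 'e) module_scheme \<Rightarrow> ('f, 'b, 'g) module_scheme
    \<Rightarrow> ('a \<Rightarrow> 'b) \<Rightarrow> bool" where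
  "alg_hom F R S f \<longleftrightarrow> f \<in> ring_hom R S \<and> linear_map F R S f"

definition dgca_hom ::
  "('f, 'm) ring_scheme \<Rightarrow> ('f, 'a) dga \<Rightarrow> ('f, 'b) dga \<Rightarrow> ('a \<Rightarrow> 'b) \<Rightarrow> bool" where
  "dgca_hom F A B f \<longleftrightarrow>
     dgca F A \<and> dgca F B \<and> alg_hom F A B f \<and>
     (\<forall>k. f ` grade A k \<subseteq> grade B k) \<and>
     (\<forall>x\<in>carrier A. f (diff A x) = diff B (f x))"

definition quasi_iso ::
  "('f, 'm) ring_scheme \<Rightarrow> ('f, 'a) dga \<Rightarrow> ('f, 'b) dga \<Rightarrow> ('a \<Rightarrow> 'b) \<Rightarrow> bool" where
  "quasi_iso F A B f \<longleftrightarrow>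
     dgca_hom F A B f \<and>
     bij_betw (coh_map B (diff B) f) (carrier (cohomology A)) (carrier (cohomology B))"

definition quasi_iso_related ::
  "('f, 'm) ring_scheme \<Rightarrow> ('f, 'a) dga \<Rightarrow> ('f, 'b) dga \<Rightarrow> bool" where
  "quasi_iso_related F A B \<longleftrightarrow> (\<exists>f. quasi_iso F A B f) \<or> (\<exists>f. quasi_iso F B A f)"

text \<open>
  HOL cannot quantify over the carrier types of the DGCAs occurring in a zig-zag, so they are taken
  over one fixed type.  This is no restriction: every zig-zag between \<open>A\<close> and \<open>B\<close> can be
  replaced by \<open>A \<leftarrow> C \<rightarrow> B\<close> with \<open>C\<close> a cofibrant replacement of \<open>A\<close>, whose cardinality is at
  most that of \<open>A \<times> F\<close> (\<open>F\<close> is infinite).  The type used here has room for isomorphic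
  copies of \<open>C\<close>, \<open>A\<close> and \<open>B\<close>.
\<close>

definition equivalent :: "('f, 'm) ring_scheme \<Rightarrow> ('f, 'a) dga \<Rightarrow> ('f, 'b) dga \<Rightarrow> bool" where
  "equivalent F A B \<longleftrightarrow>
     (\<exists>X Y :: ('f, ('f + 'a + 'b) set) dga.
        quasi_iso_related F A X \<and> (quasi_iso_related F)\<^sup>*\<^sup>* X Y \<and> quasi_iso_related F Y B)"

definition formal :: "('f, 'm) ring_scheme \<Rightarrow> ('f, 'a) dga \<Rightarrow> bool" where
  "formal F A \<longleftrightarrow> equivalent F A (cohomology A)"

text \<open>\<open>connected_upto F A s\<close>: \<open>A\<close> is \<open>s\<close>-connected.\<close>

definition connected_upto :: "('f, 'm) ring_scheme \<Rightarrow> ('f, 'a) dga \<Rightarrow> nat \<Rightarrow> bool" where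
  "connected_upto F A s \<longleftrightarrow>
     (\<exists>f. linear_functional_on F (cohomology A) (grade (cohomology A) 0) f \<and>
          bij_betw f (grade (cohomology A) 0) (carrier F)) \<and>
     (\<forall>k. 1 \<le> k \<and> k \<le> int s \<longrightarrow> grade (cohomology A) k = {\<zero>\<^bsub>cohomology A\<^esub>})"


section \<open>Poincar\'e DGCAs and Hodge type decompositions\<close>

text \<open>
  The bilinear extension of $\langle\alpha^k,\beta^l\rangle = \int\alpha^k\beta^l$ if $k+l=n$, and
  $0$ otherwise: it only sees the degree \<open>n\<close> component of the product.
\<close>

definition pairing ::
  "('f, 'a, 'e) graded_scheme \<Rightarrow> nat \<Rightarrow> ('a \<Rightarrow> 'f) \<Rightarrow> 'a \<Rightarrow> 'a \<Rightarrow> 'f" where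
  "pairing A n I x y = I (component A (int n) (x \<otimes>\<^bsub>A\<^esub> y))"

definition poincare_algebra ::
  "('f, 'm) ring_scheme \<Rightarrow> ('f, 'a, 'e) graded_scheme \<Rightarrow> nat \<Rightarrow> ('a \<Rightarrow> 'f) \<Rightarrow> bool" where
  "poincare_algebra F H n I \<longleftrightarrow>
     graded_comm_algebra F H \<and> finite_dim F H \<and>
     (\<forall>k. k < 0 \<or> int n < k \<longrightarrow> grade H k = {\<zero>\<^bsub>H\<^esub>}) \<and>
     linear_functional_on F H (grade H (int n)) I \<and>
     (\<forall>x\<in>carrier H. (\<forall>y\<in>carrier H. pairing H n I x y = \<zero>\<^bsub>F\<^esub>) \<longrightarrow> x = \<zero>\<^bsub>H\<^esub>) \<and>
     (\<forall>y\<in>carrier H. (\<forall>x\<in>carrier H. pairing H n I x y = \<zero>\<^bsub>F\<^esub>) \<longrightarrow> y = \<zero>\<^bsub>H\<^esub>)"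

definition poincare_dgca ::
  "('f, 'm) ring_scheme \<Rightarrow> ('f, 'a) dga \<Rightarrow> nat \<Rightarrow> ('a set \<Rightarrow> 'f) \<Rightarrow> bool" where
  "poincare_dgca F A n I \<longleftrightarrow>
     dgca F A \<and> (\<forall>k. int n < k \<longrightarrow> grade A k = {\<zero>\<^bsub>A\<^esub>}) \<and>
     poincare_algebra F (cohomology A) n I"

text \<open>The class below is defined because all elements of degree \<open>n\<close> are closed.\<close>

definition dgca_pairing ::
  "('f, 'a) dga \<Rightarrow> nat \<Rightarrow> ('a set \<Rightarrow> 'f) \<Rightarrow> 'a \<Rightarrow> 'a \<Rightarrow> 'f" where
  "dgca_pairing A n I = pairing A n (\<lambda>x. I (coh_class A x))"

definition harmonic_subspace :: "('f, 'm) ring_scheme \<Rightarrow> ('f, 'a) dga \<Rightarrow> 'a set \<Rightarrow> bool" where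
  "harmonic_subspace F A H \<longleftrightarrow>
     graded_subspace F A H \<and>
     direct_sum A (cocycles A (diff A)) (coboundaries A (diff A)) H"

definition hodge_decomposition ::
  "('f, 'm) ring_scheme \<Rightarrow> ('f, 'a) dga \<Rightarrow> nat \<Rightarrow> ('a set \<Rightarrow> 'f) \<Rightarrow> 'a set \<Rightarrow> 'a set \<Rightarrow> bool" where
  "hodge_decomposition F A n I H B \<longleftrightarrow>
     harmonic_subspace F A H \<and> graded_subspace F A B \<and>
     direct_sum A (carrier A) (coboundaries A (diff A) <+>\<^bsub>A\<^esub> H) B \<and>
     (\<forall>x \<in> H <+>\<^bsub>A\<^esub> B. \<forall>y\<in>B. dgca_pairing A n I x y = \<zero>\<^bsub>F\<^esub>)"


section \<open>Generating subspaces and adapted harmonic subspaces\<close>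

text \<open>For non-negatively graded \<open>V\<close>, this is $\bigoplus_{k\ge 1} V^k$.\<close>

definition positive_part :: "('f, 'a, 'e) graded_scheme \<Rightarrow> 'a set" where
  "positive_part V = {x \<in> carrier V. \<forall>k\<le>0. component V k x = \<zero>\<^bsub>V\<^esub>}"

definition generating_subspace ::
  "('f, 'm) ring_scheme \<Rightarrow> ('f, 'a, 'e) graded_scheme \<Rightarrow> 'a set \<Rightarrow> bool" where
  "generating_subspace F H G \<longleftrightarrow>
     graded_subspace F H G \<and> G \<subseteq> positive_part H \<and>
     direct_sum H (positive_part H) G (positive_part H \<cdot>\<^bsub>H\<^esub> positive_part H)"

text \<open>
  The graded symmetric algebra of \<open>V\<close> is the tensor algebra modulo graded commutativity.  It is
  presented as the free algebra on the set \<open>carrier V\<close> (finitely supported functions on words)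
  modulo linearity of \<open>v \<mapsto> [v]\<close> and graded commutativity.
\<close>

definition free_alg :: "('f, 'm) ring_scheme \<Rightarrow> 'a set \<Rightarrow> ('f, 'a list \<Rightarrow> 'f) module" where
  "free_alg F X =
     \<lparr>carrier = {p. finite {w. p w \<noteq> \<zero>\<^bsub>F\<^esub>} \<and>
                   (\<forall>w. p w \<in> carrier F \<and> (p w \<noteq> \<zero>\<^bsub>F\<^esub> \<longrightarrow> set w \<subseteq> X))},
      mult = (\<lambda>p q w. \<Oplus>\<^bsub>F\<^esub>i\<in>{..length w}. p (take i w) \<otimes>\<^bsub>F\<^esub> q (drop i w)),
      one = (\<lambda>w. if w = [] then \<one>\<^bsub>F\<^esub> else \<zero>\<^bsub>F\<^esub>),
      zero = (\<lambda>w. \<zero>\<^bsub>F\<^esub>),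
      add = (\<lambda>p q w. p w \<oplus>\<^bsub>F\<^esub> q w),
      smult = (\<lambda>c p w. c \<otimes>\<^bsub>F\<^esub> p w)\<rparr>"

definition word :: "('f, 'm) ring_scheme \<Rightarrow> 'a list \<Rightarrow> 'a list \<Rightarrow> 'f" where
  "word F w = (\<lambda>u. if u = w then \<one>\<^bsub>F\<^esub> else \<zero>\<^bsub>F\<^esub>)"

definition sym_ideal ::
  "('f, 'm) ring_scheme \<Rightarrow> ('f, 'a, 'e) graded_scheme \<Rightarrow> ('a list \<Rightarrow> 'f) set" where
  "sym_ideal F V = (let T = free_alg F (carrier V) in
     genideal T
      ({word F [x \<oplus>\<^bsub>V\<^esub> y] \<ominus>\<^bsub>T\<^esub> (word F [x] \<oplus>\<^bsub>T\<^esub> word F [y]) | x y.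
          x \<in> carrier V \<and> y \<in> carrier V} \<union>
       {word F [c \<odot>\<^bsub>V\<^esub> x] \<ominus>\<^bsub>T\<^esub> c \<odot>\<^bsub>T\<^esub> word F [x] | c x.
          c \<in> carrier F \<and> x \<in> carrier V} \<union>
       {word F [x, y] \<ominus>\<^bsub>T\<^esub> signed T (k * l) (word F [y, x]) | k l x y.
          x \<in> grade V k \<and> y \<in> grade V l}))"

definition sym_alg ::
  "('f, 'm) ring_scheme \<Rightarrow> ('f, 'a, 'e) graded_scheme \<Rightarrow> ('f, ('a list \<Rightarrow> 'f) set) module" where
  "sym_alg F V = quot_alg (free_alg F (carrier V)) (sym_ideal F V)"

definition sym_embed ::
  "('f, 'm) ring_scheme \<Rightarrow> ('f, 'a, 'e) graded_scheme \<Rightarrow> 'a \<Rightarrow> ('a list \<Rightarrow> 'f) set" where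
  "sym_embed F V x = sym_ideal F V +>\<^bsub>free_alg F (carrier V)\<^esub> word F [x]"

definition partial_splitting ::
  "('f, 'm) ring_scheme \<Rightarrow> ('f, 'a) dga \<Rightarrow> 'a set set \<Rightarrow> ('a set \<Rightarrow> 'a) \<Rightarrow> bool" where
  "partial_splitting F A G i0 \<longleftrightarrow>
     linear_map F (restrict_graded (cohomology A) G) (closed_subalgebra A) i0 \<and>
     (\<forall>k. i0 ` (grade (cohomology A) k \<inter> G) \<subseteq> grade A k) \<and>
     (\<forall>x\<in>G. coh_class A (i0 x) = x)"

text \<open>\<open>\<phi>\<close> is the (unique) extension of \<open>i0\<close> to an algebra morphism on the symmetric algebra.\<close>

definition adapted ::
  "('f, 'm) ring_scheme \<Rightarrow> ('f, 'a) dga \<Rightarrow> 'a set set \<Rightarrow> ('a set \<Rightarrow> 'a) \<Rightarrow> 'a set \<Rightarrow> bool" where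
  "adapted F A G i0 H \<longleftrightarrow>
     (let S = sym_alg F (restrict_graded (cohomology A) G) in
      \<exists>\<phi> i. alg_hom F S (closed_subalgebra A) \<phi> \<and>
        (\<forall>x\<in>G. \<phi> (sym_embed F (restrict_graded (cohomology A) G) x) = i0 x) \<and>
        linear_map F (cohomology A) (closed_subalgebra A) i \<and>
        (\<forall>x\<in>carrier (cohomology A). coh_class A (i x) = x) \<and>
        (\<forall>x\<in>G. i x = i0 x) \<and>
        i ` carrier (cohomology A) \<subseteq> \<phi> ` carrier S \<and>
        H = i ` carrier (cohomology A))"


section \<open>\<open>A\<^sub>\<infinity>\<close>-algebras\<close>

text \<open>
  A \<open>k\<close>-ary operation is a function on lists, of which only the values on lists of length \<open>k\<close>
  matter.  The identities are stated on homogeneous elements \<open>xs\<close> of degrees \<open>ds\<close>, with Keller's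
  signs: \[\sum_{r+s+t=N} (-1)^{r+st}\, m_{r+1+t}(1^{\otimes r}\otimes m_s\otimes 1^{\otimes t}) = 0\]
  and \[\sum_{r+s+t=N} (-1)^{r+st} f_{r+1+t}(1^{\otimes r}\otimes m_s\otimes 1^{\otimes t})
  = \sum_{i_1+\dots+i_q=N} (-1)^{\epsilon}\, m'_q(f_{i_1}\otimes\dots\otimes f_{i_q}),\qquad
  \epsilon = \sum_j (q-j)(i_j-1).\]  Evaluation on elements contributes the Koszul signs
  $(f\otimes g)(x\otimes y) = (-1)^{|g||x|} f(x)\otimes g(y)$, where $|m_s| = 2-s$, $|f_i| = 1-i$.
\<close>

definition homogeneous :: "('f, 'a, 'e) graded_scheme \<Rightarrow> 'a list \<Rightarrow> int list \<Rightarrow> bool" where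
  "homogeneous V xs ds \<longleftrightarrow> list_all2 (\<lambda>x p. x \<in> grade V p) xs ds"

definition multilinear ::
  "('f, 'm) ring_scheme \<Rightarrow> nat \<Rightarrow> ('f, 'a, 'e) module_scheme \<Rightarrow> ('f, 'b, 'g) module_scheme
    \<Rightarrow> ('a list \<Rightarrow> 'b) \<Rightarrow> bool" where
  "multilinear F k V W f \<longleftrightarrow>
     (\<forall>xs. length xs = k \<and> set xs \<subseteq> carrier V \<longrightarrow>
        (\<forall>j<k. linear_map F V W (\<lambda>x. f (xs[j := x]))))"

text \<open>\<open>f k\<close> is a linear map \<open>V\<^sup>\<otimes>\<^sup>k \<rightarrow> W\<close> of degree \<open>e - k\<close>, for all \<open>k \<ge> 1\<close>.\<close>

definition multilinear_family ::
  "('f, 'm) ring_scheme \<Rightarrow> int \<Rightarrow> ('f, 'a, 'e) graded_scheme \<Rightarrow> ('f, 'b, 'g) graded_scheme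
    \<Rightarrow> (nat \<Rightarrow> 'a list \<Rightarrow> 'b) \<Rightarrow> bool" where
  "multilinear_family F e V W f \<longleftrightarrow>
     (\<forall>k\<ge>1. multilinear F k V W (f k) \<and>
       (\<forall>xs ds. length xs = k \<and> homogeneous V xs ds
          \<longrightarrow> f k xs \<in> grade W (sum_list ds + e - int k)))"

text \<open>$\sum_{r+s+t=N} (-1)^{r+st}\, g_{r+1+t}(1^{\otimes r}\otimes m_s\otimes 1^{\otimes t})$\<close>

definition insertion_sum ::
  "('b, 'g) ring_scheme \<Rightarrow> (nat \<Rightarrow> 'a list \<Rightarrow> 'b) \<Rightarrow> (nat \<Rightarrow> 'a list \<Rightarrow> 'a)
    \<Rightarrow> nat \<Rightarrow> 'a list \<Rightarrow> int list \<Rightarrow> 'b" where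
  "insertion_sum W g m N xs ds =
     finsum W
       (\<lambda>(r, s, t). signed W (int r + int s * int t + int s * sum_list (take r ds))
          (g (r + 1 + t) (take r xs @ [m s (take s (drop r xs))] @ drop (r + s) xs)))
       {(r, s, t). r + s + t = N \<and> 1 \<le> s}"

definition a_inf_algebra ::
  "('f, 'm) ring_scheme \<Rightarrow> ('f, 'a, 'e) graded_scheme \<Rightarrow> (nat \<Rightarrow> 'a list \<Rightarrow> 'a) \<Rightarrow> bool" where
  "a_inf_algebra F V m \<longleftrightarrow>
     graded_module F V \<and> multilinear_family F 2 V V m \<and>
     (\<forall>N\<ge>1. \<forall>xs ds. length xs = N \<and> homogeneous V xs ds
        \<longrightarrow> insertion_sum V m m N xs ds = \<zero>\<^bsub>V\<^esub>)"

definition a3_algebra ::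
  "('f, 'm) ring_scheme \<Rightarrow> ('f, 'a, 'e) graded_scheme \<Rightarrow> (nat \<Rightarrow> 'a list \<Rightarrow> 'a) \<Rightarrow> bool" where
  "a3_algebra F V m \<longleftrightarrow>
     a_inf_algebra F V m \<and>
     (\<forall>k\<ge>4. \<forall>xs. length xs = k \<and> set xs \<subseteq> carrier V \<longrightarrow> m k xs = \<zero>\<^bsub>V\<^esub>)"

definition dga_operations :: "('f, 'a) dga \<Rightarrow> nat \<Rightarrow> 'a list \<Rightarrow> 'a" where
  "dga_operations A k xs =
     (if k = 1 then diff A (xs ! 0) else if k = 2 then xs ! 0 \<otimes>\<^bsub>A\<^esub> xs ! 1 else \<zero>\<^bsub>A\<^esub>)"

fun split_blocks :: "nat list \<Rightarrow> 'a list \<Rightarrow> 'a list list" where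
  "split_blocks [] xs = []"
| "split_blocks (i # js) xs = take i xs # split_blocks js (drop i xs)"

definition block_sum ::
  "('b, 'g) ring_scheme \<Rightarrow> (nat \<Rightarrow> 'b list \<Rightarrow> 'b) \<Rightarrow> (nat \<Rightarrow> 'a list \<Rightarrow> 'b)
    \<Rightarrow> nat \<Rightarrow> 'a list \<Rightarrow> int list \<Rightarrow> 'b" where
  "block_sum W m' f N xs ds =
     finsum W
       (\<lambda>is. signed W
          (\<Sum>j<length is. (int (length is) - 1 - int j) * (int (is ! j) - 1)
                          + (int (is ! j) - 1) * sum_list (take (sum_list (take j is)) ds))
          (m' (length is) (map (\<lambda>b. f (length b) b) (split_blocks is xs))))
       {is. (\<forall>i\<in>set is. 1 \<le> i) \<and> sum_list is = N}"

definition a_inf_morphism ::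
  "('f, 'm) ring_scheme \<Rightarrow> ('f, 'a, 'e) graded_scheme \<Rightarrow> (nat \<Rightarrow> 'a list \<Rightarrow> 'a)
    \<Rightarrow> ('f, 'b, 'g) graded_scheme \<Rightarrow> (nat \<Rightarrow> 'b list \<Rightarrow> 'b) \<Rightarrow> (nat \<Rightarrow> 'a list \<Rightarrow> 'b) \<Rightarrow> bool" where
  "a_inf_morphism F V m W m' f \<longleftrightarrow>
     a_inf_algebra F V m \<and> a_inf_algebra F W m' \<and> multilinear_family F 1 V W f \<and>
     (\<forall>N\<ge>1. \<forall>xs ds. length xs = N \<and> homogeneous V xs ds
        \<longrightarrow> insertion_sum W f m N xs ds = block_sum W m' f N xs ds)"

definition a_inf_quasi_iso ::
  "('f, 'm) ring_scheme \<Rightarrow> ('f, 'a, 'e) graded_scheme \<Rightarrow> (nat \<Rightarrow> 'a list \<Rightarrow> 'a)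
    \<Rightarrow> ('f, 'b, 'g) graded_scheme \<Rightarrow> (nat \<Rightarrow> 'b list \<Rightarrow> 'b) \<Rightarrow> (nat \<Rightarrow> 'a list \<Rightarrow> 'b) \<Rightarrow> bool" where
  "a_inf_quasi_iso F V m W m' f \<longleftrightarrow>
     a_inf_morphism F V m W m' f \<and>
     bij_betw (coh_map W (\<lambda>x. m' 1 [x]) (\<lambda>x. f 1 [x]))
       (carrier (coh_space V (\<lambda>x. m 1 [x]))) (carrier (coh_space W (\<lambda>x. m' 1 [x])))"

text \<open>Over a field this relation is symmetric and transitive, so no zig-zag is needed.\<close>

definition a_inf_quasi_isomorphic ::
  "('f, 'm) ring_scheme \<Rightarrow> ('f, 'a, 'e) graded_scheme \<Rightarrow> (nat \<Rightarrow> 'a list \<Rightarrow> 'a)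
    \<Rightarrow> ('f, 'b, 'g) graded_scheme \<Rightarrow> (nat \<Rightarrow> 'b list \<Rightarrow> 'b) \<Rightarrow> bool" where
  "a_inf_quasi_isomorphic F V m W m' \<longleftrightarrow> (\<exists>f. a_inf_quasi_iso F V m W m' f)"

end

(* The harmonic subspace H carries the homotopy transferred structure for the contraction (P, h) of
   A onto H that a Hodge type decomposition provides: h inverts d on d A and vanishes on H and B.
   Instead of summing over trees, one solves the twisting cochain equation d tau = tau D + tau * tau
   recursively, by tau = h (tau * tau) and D = - P (tau * tau); the obstruction at each word length is
   closed, and is killed by h and P, hence zero.  Degrees do the rest.  All arguments of m_k may be
   assumed to have degree at least r, since m_k vanishes on units for k > 2; its values then have
   degree at least k (r - 1) + 2 > n - r, where H lives only in degree n, and the component in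
   degree n vanishes because B is orthogonal to H + B.  The same orthogonality shows that, for
   n <= 4 r - 2, the map [P] is multiplicative on the subalgebra of A that is H in degrees below
   2 r - 1, H + B in degree 2 r - 1 and A above; this subalgebra has the cohomology of A, so A is
   formal without any rectification of the A-infinity quasi-isomorphism. *)

theory Submission
  imports Defs
begin

section \<open>Sums over the splittings of a word\<close>

text \<open>The bounds \<open>5 * r - 3\<close> and \<open>4 * r - 2\<close> are the inequality
  \<open>k * (r - 1) + 2 > n - r\<close> for \<open>k = 4\<close> and \<open>k = 3\<close>. Its
  right-hand side comes from Poincare duality, which turns connectedness into the vanishing of
  \<open>H\<close> strictly between the degrees \<open>n - r\<close> and \<open>n\<close>. Signs
  shape the construction. On suspended words the A_infinity relations say that an odd coderivation
  squares to zero, and one parity operator carries every sign. Keller's relations differ from this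
  by signs depending on the degrees of the arguments, while multilinearity is also required on
  inhomogeneous elements. So these signs are produced by powers of the grading involution acting on
  the letters, and are compared only on homogeneous words. For formality, the difficulty is that the
  harmonic projection is in general not multiplicative on \<open>A\<close>. The subalgebra is a
  compromise: small enough for the kernel of the projection to be an ideal in it, yet closed under
  the homotopy, so that a closed element of that kernel has a primitive inside the
  subalgebra.\<close>

primrec splits_sum :: "('b, 'g) ring_scheme \<Rightarrow> 'a list \<Rightarrow> ('a list \<Rightarrow> 'a list \<Rightarrow> 'b) \<Rightarrow> 'b" where
  "splits_sum W [] K = K [] []"
| "splits_sum W (x # w) K = K [] (x # w) \<oplus>\<^bsub>W\<^esub> splits_sum W w (\<lambda>u v. K (x # u) v)"

text \<open>
  \<open>insert_op W s b w \<phi>\<close> is the sum of \<open>\<phi> (map s u @ [b v] @ t)\<close> over \<open>w = u @ v @ t\<close> with \<open>v \<noteq> []\<close>: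
  the composition of \<open>\<phi>\<close> with the coderivation of the tensor coalgebra induced by \<open>b\<close>, the map \<open>s\<close>
  providing the Koszul signs of moving \<open>b\<close> past \<open>u\<close>.
\<close>

primrec insert_op ::
  "('b, 'g) ring_scheme \<Rightarrow> ('a \<Rightarrow> 'a) \<Rightarrow> ('a list \<Rightarrow> 'a) \<Rightarrow> 'a list \<Rightarrow> ('a list \<Rightarrow> 'b) \<Rightarrow> 'b" where
  "insert_op W s b [] \<phi> = \<zero>\<^bsub>W\<^esub>"
| "insert_op W s b (x # w) \<phi> =
     splits_sum W w (\<lambda>u v. \<phi> (b (x # u) # v)) \<oplus>\<^bsub>W\<^esub> insert_op W s b w (\<lambda>v. \<phi> (s x # v))"

text \<open>As a congruence rule for recursive definitions it hands \<open>u @ v = w\<close> to the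
  termination proof of \<open>\<tau>\<close>, whose guard then makes both parts shorter than
  \<open>w\<close>.\<close>

lemma splits_sum_cong [fundef_cong]:
  assumes "w = w'" and "\<And>u v. u @ v = w' \<Longrightarrow> K u v = K' u v"
  shows "splits_sum W w K = splits_sum W w' K'"
proof -
  have "(\<And>u v. u @ v = w \<Longrightarrow> K u v = K' u v) \<Longrightarrow> splits_sum W w K = splits_sum W w K'"
  proof (induction w arbitrary: K K')
    case (Cons x w)
    have "splits_sum W w (\<lambda>u v. K (x # u) v) = splits_sum W w (\<lambda>u v. K' (x # u) v)"
      by (rule Cons.IH) (simp add: Cons.prems)
    then show ?case by (simp add: Cons.prems)
  qed simp
  with assms show ?thesis by simp
qed

context abelian_group
begin

text \<open>In both later uses \<open>c\<close> collects cross terms that arise twice with opposite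
  signs: insertions at disjoint places in \<open>insert_op_insert_op\<close>, and threefold products
  in \<open>d_\<Lambda>\<close>.\<close>

lemma add_cancel_across:
  assumes "a \<in> carrier G" "b \<in> carrier G" "c \<in> carrier G" "e \<in> carrier G"
  shows "(a \<oplus> c) \<oplus> ((b \<oplus> \<ominus> c) \<oplus> e) = (a \<oplus> b) \<oplus> e"
proof -
  have "(a \<oplus> c) \<oplus> ((b \<oplus> \<ominus> c) \<oplus> e) = (c \<oplus> \<ominus> c) \<oplus> ((a \<oplus> b) \<oplus> e)"
    using assms by (simp add: a_ac)
  then show ?thesis using assms by (simp add: r_neg)
qed

lemma additive_zero_minus:
  assumes "\<And>x. x \<in> carrier G \<Longrightarrow> g x \<in> carrier G"
    and "\<And>x y. \<lbrakk>x \<in> carrier G; y \<in> carrier G\<rbrakk> \<Longrightarrow> g (x \<oplus> y) = g x \<oplus> g y"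
  shows "g \<zero> = \<zero>" and "x \<in> carrier G \<Longrightarrow> g (\<ominus> x) = \<ominus> g x"
proof -
  show *: "g \<zero> = \<zero>" using assms(1)[of \<zero>] assms(2)[of \<zero> \<zero>] by (simp add: add.r_cancel_one')
  show "g (\<ominus> x) = \<ominus> g x" if "x \<in> carrier G"
    using assms(1)[of "\<ominus> x"] assms(1)[of x] assms(2)[of "\<ominus> x" x] that *
    by (simp add: l_neg minus_equality)
qed

lemma splits_sum_closed [simp]: "(\<And>u v. K u v \<in> carrier G) \<Longrightarrow> splits_sum G w K \<in> carrier G"
  by (induction w arbitrary: K) auto

text \<open>Closure under addition suffices, since even the empty word has one splitting and the sum
  is never empty. Later \<open>S\<close> is a graded piece, or the part of it or of the carrier that
  given additive maps annihilate.\<close>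

lemma splits_sum_mem:
  assumes "\<And>x y. x \<in> S \<Longrightarrow> y \<in> S \<Longrightarrow> x \<oplus> y \<in> S" and "\<And>u v. u @ v = w \<Longrightarrow> K u v \<in> S"
  shows "splits_sum G w K \<in> S"
  using assms(2)
proof (induction w arbitrary: K)
  case (Cons x w)
  have "splits_sum G w (\<lambda>u v. K (x # u) v) \<in> S"
    by (rule Cons.IH) (simp add: Cons.prems)
  then show ?case by (simp add: Cons.prems assms(1))
qed simp

lemma splits_sum_add:
  assumes "\<And>u v. K u v \<in> carrier G" "\<And>u v. L u v \<in> carrier G"
  shows "splits_sum G w (\<lambda>u v. K u v \<oplus> L u v) = splits_sum G w K \<oplus> splits_sum G w L"
  using assms by (induction w arbitrary: K L) (simp_all add: a_ac)

lemma splits_sum_zero: "splits_sum G w (\<lambda>u v. \<zero>) = \<zero>"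
  by (induction w) simp_all

lemma splits_sum_eq_zero:
  "(\<And>u v. u @ v = w \<Longrightarrow> K u v = \<zero>) \<Longrightarrow> splits_sum G w K = \<zero>"
  using splits_sum_cong[of w w K "\<lambda>u v. \<zero>" G] by (simp add: splits_sum_zero)

lemma splits_sum_last:
  assumes "\<And>u v. K u v \<in> carrier G" "\<And>u v. u @ v = w \<Longrightarrow> v \<noteq> [] \<Longrightarrow> K u v = \<zero>"
  shows "splits_sum G w K = K w []"
  using assms
proof (induction w arbitrary: K)
  case (Cons x w)
  have "splits_sum G w (\<lambda>u v. K (x # u) v) = K (x # w) []"
    by (rule Cons.IH) (auto simp: Cons.prems)
  then show ?case by (simp add: Cons.prems)
qed simp

lemma splits_sum_hom:
  assumes "\<And>u v. K u v \<in> carrier G" "\<And>x. x \<in> carrier G \<Longrightarrow> g x \<in> carrier G"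
    and "\<And>x y. x \<in> carrier G \<Longrightarrow> y \<in> carrier G \<Longrightarrow> g (x \<oplus> y) = g x \<oplus> g y"
  shows "g (splits_sum G w K) = splits_sum G w (\<lambda>u v. g (K u v))"
  using assms(1)
proof (induction w arbitrary: K)
  case (Cons x w)
  then show ?case by (simp add: assms)
qed simp

lemma splits_sum_minus:
  assumes "\<And>u v. K u v \<in> carrier G"
  shows "splits_sum G w (\<lambda>u v. \<ominus> K u v) = \<ominus> splits_sum G w K"
  using splits_sum_hom[of K "\<lambda>x. \<ominus> x", OF assms] by (simp add: minus_add)

text \<open>Coassociativity of deconcatenation: both sides run over the ways to cut the word into
  three parts.\<close>

lemma splits_sum_assoc:
  assumes "\<And>u v w. K u v w \<in> carrier G"
  shows "splits_sum G w (\<lambda>u v. splits_sum G v (\<lambda>v1 v2. K u v1 v2))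
    = splits_sum G w (\<lambda>u v. splits_sum G u (\<lambda>u1 u2. K u1 u2 v))"
  using assms
proof (induction w arbitrary: K)
  case (Cons x w)
  let ?A = "splits_sum G w (\<lambda>u v. K [] (x # u) v)"
  let ?B = "splits_sum G w (\<lambda>u v. splits_sum G u (\<lambda>u1 u2. K (x # u1) u2 v))"
  have "splits_sum G w (\<lambda>u v. splits_sum G v (K (x # u))) = ?B"
    by (rule Cons.IH) (simp add: Cons.prems)
  moreover have "splits_sum G w (\<lambda>u v. K [] (x # u) v \<oplus> splits_sum G u (\<lambda>u1 u2. K (x # u1) u2 v))
      = ?A \<oplus> ?B"
    by (rule splits_sum_add) (simp_all add: Cons.prems)
  ultimately show ?case by (simp add: Cons.prems a_ac)
qed simp

lemma insert_op_closed [simp]: "(\<And>v. \<phi> v \<in> carrier G) \<Longrightarrow> insert_op G s b w \<phi> \<in> carrier G"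
  by (induction w arbitrary: \<phi>) auto

lemma insert_op_add:
  assumes "\<And>v. \<phi> v \<in> carrier G" "\<And>v. \<psi> v \<in> carrier G"
  shows "insert_op G s b w (\<lambda>v. \<phi> v \<oplus> \<psi> v) = insert_op G s b w \<phi> \<oplus> insert_op G s b w \<psi>"
  using assms by (induction w arbitrary: \<phi> \<psi>) (simp_all add: a_ac splits_sum_add)

lemma insert_op_hom:
  assumes "\<And>v. \<phi> v \<in> carrier G" "\<And>x. x \<in> carrier G \<Longrightarrow> g x \<in> carrier G"
    and "\<And>x y. x \<in> carrier G \<Longrightarrow> y \<in> carrier G \<Longrightarrow> g (x \<oplus> y) = g x \<oplus> g y"
  shows "g (insert_op G s b w \<phi>) = insert_op G s b w (\<lambda>v. g (\<phi> v))"
  using assms(1)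
proof (induction w arbitrary: \<phi>)
  case Nil
  have "g \<zero> \<oplus> g \<zero> = g \<zero>" using assms(3)[of \<zero> \<zero>] by simp
  then show ?case using assms(2) by (simp add: add.r_cancel_one)
next
  case (Cons x w)
  then show ?case
    by (simp add: assms splits_sum_hom[of _ g])
qed

text \<open>For \<open>K u v = \<phi> u \<otimes> \<psi> v\<close> this is the Leibniz rule for convolutions of cochains.\<close>

lemma insert_op_splits_sum:
  assumes "\<And>u v. K u v \<in> carrier G"
  shows "insert_op G s b w (\<lambda>w. splits_sum G w K)
    = splits_sum G w (\<lambda>u v. insert_op G s b u (\<lambda>u'. K u' v) \<oplus> insert_op G s b v (K (map s u)))"
  using assms
proof (induction w arbitrary: K)
  case (Cons x w)
  let ?M = "\<lambda>u v. insert_op G s b u (\<lambda>u'. K (s x # u') v) \<oplus> insert_op G s b v (K (s x # map s u))"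
  let ?A = "splits_sum G w (\<lambda>u v. K [] (b (x # u) # v))"
  let ?B = "splits_sum G w (\<lambda>u v. splits_sum G u (\<lambda>u1 u2. K (b (x # u1) # u2) v))"
  let ?C = "insert_op G s b w (\<lambda>v. K [] (s x # v))"
  let ?D = "splits_sum G w ?M"
  note closed = Cons.prems
  have IH: "insert_op G s b w (\<lambda>w. splits_sum G w (\<lambda>u v. K (s x # u) v)) = ?D"
    by (rule Cons.IH) (simp add: closed)
  have B: "splits_sum G w (\<lambda>u v. splits_sum G v (\<lambda>v1 v2. K (b (x # u) # v1) v2)) = ?B"
    by (rule splits_sum_assoc) (simp add: closed)
  have "insert_op G s b (x # w) (\<lambda>w. splits_sum G w K) = (?A \<oplus> ?B) \<oplus> (?C \<oplus> ?D)"
    using closed by (simp add: splits_sum_add insert_op_add IH B)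
  moreover have "splits_sum G (x # w)
      (\<lambda>u v. insert_op G s b u (\<lambda>u'. K u' v) \<oplus> insert_op G s b v (K (map s u)))
      = (\<zero> \<oplus> (?A \<oplus> ?C)) \<oplus> splits_sum G w (\<lambda>u v. splits_sum G u (\<lambda>u1 u2. K (b (x # u1) # u2) v) \<oplus> ?M u v)"
    using closed by (simp add: a_assoc)
  moreover have "\<dots> = (\<zero> \<oplus> (?A \<oplus> ?C)) \<oplus> (?B \<oplus> ?D)"
    using closed by (subst splits_sum_add) auto
  ultimately show ?case using closed by (simp add: a_ac)
qed simp

lemma insert_op_eq_zero:
  assumes "\<And>u v t. w = u @ v @ t \<Longrightarrow> v \<noteq> [] \<Longrightarrow> \<phi> (map s u @ b v # t) = \<zero>"
  shows "insert_op G s b w \<phi> = \<zero>"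
  using assms
proof (induction w arbitrary: \<phi>)
  case (Cons x w)
  have "insert_op G s b w (\<lambda>v. \<phi> (s x # v)) = \<zero>"
  proof (rule Cons.IH)
    fix u v t assume "w = u @ v @ t" "v \<noteq> []"
    then show "\<phi> (s x # map s u @ b v # t) = \<zero>" using Cons.prems[of "x # u" v t] by simp
  qed
  moreover have "splits_sum G w (\<lambda>u v. \<phi> (b (x # u) # v)) = \<zero>"
  proof (rule splits_sum_eq_zero)
    fix u v assume "u @ v = w"
    then show "\<phi> (b (x # u) # v) = \<zero>" using Cons.prems[of "[]" "x # u" v] by simp
  qed
  ultimately show ?case by simp
qed simp

text \<open>Isolates the term in which \<open>b\<close> swallows the whole word. The other terms
  vanish in the applications either by induction on the length or because
  \<open>p (\<tau> w)\<close> is zero unless \<open>w\<close> is a single letter.\<close>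

lemma insert_op_eq_whole:
  assumes "w \<noteq> []" "\<And>v. \<phi> v \<in> carrier G"
    and "\<And>u v t. w = u @ v @ t \<Longrightarrow> v \<noteq> [] \<Longrightarrow> u \<noteq> [] \<or> t \<noteq> [] \<Longrightarrow> \<phi> (map s u @ b v # t) = \<zero>"
  shows "insert_op G s b w \<phi> = \<phi> [b w]"
proof (cases w)
  case (Cons x w')
  have "insert_op G s b w' (\<lambda>v. \<phi> (s x # v)) = \<zero>"
  proof (rule insert_op_eq_zero)
    fix u v t assume "w' = u @ v @ t" "v \<noteq> []"
    then show "\<phi> (s x # map s u @ b v # t) = \<zero>" using assms(3)[of "x # u" v t] Cons by simp
  qed
  moreover have "splits_sum G w' (\<lambda>u v. \<phi> (b (x # u) # v)) = \<phi> (b (x # w') # [])"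
  proof (rule splits_sum_last)
    fix u v assume "u @ v = w'" "v \<noteq> []"
    then show "\<phi> (b (x # u) # v) = \<zero>" using assms(3)[of "[]" "x # u" v] Cons by simp
  qed (simp add: assms)
  ultimately show ?thesis using Cons assms(2) by simp
qed (simp add: assms(1))

text \<open>
  The square of an odd coderivation is the coderivation induced by \<open>b \<circ> b\<close>; insertions at disjoint
  places cancel because \<open>b\<close> is odd.
\<close>

lemma insert_op_insert_op:
  assumes "\<And>v. \<phi> v \<in> carrier G" "\<And>v. b v \<in> carrier G" "\<And>x. s (s x) = x"
    and "\<And>x. x \<in> carrier G \<Longrightarrow> s x \<in> carrier G"
    and "\<And>u v x y. x \<in> carrier G \<Longrightarrow> y \<in> carrier G \<Longrightarrow>
      \<phi> (u @ (x \<oplus> y) # v) = \<phi> (u @ x # v) \<oplus> \<phi> (u @ y # v)"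
    and "\<And>v. b (map s v) = \<ominus> s (b v)"
  shows "insert_op G s b w (\<lambda>w. insert_op G s b w \<phi>)
    = insert_op G (\<lambda>x. x) (\<lambda>w. insert_op G s b w b) w \<phi>"
  using assms(1,5)
proof (induction w arbitrary: \<phi>)
  case (Cons x w)
  note closed = Cons.prems(1) assms(2)
  have additive: "\<phi> ((y \<oplus> z) # v) = \<phi> (y # v) \<oplus> \<phi> (z # v)"
    if "y \<in> carrier G" "z \<in> carrier G" for y z v
    using Cons.prems(2)[of y z "[]" v] that by simp
  have zero: "\<phi> (\<zero> # v) = \<zero>" for v
    using additive[of \<zero> \<zero> v] closed(1) by (simp add: add.r_cancel_one')
  have minus: "\<phi> (\<ominus> y # v) = \<ominus> \<phi> (y # v)" if "y \<in> carrier G" for y v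
    using additive[of "\<ominus> y" y v] closed(1)[of "\<ominus> y # v"] closed(1)[of "y # v"] that zero[of v]
    by (simp add: l_neg minus_equality)
  \<comment> \<open>Pairs of insertions involving \<open>x\<close> are of three kinds. In
    \<open>?A\<close> and \<open>?B\<close> they are nested, the outer block starts at
    \<open>x\<close>, and the inner block contains \<open>x\<close> or avoids it. In
    \<open>?C\<close> they are disjoint, with the left block starting at \<open>x\<close>; this kind
    arises in two orders, with opposite signs.\<close>
  let ?R = "\<lambda>w. insert_op G s b w b"
  let ?A = "\<lambda>u v. splits_sum G u (\<lambda>u1 u2. \<phi> (b (b (x # u1) # u2) # v))"
  let ?C = "\<lambda>u v. insert_op G s b v (\<lambda>v'. \<phi> (s (b (x # u)) # v'))"
  let ?B = "\<lambda>u v. insert_op G s b u (\<lambda>u'. \<phi> (b (s x # u') # v))"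
  have R: "\<phi> (?R (x # u) # v) = ?A u v \<oplus> ?B u v" for u v
  proof -
    have "\<phi> (?R (x # u) # v) = \<phi> (splits_sum G u (\<lambda>u1 u2. b (b (x # u1) # u2)) # v)
        \<oplus> \<phi> (insert_op G s b u (\<lambda>u'. b (s x # u')) # v)"
      by (simp add: additive closed)
    also have "\<phi> (splits_sum G u (\<lambda>u1 u2. b (b (x # u1) # u2)) # v) = ?A u v"
      by (rule splits_sum_hom) (simp_all add: additive closed)
    also have "\<phi> (insert_op G s b u (\<lambda>u'. b (s x # u')) # v) = ?B u v"
      by (rule insert_op_hom[where g = "\<lambda>z. \<phi> (z # v)"]) (simp_all add: additive closed)
    finally show ?thesis .
  qed
  have C: "insert_op G s b v (\<lambda>v'. \<phi> (b (s x # map s u) # v')) = \<ominus> ?C u v" for u v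
  proof -
    have "b (s x # map s u) = \<ominus> s (b (x # u))" using assms(6)[of "x # u"] by simp
    then have "(\<lambda>v'. \<phi> (b (s x # map s u) # v')) = (\<lambda>v'. \<ominus> \<phi> (s (b (x # u)) # v'))"
      by (simp add: minus closed assms(4))
    then show ?thesis
      using insert_op_hom[of "\<lambda>v'. \<phi> (s (b (x # u)) # v')" "\<lambda>z. \<ominus> z" s b v] closed
      by (simp add: minus_add)
  qed
  have "insert_op G s b w (\<lambda>w. insert_op G s b w (\<lambda>v. \<phi> (s (s x) # v)))
      = insert_op G (\<lambda>x. x) ?R w (\<lambda>v. \<phi> (x # v))" (is "?I = ?J")
    unfolding assms(3)
  proof (rule Cons.IH)
    fix u v y z assume "y \<in> carrier G" "z \<in> carrier G"
    then show "\<phi> (x # u @ (y \<oplus> z) # v) = \<phi> (x # u @ y # v) \<oplus> \<phi> (x # u @ z # v)"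
      using Cons.prems(2)[of y z "x # u" v] by simp
  qed (simp add: closed)
  have "insert_op G s b (x # w) (\<lambda>w. insert_op G s b w \<phi>)
      = (splits_sum G w (\<lambda>u v. splits_sum G v (\<lambda>v1 v2. \<phi> (b (b (x # u) # v1) # v2)))
          \<oplus> splits_sum G w ?C)
        \<oplus> (insert_op G s b w (\<lambda>v. splits_sum G v (\<lambda>v1 v2. \<phi> (b (s x # v1) # v2))) \<oplus> ?I)"
    by (simp add: closed splits_sum_add insert_op_add)
  also have "splits_sum G w (\<lambda>u v. splits_sum G v (\<lambda>v1 v2. \<phi> (b (b (x # u) # v1) # v2)))
      = splits_sum G w ?A"
    by (rule splits_sum_assoc) (simp add: closed)
  also have "insert_op G s b w (\<lambda>v. splits_sum G v (\<lambda>v1 v2. \<phi> (b (s x # v1) # v2)))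
      = splits_sum G w (\<lambda>u v. ?B u v \<oplus> \<ominus> ?C u v)"
    by (subst insert_op_splits_sum) (simp_all add: closed C)
  also have "\<dots> = splits_sum G w ?B \<oplus> \<ominus> splits_sum G w ?C"
    by (subst splits_sum_add) (simp_all add: closed splits_sum_minus)
  also have "?I = ?J" by fact
  also have "(splits_sum G w ?A \<oplus> splits_sum G w ?C)
        \<oplus> ((splits_sum G w ?B \<oplus> \<ominus> splits_sum G w ?C) \<oplus> ?J)
      = (splits_sum G w ?A \<oplus> splits_sum G w ?B) \<oplus> ?J"
    by (rule add_cancel_across) (simp_all add: closed)
  also have "splits_sum G w ?A \<oplus> splits_sum G w ?B
      = splits_sum G w (\<lambda>u v. \<phi> (?R (x # u) # v))"
    by (simp only: R) (subst splits_sum_add, simp_all add: closed)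
  finally show ?case by simp
qed simp

end

section \<open>Homotopy transfer\<close>

text \<open>
  In the application \<open>p\<close> and \<open>h\<close> are the projection and the homotopy of a contraction, and
  \<open>s x = (-1)\<^bsup>p - 1\<^esup> x\<close> for \<open>x\<close> of degree \<open>p\<close> is the parity operator of the suspension.  Words stand
  for tensors of suspended elements, which hides all signs in \<open>s\<close>.  That \<open>p_closed\<close>, \<open>s_s\<close> and \<open>p_s\<close>
  hold for all \<open>x\<close>, not only on the carrier, saves carrier conditions on the letters of words.
\<close>

locale transfer_data = ring A for A (structure) +
  fixes d h p s
  assumes d_closed [simp]: "x \<in> carrier A \<Longrightarrow> d x \<in> carrier A"
    and d_add [simp]: "\<lbrakk>x \<in> carrier A; y \<in> carrier A\<rbrakk> \<Longrightarrow> d (x \<oplus> y) = d x \<oplus> d y"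
    and h_closed [simp]: "x \<in> carrier A \<Longrightarrow> h x \<in> carrier A"
    and h_add [simp]: "\<lbrakk>x \<in> carrier A; y \<in> carrier A\<rbrakk> \<Longrightarrow> h (x \<oplus> y) = h x \<oplus> h y"
    and p_closed [simp]: "p x \<in> carrier A"
    and p_add [simp]: "\<lbrakk>x \<in> carrier A; y \<in> carrier A\<rbrakk> \<Longrightarrow> p (x \<oplus> y) = p x \<oplus> p y"
    and s_closed [simp]: "x \<in> carrier A \<Longrightarrow> s x \<in> carrier A"
    and s_add [simp]: "\<lbrakk>x \<in> carrier A; y \<in> carrier A\<rbrakk> \<Longrightarrow> s (x \<oplus> y) = s x \<oplus> s y"
    and s_s [simp]: "s (s x) = x"
    and s_mult: "\<lbrakk>x \<in> carrier A; y \<in> carrier A\<rbrakk> \<Longrightarrow> s (x \<otimes> y) = \<ominus> (s x \<otimes> s y)"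
    and d_s: "x \<in> carrier A \<Longrightarrow> d (s x) = \<ominus> s (d x)"
    and h_s: "x \<in> carrier A \<Longrightarrow> h (s x) = \<ominus> s (h x)"
    and p_s: "p (s x) = s (p x)"
    and d_mult: "\<lbrakk>x \<in> carrier A; y \<in> carrier A\<rbrakk> \<Longrightarrow> d (x \<otimes> y) = d x \<otimes> y \<oplus> \<ominus> (s x \<otimes> d y)"
    and d_d: "x \<in> carrier A \<Longrightarrow> d (d x) = \<zero>"
    and h_h: "x \<in> carrier A \<Longrightarrow> h (h x) = \<zero>"
    and h_p: "h (p x) = \<zero>"
    and p_h: "x \<in> carrier A \<Longrightarrow> p (h x) = \<zero>"
    and d_p: "d (p x) = \<zero>"
    and p_d: "x \<in> carrier A \<Longrightarrow> p (d x) = \<zero>"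
    and p_p: "p (p x) = p x"
    and h_d_h: "x \<in> carrier A \<Longrightarrow> h (d (h x)) = h x"
    and homotopy: "x \<in> carrier A \<Longrightarrow> x = d (h x) \<oplus> h (d x) \<oplus> p x"
begin

lemmas hom_simps [simp] =
  additive_zero_minus[of d, OF d_closed d_add] additive_zero_minus[of h, OF h_closed h_add]
  additive_zero_minus[of p, OF p_closed p_add] additive_zero_minus[of s, OF s_closed s_add]

function \<tau> where
  "\<tau> w = (if w = [] then \<zero> else if tl w = [] then p (hd w)
     else h (splits_sum A w (\<lambda>u v. if u = [] \<or> v = [] then \<zero> else s (\<tau> u) \<otimes> \<tau> v)))"
  by pat_completeness auto
termination by (relation "measure length") auto

declare \<tau>.simps [simp del]

text \<open>
  The guard in \<open>\<tau>\<close> only serves termination, since \<open>\<tau> [] = \<zero>\<close>.  \<open>\<Lambda>\<close> is the convolution square of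
  the twisting cochain \<open>\<tau>\<close>, and \<open>\<beta>\<close> collects the transferred multiplications.
\<close>

definition \<Lambda> where "\<Lambda> w = splits_sum A w (\<lambda>u v. s (\<tau> u) \<otimes> \<tau> v)"

definition \<beta> where "\<beta> w = \<ominus> p (\<Lambda> w)"

lemma \<tau>_closed [simp]: "\<tau> w \<in> carrier A"
proof (induction w rule: \<tau>.induct)
  case (1 w)
  have "splits_sum A w (\<lambda>u v. if u = [] \<or> v = [] then \<zero> else s (\<tau> u) \<otimes> \<tau> v) \<in> carrier A"
    if "w \<noteq> []" "tl w \<noteq> []"
    by (rule splits_sum_mem) (use 1 that in auto)
  then show ?case by (subst \<tau>.simps) simp
qed

lemma \<Lambda>_closed [simp]: "\<Lambda> w \<in> carrier A"
  unfolding \<Lambda>_def by simp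

lemma \<beta>_closed [simp]: "\<beta> w \<in> carrier A"
  unfolding \<beta>_def by simp

lemma \<tau>_Nil [simp]: "\<tau> [] = \<zero>"
  by (simp add: \<tau>.simps)

lemma \<tau>_single [simp]: "\<tau> [x] = p x"
  by (simp add: \<tau>.simps)

lemma \<tau>_eq: "length w \<ge> 2 \<Longrightarrow> \<tau> w = h (\<Lambda> w)"
  unfolding \<Lambda>_def
  by (subst \<tau>.simps, cases w) (auto intro!: arg_cong[of _ _ h] splits_sum_cong simp del: splits_sum.simps)

lemma length_less_2_cases:
  obtains "w = []" | x where "w = [x]" | "length w \<ge> 2"
  by (metis One_nat_def Suc_1 Suc_leI length_0_conv length_Suc_conv less_2_cases not_le)

lemma h_\<tau> [simp]: "h (\<tau> w) = \<zero>"
  by (rule length_less_2_cases[of w]) (auto simp: \<tau>_eq h_h h_p)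

lemma p_\<tau>: "length w \<noteq> 1 \<Longrightarrow> p (\<tau> w) = \<zero>"
  by (rule length_less_2_cases[of w]) (auto simp: \<tau>_eq p_h)

lemma \<Lambda>_single [simp]: "\<Lambda> [x] = \<zero>"
  by (simp add: \<Lambda>_def)

lemma p_\<beta> [simp]: "p (\<beta> w) = \<beta> w"
  by (simp add: \<beta>_def p_p)

lemma \<beta>_single [simp]: "\<beta> [x] = \<zero>" "\<beta> [] = \<zero>"
  by (simp_all add: \<beta>_def \<Lambda>_def)

lemma splits_sum_map: "splits_sum A (map s w) K = splits_sum A w (\<lambda>u v. K (map s u) (map s v))"
  by (induction w arbitrary: K) simp_all

text \<open>On suspended elements the product and \<open>h\<close> are odd and \<open>p\<close> is
  even. Unfolded into trees, \<open>\<tau>\<close> contains as many products as homotopies, hence is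
  even, while \<open>\<Lambda>\<close> contains one product more.\<close>

lemma map_s_aux: "\<tau> (map s w) = s (\<tau> w) \<and> \<Lambda> (map s w) = \<ominus> s (\<Lambda> w)"
proof (induction w rule: measure_induct_rule[where f = length])
  case (less w)
  have L: "\<Lambda> (map s w) = \<ominus> s (\<Lambda> w)"
  proof -
    have "\<Lambda> (map s w) = splits_sum A w (\<lambda>u v. s (\<tau> (map s u)) \<otimes> \<tau> (map s v))"
      by (simp add: \<Lambda>_def splits_sum_map)
    also have "\<dots> = splits_sum A w (\<lambda>u v. \<ominus> s (s (\<tau> u) \<otimes> \<tau> v))"
    proof (rule splits_sum_cong)
      fix u v assume "u @ v = w"
      then show "s (\<tau> (map s u)) \<otimes> \<tau> (map s v) = \<ominus> s (s (\<tau> u) \<otimes> \<tau> v)"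
        using less(1)[of u] less(1)[of v] by (cases "u = [] \<or> v = []") (auto simp: s_mult)
    qed simp
    also have "\<dots> = \<ominus> s (\<Lambda> w)"
      unfolding \<Lambda>_def by (simp add: splits_sum_minus splits_sum_hom[of _ s])
    finally show ?thesis .
  qed
  show "\<tau> (map s w) = s (\<tau> w) \<and> \<Lambda> (map s w) = \<ominus> s (\<Lambda> w)"
  proof (cases rule: length_less_2_cases[of w])
    case 3
    then show ?thesis using L by (simp add: \<tau>_eq h_s)
  qed (use L in \<open>simp_all add: p_s\<close>)
qed

lemmas \<tau>_map_s = map_s_aux[THEN conjunct1] and \<Lambda>_map_s = map_s_aux[THEN conjunct2]

lemma \<beta>_map_s: "\<beta> (map s w) = \<ominus> s (\<beta> w)"
  by (simp add: \<beta>_def \<Lambda>_map_s p_s)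

section \<open>Linearity in each letter\<close>

lemma splits_sum_letter:
  assumes "\<And>u v. K u v \<in> carrier A"
  shows "splits_sum A (u @ x # v) K
    = splits_sum A u (\<lambda>a b. K a (b @ x # v)) \<oplus> splits_sum A v (\<lambda>a b. K (u @ x # a) b)"
  using assms by (induction u arbitrary: K) (simp_all add: a_assoc)

lemma \<Lambda>_letter:
  "\<Lambda> (u @ x # v) = splits_sum A u (\<lambda>a b. s (\<tau> a) \<otimes> \<tau> (b @ x # v))
    \<oplus> splits_sum A v (\<lambda>a b. s (\<tau> (u @ x # a)) \<otimes> \<tau> b)"
  unfolding \<Lambda>_def by (rule splits_sum_letter) simp

text \<open>Induction on the number of the other letters. A cut with an empty part leaves the word
  as long as before, but contributes zero because \<open>\<tau> [] = \<zero>\<close>, so the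
  hypothesis for shorter words is enough.\<close>

lemma additive_aux:
  assumes "x \<in> carrier A" "y \<in> carrier A"
  shows "\<tau> (u @ (x \<oplus> y) # v) = \<tau> (u @ x # v) \<oplus> \<tau> (u @ y # v)
    \<and> \<Lambda> (u @ (x \<oplus> y) # v) = \<Lambda> (u @ x # v) \<oplus> \<Lambda> (u @ y # v)"
proof (induction "length u + length v" arbitrary: u v rule: less_induct)
  case less
  have 1: "splits_sum A u (\<lambda>a b. s (\<tau> a) \<otimes> \<tau> (b @ (x \<oplus> y) # v))
    = splits_sum A u (\<lambda>a b. s (\<tau> a) \<otimes> \<tau> (b @ x # v) \<oplus> s (\<tau> a) \<otimes> \<tau> (b @ y # v))"
  proof (rule splits_sum_cong)
    fix a b assume "a @ b = u"
    then show "s (\<tau> a) \<otimes> \<tau> (b @ (x \<oplus> y) # v)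
        = s (\<tau> a) \<otimes> \<tau> (b @ x # v) \<oplus> s (\<tau> a) \<otimes> \<tau> (b @ y # v)"
      using less[of b v] by (cases "a = []") (auto simp: r_distr)
  qed simp
  have 2: "splits_sum A v (\<lambda>a b. s (\<tau> (u @ (x \<oplus> y) # a)) \<otimes> \<tau> b)
    = splits_sum A v (\<lambda>a b. s (\<tau> (u @ x # a)) \<otimes> \<tau> b \<oplus> s (\<tau> (u @ y # a)) \<otimes> \<tau> b)"
  proof (rule splits_sum_cong)
    fix a b assume "a @ b = v"
    then show "s (\<tau> (u @ (x \<oplus> y) # a)) \<otimes> \<tau> b
        = s (\<tau> (u @ x # a)) \<otimes> \<tau> b \<oplus> s (\<tau> (u @ y # a)) \<otimes> \<tau> b"
      using less[of u a] by (cases "b = []") (auto simp: l_distr)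
  qed simp
  have L: "\<Lambda> (u @ (x \<oplus> y) # v) = \<Lambda> (u @ x # v) \<oplus> \<Lambda> (u @ y # v)"
    unfolding \<Lambda>_letter 1 2 by (simp add: splits_sum_add a_ac)
  then show ?case
    by (cases "u = [] \<and> v = []") (auto simp: \<tau>_eq assms Suc_le_eq)
qed

lemmas \<tau>_additive = additive_aux[THEN conjunct1] and \<Lambda>_additive = additive_aux[THEN conjunct2]

lemma \<tau>_zero_letter: "\<zero> \<in> set w \<Longrightarrow> \<tau> w = \<zero>"
  using \<tau>_additive[of \<zero> \<zero>] by (auto simp: in_set_conv_decomp add.r_cancel_one')

lemma \<Lambda>_zero_letter: "\<zero> \<in> set w \<Longrightarrow> \<Lambda> w = \<zero>"
  using \<Lambda>_additive[of \<zero> \<zero>] by (auto simp: in_set_conv_decomp add.r_cancel_one')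

lemma \<beta>_zero_letter: "\<zero> \<in> set w \<Longrightarrow> \<beta> w = \<zero>"
  by (simp add: \<beta>_def \<Lambda>_zero_letter)

section \<open>The twisting cochain equation\<close>

abbreviation "ins \<equiv> insert_op A s \<beta>"

text \<open>The failure of the twisting cochain equation at \<open>w\<close>; the term
  \<open>ins w \<tau>\<close> is \<open>\<tau>\<close> composed with the coderivation induced by
  \<open>\<beta>\<close>.\<close>

definition "defect w = d (\<tau> w) \<oplus> \<ominus> ins w \<tau> \<oplus> \<ominus> \<Lambda> w"

lemma defect_closed [simp]: "defect w \<in> carrier A"
  by (simp add: defect_def)

lemma insert_op_zero_letter:
  assumes "\<zero> \<in> set w" "\<And>v. \<zero> \<in> set v \<Longrightarrow> \<phi> v = \<zero>"
  shows "ins w \<phi> = \<zero>"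
proof (rule insert_op_eq_zero)
  fix u v t assume "w = u @ v @ t" "v \<noteq> []"
  then consider "\<zero> \<in> set u" | "\<zero> \<in> set v" | "\<zero> \<in> set t" using assms(1) by auto
  then show "\<phi> (map s u @ \<beta> v # t) = \<zero>"
  proof cases
    case 1
    then have "s \<zero> \<in> set (map s u)" by (auto simp del: hom_simps)
    then show ?thesis by (intro assms(2)) auto
  qed (auto intro!: assms(2) simp: \<beta>_zero_letter)
qed

lemma defect_zero_letter: "\<zero> \<in> set w \<Longrightarrow> defect w = \<zero>"
  by (simp add: defect_def \<tau>_zero_letter \<Lambda>_zero_letter insert_op_zero_letter)

text \<open>The Leibniz rule for the convolution square. In the second sum, the sign
  \<open>s\<close> from moving the coderivation past \<open>u\<close> meets the \<open>s\<close>
  inside \<open>\<Lambda>\<close>, and the two cancel.\<close>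

lemma ins_\<Lambda>:
  "ins w \<Lambda> = splits_sum A w (\<lambda>u v. s (ins u \<tau>) \<otimes> \<tau> v) \<oplus> splits_sum A w (\<lambda>u v. \<tau> u \<otimes> ins v \<tau>)"
proof -
  have "ins w \<Lambda> = splits_sum A w (\<lambda>u v. ins u (\<lambda>u'. s (\<tau> u') \<otimes> \<tau> v) \<oplus> ins v (\<lambda>v'. \<tau> u \<otimes> \<tau> v'))"
    unfolding \<Lambda>_def by (subst insert_op_splits_sum) (simp_all add: \<tau>_map_s)
  also have "\<dots> = splits_sum A w (\<lambda>u v. s (ins u \<tau>) \<otimes> \<tau> v \<oplus> \<tau> u \<otimes> ins v \<tau>)"
  proof -
    have "s (ins u \<tau>) \<otimes> y = ins u (\<lambda>u'. s (\<tau> u') \<otimes> y)" if "y \<in> carrier A" for u y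
      using that by (intro insert_op_hom[where g = "\<lambda>x. s x \<otimes> y"]) (simp_all add: l_distr)
    moreover have "y \<otimes> ins v \<tau> = ins v (\<lambda>v'. y \<otimes> \<tau> v')" if "y \<in> carrier A" for v y
      using that by (intro insert_op_hom[where g = "\<lambda>x. y \<otimes> x"]) (simp_all add: r_distr)
    ultimately show ?thesis by simp
  qed
  also have "\<dots> = splits_sum A w (\<lambda>u v. s (ins u \<tau>) \<otimes> \<tau> v) \<oplus> splits_sum A w (\<lambda>u v. \<tau> u \<otimes> ins v \<tau>)"
    by (rule splits_sum_add) simp_all
  finally show ?thesis .
qed

lemma d_\<tau>: "d (\<tau> w) = defect w \<oplus> (ins w \<tau> \<oplus> \<Lambda> w)"
proof -
  have "defect w \<oplus> (ins w \<tau> \<oplus> \<Lambda> w)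
      = d (\<tau> w) \<oplus> ((ins w \<tau> \<oplus> \<ominus> ins w \<tau>) \<oplus> (\<Lambda> w \<oplus> \<ominus> \<Lambda> w))"
    unfolding defect_def by (simp add: a_ac del: r_neg)
  then show ?thesis by (simp add: r_neg)
qed

text \<open>Associativity of convolution: both sides are sums of products
  \<open>\<tau> u \<otimes> s (\<tau> v) \<otimes> \<tau> w\<close>, and the minus sign is that of
  \<open>s_mult\<close>.\<close>

lemma \<tau>_\<Lambda>: "splits_sum A w (\<lambda>u v. s (\<Lambda> u) \<otimes> \<tau> v) = \<ominus> splits_sum A w (\<lambda>u v. \<tau> u \<otimes> \<Lambda> v)"
proof -
  have "s (\<Lambda> u) \<otimes> y = splits_sum A u (\<lambda>u1 u2. \<ominus> (\<tau> u1 \<otimes> (s (\<tau> u2) \<otimes> y)))" if "y \<in> carrier A" for u y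
    using that unfolding \<Lambda>_def
    by (subst splits_sum_hom[where g = "\<lambda>x. s x \<otimes> y"]) (simp_all add: l_distr s_mult l_minus m_assoc)
  then have "splits_sum A w (\<lambda>u v. s (\<Lambda> u) \<otimes> \<tau> v)
      = \<ominus> splits_sum A w (\<lambda>u v. splits_sum A u (\<lambda>u1 u2. \<tau> u1 \<otimes> (s (\<tau> u2) \<otimes> \<tau> v)))"
    by (simp add: splits_sum_minus)
  moreover have "y \<otimes> \<Lambda> v = splits_sum A v (\<lambda>v1 v2. y \<otimes> (s (\<tau> v1) \<otimes> \<tau> v2))" if "y \<in> carrier A" for v y
    using that unfolding \<Lambda>_def
    by (subst splits_sum_hom[where g = "\<lambda>x. y \<otimes> x"]) (simp_all add: r_distr)
  ultimately show ?thesis by (simp add: splits_sum_assoc)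
qed

text \<open>A Bianchi identity. Replacing \<open>d (\<tau> v)\<close> by the twisting cochain
  equation for shorter words creates threefold products, which cancel by
  \<open>\<tau>_\<Lambda>\<close>; the rest is \<open>ins_\<Lambda>\<close>.\<close>

lemma d_\<Lambda>:
  assumes "\<And>v. length v < length w \<Longrightarrow> defect v = \<zero>"
  shows "d (\<Lambda> w) = \<ominus> ins w \<Lambda>"
proof -
  let ?X = "splits_sum A w (\<lambda>u v. s (ins u \<tau>) \<otimes> \<tau> v)"
  let ?Y = "splits_sum A w (\<lambda>u v. \<tau> u \<otimes> ins v \<tau>)"
  let ?Z = "splits_sum A w (\<lambda>u v. \<tau> u \<otimes> \<Lambda> v)"
  have "d (\<Lambda> w) = splits_sum A w (\<lambda>u v. \<ominus> (s (d (\<tau> u)) \<otimes> \<tau> v) \<oplus> \<ominus> (\<tau> u \<otimes> d (\<tau> v)))"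
    unfolding \<Lambda>_def by (subst splits_sum_hom[where g = d]) (simp_all add: d_mult d_s l_minus)
  also have "\<dots> = splits_sum A w (\<lambda>u v.
      \<ominus> (s (ins u \<tau>) \<otimes> \<tau> v \<oplus> s (\<Lambda> u) \<otimes> \<tau> v) \<oplus> \<ominus> (\<tau> u \<otimes> ins v \<tau> \<oplus> \<tau> u \<otimes> \<Lambda> v))"
  proof (rule splits_sum_cong)
    have *: "d (\<tau> v) = ins v \<tau> \<oplus> \<Lambda> v" if "length v < length w" for v
      using assms[OF that] d_\<tau>[of v] by simp
    fix u v assume uv: "u @ v = w"
    \<comment> \<open>For empty \<open>v\<close> the word \<open>u\<close> is all of
      \<open>w\<close>, where the equation is not yet known; but then the factor
      \<open>\<tau> v\<close> is zero.\<close>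
    have 1: "s (d (\<tau> u)) \<otimes> \<tau> v = s (ins u \<tau>) \<otimes> \<tau> v \<oplus> s (\<Lambda> u) \<otimes> \<tau> v"
      using *[of u] uv by (cases "v = []") (auto simp: l_distr)
    have 2: "\<tau> u \<otimes> d (\<tau> v) = \<tau> u \<otimes> ins v \<tau> \<oplus> \<tau> u \<otimes> \<Lambda> v"
      using *[of v] uv by (cases "u = []") (auto simp: r_distr)
    show "\<ominus> (s (d (\<tau> u)) \<otimes> \<tau> v) \<oplus> \<ominus> (\<tau> u \<otimes> d (\<tau> v)) =
      \<ominus> (s (ins u \<tau>) \<otimes> \<tau> v \<oplus> s (\<Lambda> u) \<otimes> \<tau> v) \<oplus> \<ominus> (\<tau> u \<otimes> ins v \<tau> \<oplus> \<tau> u \<otimes> \<Lambda> v)"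
      by (simp only: 1 2)
  qed simp
  also have "\<dots> = \<ominus> (?X \<oplus> \<ominus> ?Z) \<oplus> \<ominus> (?Y \<oplus> ?Z)"
    by (simp add: splits_sum_add splits_sum_minus \<tau>_\<Lambda>)
  also have "\<dots> = \<ominus> (?X \<oplus> ?Y)"
    using add_cancel_across[of "\<ominus> ?X" "\<ominus> ?Y" ?Z \<zero>] by (simp add: minus_add)
  finally show ?thesis by (simp add: ins_\<Lambda>)
qed

text \<open>Inserting a block of length at least two shortens the word, so the hypothesis applies; a
  block of length one is replaced by \<open>\<beta> [x] = \<zero>\<close>.\<close>

lemma ins_defect:
  assumes "\<And>v. length v < length w \<Longrightarrow> defect v = \<zero>"
  shows "ins w defect = \<zero>"
proof (rule insert_op_eq_zero)
  fix u v t assume *: "w = u @ v @ t" "v \<noteq> []"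
  show "defect (map s u @ \<beta> v # t) = \<zero>"
  proof (cases "length v = 1")
    case True
    then have "\<beta> v = \<zero>" by (auto simp: length_Suc_conv)
    then show ?thesis by (simp add: defect_zero_letter)
  next
    case False
    then have "length v \<ge> 2" using * by (cases v) (auto simp: Suc_le_eq)
    then show ?thesis using * by (intro assms) simp
  qed
qed

text \<open>By \<open>ins_ins_\<tau>\<close> below, the obstruction here is the \<open>A\<^sub>\<infinity>\<close> relation of \<open>\<beta>\<close> for the word \<open>w\<close>.\<close>

lemma d_defect:
  assumes "\<And>v. length v < length w \<Longrightarrow> defect v = \<zero>"
  shows "d (defect w) = \<ominus> ins w (\<lambda>v. ins v \<tau>)"
proof -
  have "d (ins w \<tau>) = ins w (\<lambda>v. defect v \<oplus> (ins v \<tau> \<oplus> \<Lambda> v))"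
    by (subst insert_op_hom[where g = d]) (simp_all flip: d_\<tau>)
  also have "\<dots> = ins w (\<lambda>v. ins v \<tau>) \<oplus> ins w \<Lambda>"
    by (simp add: insert_op_add ins_defect[OF assms])
  finally have "d (ins w \<tau>) = ins w (\<lambda>v. ins v \<tau>) \<oplus> ins w \<Lambda>" .
  then have "d (defect w) = \<ominus> ins w (\<lambda>v. ins v \<tau>) \<oplus> (\<ominus> ins w \<Lambda> \<oplus> ins w \<Lambda>)"
    by (simp add: defect_def d_d d_\<Lambda>[OF assms] minus_add a_assoc)
  then show ?thesis by (simp add: l_neg)
qed

text \<open>The square of the coderivation is induced by \<open>ins v \<beta>\<close>, which by
  induction is nonzero at most on the whole word. There \<open>\<tau>\<close> acts as
  \<open>p\<close>, which fixes all values of \<open>\<beta>\<close>.\<close>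

lemma ins_ins_\<tau>:
  assumes "w \<noteq> []" "\<And>v. length v < length w \<Longrightarrow> ins v \<beta> = \<zero>"
  shows "ins w (\<lambda>v. ins v \<tau>) = ins w \<beta>"
proof -
  have "ins w (\<lambda>v. ins v \<tau>) = insert_op A (\<lambda>x. x) (\<lambda>v. ins v \<beta>) w \<tau>"
    by (rule insert_op_insert_op) (simp_all add: \<tau>_additive \<beta>_map_s)
  also have "\<dots> = \<tau> [ins w \<beta>]"
    using assms by (intro insert_op_eq_whole) (auto simp: \<tau>_zero_letter)
  also have "\<dots> = ins w \<beta>"
    by (simp, subst insert_op_hom[where g = p]) simp_all
  finally show ?thesis .
qed

text \<open>
  Since \<open>d (defect w) = \<ominus> ins w \<beta>\<close> is exact and lies in the image of \<open>p\<close>, it vanishes; so \<open>defect w\<close>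
  is annihilated by \<open>d\<close>, and by construction of \<open>\<tau>\<close> and \<open>\<beta>\<close> also by \<open>h\<close> and \<open>p\<close>.
\<close>

lemma transfer_aux: "defect w = \<zero> \<and> ins w \<beta> = \<zero>"
proof (induction w rule: measure_induct_rule[where f = length])
  case (less w)
  show ?case
  proof (cases "w = []")
    case True
    then show ?thesis by (simp add: defect_def \<Lambda>_def)
  next
    case False
    have d: "d (defect w) = \<ominus> ins w \<beta>"
      using less False by (simp add: d_defect ins_ins_\<tau>)
    have "p (ins w \<beta>) = ins w \<beta>"
      by (subst insert_op_hom[where g = p]) simp_all
    moreover have "p (\<ominus> ins w \<beta>) = \<zero>" using p_d[of "defect w"] by (simp add: d)
    ultimately have R: "ins w \<beta> = \<zero>" by simp
    have "h (ins w \<tau>) = \<zero>"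
      by (subst insert_op_hom[where g = h]) (simp_all add: insert_op_eq_zero)
    \<comment> \<open>For at least two letters this is \<open>h d h = h\<close>; on a single letter
      both sides vanish, since \<open>d p = 0\<close> and
      \<open>\<Lambda> [x] = \<zero>\<close>.\<close>
    moreover have "h (d (\<tau> w)) = h (\<Lambda> w)"
      by (rule length_less_2_cases[of w]) (auto simp: \<tau>_eq h_d_h d_p \<Lambda>_def)
    ultimately have h: "h (defect w) = \<zero>" by (simp add: defect_def r_neg)
    have "p (ins w \<tau>) = ins w (\<lambda>v. p (\<tau> v))"
      by (subst insert_op_hom[where g = p]) simp_all
    also have "\<dots> = p (\<tau> [\<beta> w])"
      using False by (intro insert_op_eq_whole) (auto simp: p_\<tau>)
    finally have "p (defect w) = \<zero>" by (simp add: defect_def p_d \<beta>_def p_p r_neg)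
    then show ?thesis using homotopy[of "defect w"] h d R by simp
  qed
qed

lemma d_\<tau>_eq: "d (\<tau> w) = ins w \<tau> \<oplus> \<Lambda> w"
  using d_\<tau>[of w] transfer_aux[of w] by simp

lemma ins_\<beta>: "ins w \<beta> = \<zero>"
  using transfer_aux by blast

end

section \<open>Graded modules\<close>

context graded_module
begin

lemma grade_carrier: "x \<in> grade V k \<Longrightarrow> x \<in> carrier V"
  using submoduleE(1)[OF grade_submodule] by blast

lemma grade_add: "\<lbrakk>x \<in> grade V k; y \<in> grade V k\<rbrakk> \<Longrightarrow> x \<oplus>\<^bsub>V\<^esub> y \<in> grade V k"
  using submoduleE(5)[OF grade_submodule] by blast

lemma grade_smult: "\<lbrakk>c \<in> carrier F; x \<in> grade V k\<rbrakk> \<Longrightarrow> c \<odot>\<^bsub>V\<^esub> x \<in> grade V k"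
  using submoduleE(4)[OF grade_submodule] by blast

lemma grade_minus: "x \<in> grade V k \<Longrightarrow> \<ominus>\<^bsub>V\<^esub> x \<in> grade V k"
  using submoduleE(3)[OF grade_submodule] by blast

lemma grade_zero: "\<zero>\<^bsub>V\<^esub> \<in> grade V k"
proof -
  obtain x where x: "x \<in> grade V k" using submoduleE(2)[OF grade_submodule, of k] by blast
  then have "x \<oplus>\<^bsub>V\<^esub> \<ominus>\<^bsub>V\<^esub> x \<in> grade V k" by (intro grade_add grade_minus)
  then show ?thesis using x grade_carrier M.r_neg by simp
qed

lemma decompositionI:
  assumes "\<And>k. c k \<in> grade V k" "finite S" "\<And>k. k \<notin> S \<Longrightarrow> c k = \<zero>\<^bsub>V\<^esub>"
    and "x = (\<Oplus>\<^bsub>V\<^esub>k\<in>S. c k)"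
  shows "decomposition V x c"
proof -
  have sub: "{k. c k \<noteq> \<zero>\<^bsub>V\<^esub>} \<subseteq> S" using assms(3) by blast
  have "(\<Oplus>\<^bsub>V\<^esub>k\<in>{k. c k \<noteq> \<zero>\<^bsub>V\<^esub>}. c k) = (\<Oplus>\<^bsub>V\<^esub>k\<in>S. c k)"
    using sub assms(1,2) grade_carrier
    by (intro M.add.finprod_mono_neutral_cong_left) auto
  then show ?thesis
    unfolding decomposition_def using assms finite_subset[OF sub] by simp
qed

lemma decompositionD:
  assumes "decomposition V x c" "finite S" "{k. c k \<noteq> \<zero>\<^bsub>V\<^esub>} \<subseteq> S"
  shows "x = (\<Oplus>\<^bsub>V\<^esub>k\<in>S. c k)"
proof -
  have "(\<Oplus>\<^bsub>V\<^esub>k\<in>{k. c k \<noteq> \<zero>\<^bsub>V\<^esub>}. c k) = (\<Oplus>\<^bsub>V\<^esub>k\<in>S. c k)"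
    using assms grade_carrier unfolding decomposition_def
    by (intro M.add.finprod_mono_neutral_cong_left) auto
  then show ?thesis using assms(1) unfolding decomposition_def by simp
qed

lemma decomposition_component:
  assumes "x \<in> carrier V"
  shows "decomposition V x (\<lambda>k. component V k x)"
  using theI'[OF grade_direct_sum[OF assms]] unfolding component_def by simp

lemma component_eqI:
  assumes "decomposition V x c"
  shows "component V k x = c k"
proof -
  have "x \<in> carrier V"
    using assms grade_carrier unfolding decomposition_def by (auto intro!: M.finsum_closed)
  then show ?thesis
    using grade_direct_sum[of x] decomposition_component[of x] assms by blast
qed

lemma component_in_grade: "x \<in> carrier V \<Longrightarrow> component V k x \<in> grade V k"
  using decomposition_component unfolding decomposition_def by blast

lemma component_closed [simp]: "x \<in> carrier V \<Longrightarrow> component V k x \<in> carrier V"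
  using component_in_grade grade_carrier by blast

lemma finite_components: "x \<in> carrier V \<Longrightarrow> finite {k. component V k x \<noteq> \<zero>\<^bsub>V\<^esub>}"
  using decomposition_component unfolding decomposition_def by blast

lemma component_grade: "x \<in> grade V k \<Longrightarrow> component V j x = (if j = k then x else \<zero>\<^bsub>V\<^esub>)"
  by (rule component_eqI, rule decompositionI[of _ "{k}"])
    (auto simp: grade_zero dest: grade_carrier)

lemma component_add:
  assumes "x \<in> carrier V" "y \<in> carrier V"
  shows "component V k (x \<oplus>\<^bsub>V\<^esub> y) = component V k x \<oplus>\<^bsub>V\<^esub> component V k y"
proof (rule component_eqI, rule decompositionI)
  let ?S = "{k. component V k x \<noteq> \<zero>\<^bsub>V\<^esub>} \<union> {k. component V k y \<noteq> \<zero>\<^bsub>V\<^esub>}"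
  show fin: "finite ?S" using assms by (simp add: finite_components)
  show "component V k x \<oplus>\<^bsub>V\<^esub> component V k y \<in> grade V k" for k
    using assms by (simp add: component_in_grade grade_add)
  show "component V k x \<oplus>\<^bsub>V\<^esub> component V k y = \<zero>\<^bsub>V\<^esub>" if "k \<notin> ?S" for k
    using that by simp
  have "x = (\<Oplus>\<^bsub>V\<^esub>k\<in>?S. component V k x)" "y = (\<Oplus>\<^bsub>V\<^esub>k\<in>?S. component V k y)"
    by (rule decompositionD[OF decomposition_component fin], use assms in auto)+
  then show "x \<oplus>\<^bsub>V\<^esub> y = (\<Oplus>\<^bsub>V\<^esub>k\<in>?S. component V k x \<oplus>\<^bsub>V\<^esub> component V k y)"
    using assms fin by (subst M.finsum_addf) auto
qed

lemma component_smult: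
  assumes "c \<in> carrier F" "x \<in> carrier V"
  shows "component V k (c \<odot>\<^bsub>V\<^esub> x) = c \<odot>\<^bsub>V\<^esub> component V k x"
proof (rule component_eqI, rule decompositionI)
  let ?S = "{k. component V k x \<noteq> \<zero>\<^bsub>V\<^esub>}"
  show fin: "finite ?S" using assms by (simp add: finite_components)
  show "c \<odot>\<^bsub>V\<^esub> component V k x \<in> grade V k" for k
    using assms by (simp add: component_in_grade grade_smult)
  show "c \<odot>\<^bsub>V\<^esub> component V k x = \<zero>\<^bsub>V\<^esub>" if "k \<notin> ?S" for k
    using that assms by simp
  have "x = (\<Oplus>\<^bsub>V\<^esub>k\<in>?S. component V k x)"
    by (rule decompositionD[OF decomposition_component fin], use assms in auto)
  then show "c \<odot>\<^bsub>V\<^esub> x = (\<Oplus>\<^bsub>V\<^esub>k\<in>?S. c \<odot>\<^bsub>V\<^esub> component V k x)"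
    using assms fin finsum_smult_ldistr[OF fin, of c "\<lambda>k. component V k x"] by auto
qed

lemma component_zero [simp]: "component V k \<zero>\<^bsub>V\<^esub> = \<zero>\<^bsub>V\<^esub>"
  using component_grade[OF grade_zero] by simp

lemma finsum_mem:
  assumes "\<zero>\<^bsub>V\<^esub> \<in> S" "\<And>x y. \<lbrakk>x \<in> S; y \<in> S\<rbrakk> \<Longrightarrow> x \<oplus>\<^bsub>V\<^esub> y \<in> S" "S \<subseteq> carrier V" "\<And>i. i \<in> I \<Longrightarrow> f i \<in> S"
  shows "finsum V f I \<in> S"
proof (cases "finite I")
  case True
  then show ?thesis using assms(4)
  proof (induction I)
    case (insert i I)
    then have "finsum V f (insert i I) = f i \<oplus>\<^bsub>V\<^esub> finsum V f I"
      using assms(3) by (intro M.finsum_insert) auto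
    then show ?case using insert assms(2) by simp
  qed (simp add: assms(1))
qed (simp add: assms(1))

text \<open>Zero is covered by the second assumption, because only finitely many components of
  \<open>x\<close> are nonzero. Asking for \<open>P\<close> on the components of \<open>x\<close>,
  rather than on all homogeneous elements, lets applications use properties of \<open>x\<close> such
  as membership in a graded subspace.\<close>

lemma graded_induct:
  assumes "x \<in> carrier V"
    and "\<And>k. P (component V k x)"
    and "\<And>x y. \<lbrakk>x \<in> carrier V; y \<in> carrier V; P x; P y\<rbrakk> \<Longrightarrow> P (x \<oplus>\<^bsub>V\<^esub> y)"
  shows "P x"
proof -
  let ?S = "{x \<in> carrier V. P x}"
  have "P \<zero>\<^bsub>V\<^esub>"
  proof (cases "x = \<zero>\<^bsub>V\<^esub>")
    case True
    then show ?thesis using assms(2)[of 0] by simp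
  next
    case False
    have "\<exists>k. k \<notin> {k. component V k x \<noteq> \<zero>\<^bsub>V\<^esub>}"
      using finite_components[OF assms(1)] by (rule ex_new_if_finite[OF infinite_UNIV_int])
    then obtain k where "component V k x = \<zero>\<^bsub>V\<^esub>" by blast
    then show ?thesis using assms(2)[of k] by simp
  qed
  then have "(\<Oplus>\<^bsub>V\<^esub>k\<in>{k. component V k x \<noteq> \<zero>\<^bsub>V\<^esub>}. component V k x) \<in> ?S"
    using assms by (intro finsum_mem) auto
  moreover have "x = (\<Oplus>\<^bsub>V\<^esub>k\<in>{k. component V k x \<noteq> \<zero>\<^bsub>V\<^esub>}. component V k x)"
    by (rule decompositionD[OF decomposition_component finite_components]) (simp_all add: assms(1))
  ultimately show ?thesis by (metis (no_types, lifting) mem_Collect_eq)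
qed

lemma finsum_restrict:
  assumes "submodule W F V" "\<And>i. i \<in> S \<Longrightarrow> f i \<in> W"
  shows "finsum (restrict_graded V W) f S = finsum V f S"
proof -
  interpret W: module F "V\<lparr>carrier := W\<rparr>"
    by (rule submodule.submodule_is_module[OF assms(1) module_axioms])
  have W: "W \<subseteq> carrier V" using submoduleE(1)[OF assms(1)] .
  have "finsum (restrict_graded V W) f S = finsum (V\<lparr>carrier := W\<rparr>) f S"
    by (simp add: finsum_def finprod_def restrict_graded_def)
  also have "\<dots> = finsum V f S"
  proof (cases "finite S")
    case True
    then show ?thesis using assms(2)
    proof (induction S)
      case (insert i S)
      have "finsum (V\<lparr>carrier := W\<rparr>) f (insert i S) = f i \<oplus>\<^bsub>V\<^esub> finsum (V\<lparr>carrier := W\<rparr>) f S"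
        using insert by (subst W.M.finsum_insert) auto
      moreover have "finsum V f (insert i S) = f i \<oplus>\<^bsub>V\<^esub> finsum V f S"
        using insert W by (intro M.finsum_insert) auto
      ultimately show ?case using insert by simp
    qed simp
  qed simp
  finally show ?thesis .
qed

text \<open>A decomposition of \<open>x\<close> inside \<open>W\<close> is also one in
  \<open>V\<close>, and decompositions in \<open>V\<close> are unique.\<close>

lemma component_in_subspace:
  assumes "graded_subspace F V W" "x \<in> W"
  shows "component V k x \<in> W"
proof -
  have sub: "submodule W F V" and W: "graded_module F (restrict_graded V W)"
    using assms(1) unfolding graded_subspace_def by auto
  obtain c where c: "decomposition (restrict_graded V W) x c"
    using graded_module.grade_direct_sum[OF W, of x] assms(2) by (auto simp: restrict_graded_def)
  then have cW: "\<And>k. c k \<in> grade V k \<inter> W" "finite {k. c k \<noteq> \<zero>\<^bsub>V\<^esub>}"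
    and x: "x = (\<Oplus>\<^bsub>restrict_graded V W\<^esub>k\<in>{k. c k \<noteq> \<zero>\<^bsub>V\<^esub>}. c k)"
    unfolding decomposition_def by (simp_all add: restrict_graded_def)
  have "x = (\<Oplus>\<^bsub>V\<^esub>k\<in>{k. c k \<noteq> \<zero>\<^bsub>V\<^esub>}. c k)"
    using x finsum_restrict[OF sub, of "{k. c k \<noteq> \<zero>\<^bsub>V\<^esub>}" c] cW by simp
  then have "component V k x = c k"
    using cW by (intro component_eqI decompositionI[of c "{k. c k \<noteq> \<zero>\<^bsub>V\<^esub>}"]) auto
  then show ?thesis using cW by simp
qed

end

section \<open>Signs and linear maps\<close>

context abelian_group
begin

lemma signed_closed [simp]: "x \<in> carrier G \<Longrightarrow> signed G e x \<in> carrier G"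
  by (simp add: signed_def)

lemma signed_signed: "x \<in> carrier G \<Longrightarrow> signed G e (signed G f x) = signed G (e + f) x"
  by (simp add: signed_def)

lemma signed_cong: "even (e - f) \<Longrightarrow> signed G e x = signed G f x"
  by (simp add: signed_def)

lemma signed_add:
  "\<lbrakk>x \<in> carrier G; y \<in> carrier G\<rbrakk> \<Longrightarrow> signed G e (x \<oplus> y) = signed G e x \<oplus> signed G e y"
  by (simp add: signed_def minus_add)

lemma signed_minus: "x \<in> carrier G \<Longrightarrow> signed G e (\<ominus> x) = \<ominus> signed G e x"
  by (simp add: signed_def)

lemma minus_signed: "x \<in> carrier G \<Longrightarrow> \<ominus> signed G e x = signed G (e + 1) x"
  by (simp add: signed_def)

lemma signed_zero [simp]: "signed G e \<zero> = \<zero>"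
  by (simp add: signed_def)

end

lemma (in ring) signed_mult_left:
  "\<lbrakk>x \<in> carrier R; y \<in> carrier R\<rbrakk> \<Longrightarrow> signed R e x \<otimes> y = signed R e (x \<otimes> y)"
  by (simp add: signed_def l_minus)

lemma (in ring) signed_mult_right:
  "\<lbrakk>x \<in> carrier R; y \<in> carrier R\<rbrakk> \<Longrightarrow> x \<otimes> signed R e y = signed R e (x \<otimes> y)"
  by (simp add: signed_def r_minus)

lemma (in abelian_group) mem_set_add: "x \<in> X <+> Y \<longleftrightarrow> (\<exists>a\<in>X. \<exists>b\<in>Y. x = a \<oplus> b)"
  by (auto simp: set_add_def set_mult_def)

text \<open>Reduces identities between additive expressions to homogeneous elements, where signs can
  be computed. The addition of the target is an abstract \<open>q\<close>, so that no structure on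
  the target is assumed.\<close>

lemma (in graded_module) graded_eqI:
  assumes "x \<in> carrier V" and "\<And>k z. z \<in> grade V k \<Longrightarrow> f z = g z"
    and "\<And>y z. \<lbrakk>y \<in> carrier V; z \<in> carrier V\<rbrakk> \<Longrightarrow> f (y \<oplus>\<^bsub>V\<^esub> z) = q (f y) (f z)"
    and "\<And>y z. \<lbrakk>y \<in> carrier V; z \<in> carrier V\<rbrakk> \<Longrightarrow> g (y \<oplus>\<^bsub>V\<^esub> z) = q (g y) (g z)"
  shows "f x = g x"
  using assms(1)
  by (rule graded_induct[where P = "\<lambda>x. f x = g x"])
    (simp_all add: assms(2-4) component_in_grade[OF assms(1), THEN assms(2)])

lemma (in graded_module) signed_grade: "x \<in> grade V k \<Longrightarrow> signed V e x \<in> grade V k"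
  by (simp add: signed_def grade_minus)

lemma linear_mapI:
  assumes "\<And>x. x \<in> carrier V \<Longrightarrow> f x \<in> carrier W"
    and "\<And>x y. \<lbrakk>x \<in> carrier V; y \<in> carrier V\<rbrakk> \<Longrightarrow> f (x \<oplus>\<^bsub>V\<^esub> y) = f x \<oplus>\<^bsub>W\<^esub> f y"
    and "\<And>c x. \<lbrakk>c \<in> carrier F; x \<in> carrier V\<rbrakk> \<Longrightarrow> f (c \<odot>\<^bsub>V\<^esub> x) = c \<odot>\<^bsub>W\<^esub> f x"
  shows "linear_map F V W f"
  using assms unfolding linear_map_def by blast

lemma linear_mapD:
  assumes "linear_map F V W f"
  shows "x \<in> carrier V \<Longrightarrow> f x \<in> carrier W"
    and "\<lbrakk>x \<in> carrier V; y \<in> carrier V\<rbrakk> \<Longrightarrow> f (x \<oplus>\<^bsub>V\<^esub> y) = f x \<oplus>\<^bsub>W\<^esub> f y"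
    and "\<lbrakk>c \<in> carrier F; x \<in> carrier V\<rbrakk> \<Longrightarrow> f (c \<odot>\<^bsub>V\<^esub> x) = c \<odot>\<^bsub>W\<^esub> f x"
  using assms unfolding linear_map_def by auto

section \<open>The contraction given by a Hodge type decomposition\<close>

locale hodge_dgca = dgca F A
  for F :: "('f, 'm) ring_scheme" and A :: "('f, 'a) dga" (structure) +
  fixes n :: nat and I :: "'a set \<Rightarrow> 'f" and H B :: "'a set"
  assumes poincare: "poincare_dgca F A n I"
    and hodge: "hodge_decomposition F A n I H B"
begin

abbreviation d where "d \<equiv> diff A"

lemmas d_closed [simp] = linear_mapD(1)[OF diff_linear]
  and d_add = linear_mapD(2)[OF diff_linear]
  and d_smult = linear_mapD(3)[OF diff_linear]

lemmas d_zero [simp] = M.additive_zero_minus(1)[of d, OF d_closed d_add]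
  and d_minus = M.additive_zero_minus(2)[of d, OF d_closed d_add]

lemma H_graded: "graded_subspace F A H"
  and B_graded: "graded_subspace F A B"
  using hodge unfolding hodge_decomposition_def harmonic_subspace_def by auto

lemma H_sub: "submodule H F A" and B_sub: "submodule B F A"
  using H_graded B_graded unfolding graded_subspace_def by auto

lemmas H_carrier [simp] = subsetD[OF submoduleE(1)[OF H_sub]]
  and H_smult = submoduleE(4)[OF H_sub]
  and H_add = submoduleE(5)[OF H_sub]
  and H_minus = submoduleE(3)[OF H_sub]
  and B_carrier [simp] = subsetD[OF submoduleE(1)[OF B_sub]]
  and B_smult = submoduleE(4)[OF B_sub]
  and B_add = submoduleE(5)[OF B_sub]
  and B_minus = submoduleE(3)[OF B_sub]

lemma cocycles_eq: "cocycles A d = coboundaries A d <+> H"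
  and H_exact: "coboundaries A d \<inter> H = {\<zero>}"
  using hodge unfolding hodge_decomposition_def harmonic_subspace_def direct_sum_def by auto

lemma carrier_eq: "carrier A = (coboundaries A d <+> H) <+> B"
  and B_closed: "(coboundaries A d <+> H) \<inter> B = {\<zero>}"
  using hodge unfolding hodge_decomposition_def direct_sum_def by auto

lemma H_zero [simp]: "\<zero> \<in> H" and B_zero [simp]: "\<zero> \<in> B"
  using H_exact B_closed by auto

lemma d_H [simp]: "y \<in> H \<Longrightarrow> d y = \<zero>"
proof -
  assume "y \<in> H"
  then have "y \<in> cocycles A d"
    unfolding cocycles_eq M.mem_set_add
    by (intro bexI[of _ \<zero>] bexI[of _ y]) (auto simp: coboundaries_def intro: rev_image_eqI[of \<zero>])
  then show ?thesis by (simp add: cocycles_def)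
qed

text \<open>The primitive can be taken in \<open>B\<close>: when it is decomposed once more, its
  exact and harmonic parts are closed and drop out under \<open>d\<close>.\<close>

lemma hodge_exists:
  assumes "x \<in> carrier A"
  obtains a y b where "a \<in> B" "y \<in> H" "b \<in> B" "x = d a \<oplus> y \<oplus> b"
proof -
  have split: "\<exists>a\<in>carrier A. \<exists>y\<in>H. \<exists>b\<in>B. x = d a \<oplus> y \<oplus> b" if "x \<in> carrier A" for x
  proof -
    have "x \<in> (coboundaries A d <+> H) <+> B" using that carrier_eq by simp
    then show ?thesis by (auto simp: coboundaries_def M.mem_set_add intro: bexI) blast
  qed
  obtain a y b where 1: "a \<in> carrier A" "y \<in> H" "b \<in> B" "x = d a \<oplus> y \<oplus> b"
    using split[OF assms] by blast
  obtain a' y' b' where 2: "a' \<in> carrier A" "y' \<in> H" "b' \<in> B" "a = d a' \<oplus> y' \<oplus> b'"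
    using split[OF 1(1)] by blast
  have "d a = d b'" using 2 by (simp add: d_add diff_diff)
  then show ?thesis using that[of b' y b] 1 2 by simp
qed

text \<open>The point is that \<open>d\<close> is injective on \<open>B\<close>: an element of
  \<open>B\<close> with zero differential is a cocycle, and cocycles meet \<open>B\<close> only in
  zero. This makes \<open>h\<close> well defined.\<close>

lemma hodge_zero:
  assumes "a \<in> B" "y \<in> H" "b \<in> B" "d a \<oplus> y \<oplus> b = \<zero>"
  shows "a = \<zero>" "y = \<zero>" "b = \<zero>"
proof -
  have da: "d a \<in> coboundaries A d" using assms(1) by (simp add: coboundaries_def)
  have "d a \<oplus> y = \<ominus> b" using assms by (simp add: M.minus_equality M.add.inv_equality)
  moreover have "d a \<oplus> y \<in> coboundaries A d <+> H" using da assms(2) by (auto simp: M.mem_set_add)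
  ultimately have "\<ominus> b \<in> (coboundaries A d <+> H) \<inter> B" using assms(3) by (simp add: B_minus)
  then show b: "b = \<zero>" using B_closed assms by auto
  have "d a \<oplus> y = \<zero>" using assms by (simp add: b)
  then have "y = \<ominus> d a" using assms by (metis H_carrier B_carrier M.minus_equality M.a_comm d_closed)
  then have "y \<in> coboundaries A d"
    using assms(1) by (auto simp: coboundaries_def d_minus intro!: rev_image_eqI[of "\<ominus> a"])
  then show y: "y = \<zero>" using H_exact assms by auto
  have "a \<in> cocycles A d" using assms by (simp add: b y cocycles_def)
  then show "a = \<zero>" using B_closed assms(1) unfolding cocycles_eq by auto
qed

lemma hodge_unique:
  assumes "a \<in> B" "y \<in> H" "b \<in> B" "a' \<in> B" "y' \<in> H" "b' \<in> B"
    and "d a \<oplus> y \<oplus> b = d a' \<oplus> y' \<oplus> b'"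
  shows "a = a'" "y = y'" "b = b'"
proof -
  have "d (a \<oplus> \<ominus> a') \<oplus> (y \<oplus> \<ominus> y') \<oplus> (b \<oplus> \<ominus> b')
      = (d a \<oplus> y \<oplus> b) \<oplus> \<ominus> (d a' \<oplus> y' \<oplus> b')"
    using assms(1-6) by (simp add: d_add d_minus M.minus_add M.a_ac)
  also have "\<dots> = \<zero>" using assms by (simp add: M.r_neg)
  finally have "a \<oplus> \<ominus> a' = \<zero>" "y \<oplus> \<ominus> y' = \<zero>" "b \<oplus> \<ominus> b' = \<zero>"
    using assms(1-6) hodge_zero[of "a \<oplus> \<ominus> a'" "y \<oplus> \<ominus> y'" "b \<oplus> \<ominus> b'"]
    by (auto simp: B_add B_minus H_add H_minus)
  then show "a = a'" "y = y'" "b = b'"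
    using assms(1-6) by (metis B_carrier H_carrier M.add.inv_closed M.minus_equality M.minus_minus M.a_comm)+
qed

text \<open>\<open>P\<close> projects onto \<open>H\<close>; \<open>h\<close> inverts \<open>d : B \<rightarrow> d A\<close> and vanishes on \<open>H \<oplus> B\<close>.\<close>

definition P where
  "P x = (if x \<in> carrier A then (THE y. y \<in> H \<and> (\<exists>a\<in>B. \<exists>b\<in>B. x = d a \<oplus> y \<oplus> b)) else \<zero>)"

definition h where
  "h x = (THE a. a \<in> B \<and> (\<exists>y\<in>H. \<exists>b\<in>B. x = d a \<oplus> y \<oplus> b))"

lemma P_eqI: "\<lbrakk>a \<in> B; y \<in> H; b \<in> B\<rbrakk> \<Longrightarrow> P (d a \<oplus> y \<oplus> b) = y"
  unfolding P_def by (simp, rule the_equality) (blast, metis hodge_unique(2))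

lemma h_eqI: "\<lbrakk>a \<in> B; y \<in> H; b \<in> B\<rbrakk> \<Longrightarrow> h (d a \<oplus> y \<oplus> b) = a"
  unfolding h_def by (rule the_equality) (blast, metis hodge_unique(1))

lemma P_H: "P x \<in> H"
proof (cases "x \<in> carrier A")
  case True
  then show ?thesis by (rule hodge_exists) (simp add: P_eqI)
qed (simp add: P_def)

lemma h_B: "x \<in> carrier A \<Longrightarrow> h x \<in> B"
  by (erule hodge_exists) (simp add: h_eqI)

lemma P_closed [simp]: "P x \<in> carrier A" and h_closed [simp]: "x \<in> carrier A \<Longrightarrow> h x \<in> carrier A"
  using P_H h_B by auto

lemma P_of_H [simp]: "y \<in> H \<Longrightarrow> P y = y" and h_of_H [simp]: "y \<in> H \<Longrightarrow> h y = \<zero>"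
  using P_eqI[of \<zero> y \<zero>] h_eqI[of \<zero> y \<zero>] by auto

lemma P_of_B [simp]: "b \<in> B \<Longrightarrow> P b = \<zero>" and h_of_B [simp]: "b \<in> B \<Longrightarrow> h b = \<zero>"
  using P_eqI[of \<zero> \<zero> b] h_eqI[of \<zero> \<zero> b] by auto

lemma h_d: "a \<in> B \<Longrightarrow> h (d a) = a"
  using h_eqI[of a \<zero> \<zero>] by auto

lemma P_d [simp]: "x \<in> carrier A \<Longrightarrow> P (d x) = \<zero>"
proof (elim hodge_exists)
  fix a y b assume "a \<in> B" "y \<in> H" "b \<in> B" "x = d a \<oplus> y \<oplus> b"
  then show "P (d x) = \<zero>" using P_eqI[of b \<zero> \<zero>] by (simp add: d_add diff_diff)
qed

lemma homotopy: "x \<in> carrier A \<Longrightarrow> x = d (h x) \<oplus> h (d x) \<oplus> P x"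
proof (elim hodge_exists)
  fix a y b assume x: "a \<in> B" "y \<in> H" "b \<in> B" "x = d a \<oplus> y \<oplus> b"
  then have "h (d x) = b" "h x = a" "P x = y" by (simp_all add: d_add diff_diff h_d P_eqI h_eqI)
  moreover have "d a \<oplus> y \<oplus> b = d a \<oplus> b \<oplus> y" using x by (simp add: M.a_ac)
  ultimately show "x = d (h x) \<oplus> h (d x) \<oplus> P x" using x(4) by simp
qed

lemma P_add: "\<lbrakk>x \<in> carrier A; y \<in> carrier A\<rbrakk> \<Longrightarrow> P (x \<oplus> y) = P x \<oplus> P y"
  and h_add: "\<lbrakk>x \<in> carrier A; y \<in> carrier A\<rbrakk> \<Longrightarrow> h (x \<oplus> y) = h x \<oplus> h y"
proof -
  assume "x \<in> carrier A" and *: "y \<in> carrier A"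
  then obtain a u b where x: "a \<in> B" "u \<in> H" "b \<in> B" "x = d a \<oplus> u \<oplus> b"
    using hodge_exists by blast
  obtain a' u' b' where y: "a' \<in> B" "u' \<in> H" "b' \<in> B" "y = d a' \<oplus> u' \<oplus> b'"
    using hodge_exists[OF *] by blast
  have xy: "x \<oplus> y = d (a \<oplus> a') \<oplus> (u \<oplus> u') \<oplus> (b \<oplus> b')"
    unfolding x(4) y(4) using x y by (simp add: d_add M.a_ac)
  show "P (x \<oplus> y) = P x \<oplus> P y" "h (x \<oplus> y) = h x \<oplus> h y"
    unfolding xy using x y by (simp_all add: P_eqI h_eqI B_add H_add)
qed

lemma P_smult: "\<lbrakk>c \<in> carrier F; x \<in> carrier A\<rbrakk> \<Longrightarrow> P (c \<odot> x) = c \<odot> P x"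
  and h_smult: "\<lbrakk>c \<in> carrier F; x \<in> carrier A\<rbrakk> \<Longrightarrow> h (c \<odot> x) = c \<odot> h x"
proof -
  assume c: "c \<in> carrier F" "x \<in> carrier A"
  then obtain a u b where x: "a \<in> B" "u \<in> H" "b \<in> B" "x = d a \<oplus> u \<oplus> b"
    using hodge_exists by blast
  then have cx: "c \<odot> x = d (c \<odot> a) \<oplus> c \<odot> u \<oplus> c \<odot> b"
    using c by (simp add: d_smult smult_r_distr)
  show "P (c \<odot> x) = c \<odot> P x" "h (c \<odot> x) = c \<odot> h x"
    unfolding cx using x c by (simp_all add: P_eqI h_eqI B_smult H_smult)
qed

lemma component_d:
  assumes "x \<in> carrier A"
  shows "component A (k + 1) (d x) = d (component A k x)" (is "?f x = ?g x")
proof (rule graded_eqI[OF assms, where f = ?f and g = ?g and q = "(\<oplus>)"])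
  fix j z assume z: "z \<in> grade A j"
  then show "?f z = ?g z" using diff_grade[OF z] by (simp add: component_grade)
qed (simp_all add: d_add component_add)

lemma graded_split:
  assumes "x \<in> grade A k"
  obtains a y b where "a \<in> B" "y \<in> H" "b \<in> B" "a \<in> grade A (k - 1)" "y \<in> grade A k" "b \<in> grade A k"
    "x = d a \<oplus> y \<oplus> b"
proof -
  have "x \<in> carrier A" using assms by (rule grade_carrier)
  then obtain a y b where *: "a \<in> B" "y \<in> H" "b \<in> B" "x = d a \<oplus> y \<oplus> b" using hodge_exists by blast
  have "x = component A k x" using assms by (simp add: component_grade)
  also have "\<dots> = d (component A (k - 1) a) \<oplus> component A k y \<oplus> component A k b"
    using * component_d[of a "k - 1"] by (simp add: component_add)
  finally show ?thesis
    using * by (intro that) (auto intro: component_in_subspace[OF H_graded]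
      component_in_subspace[OF B_graded] component_in_grade)
qed

lemma P_grade: "x \<in> grade A k \<Longrightarrow> P x \<in> grade A k"
  by (erule graded_split) (simp add: P_eqI)

lemma h_grade: "x \<in> grade A k \<Longrightarrow> h x \<in> grade A (k - 1)"
  by (erule graded_split) (simp add: h_eqI)

lemma component_P:
  assumes "x \<in> carrier A"
  shows "component A k (P x) = P (component A k x)" (is "?f x = ?g x")
proof (rule graded_eqI[OF assms, where f = ?f and g = ?g and q = "(\<oplus>)"])
  fix j z assume z: "z \<in> grade A j"
  then show "?f z = ?g z" using P_grade[OF z] by (simp add: component_grade)
qed (simp_all add: P_add component_add)

lemma component_h:
  assumes "x \<in> carrier A"
  shows "component A k (h x) = h (component A (k + 1) x)" (is "?f x = ?g x")
proof (rule graded_eqI[OF assms, where f = ?f and g = ?g and q = "(\<oplus>)"])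
  fix j z assume z: "z \<in> grade A j"
  then show "?f z = ?g z" using h_grade[OF z] by (auto simp: component_grade)
qed (simp_all add: h_add component_add)

section \<open>The grading involution and its commutation rules\<close>

lemma grade_outside: "k < 0 \<or> int n < k \<Longrightarrow> grade A k = {\<zero>}"
  using poincare nonneg_graded[of k] unfolding poincare_dgca_def by blast

text \<open>Multiplication by \<open>(-1)^k\<close> in degree \<open>k\<close>. The fixed summation
  range contains all degrees in which \<open>A\<close> is nonzero and makes additivity termwise,
  which a sum over the support of \<open>x\<close> would not.\<close>

definition \<iota> where "\<iota> x = (\<Oplus>k\<in>{0..int n}. signed A k (component A k x))"

lemma \<iota>_closed [simp]: "x \<in> carrier A \<Longrightarrow> \<iota> x \<in> carrier A"
  unfolding \<iota>_def by (rule M.finsum_closed) simp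

lemma \<iota>_add:
  assumes "x \<in> carrier A" "y \<in> carrier A"
  shows "\<iota> (x \<oplus> y) = \<iota> x \<oplus> \<iota> y"
proof -
  have "\<iota> x \<oplus> \<iota> y = (\<Oplus>k\<in>{0..int n}. signed A k (component A k x) \<oplus> signed A k (component A k y))"
    unfolding \<iota>_def by (rule M.finsum_addf[symmetric]) (simp_all add: assms Pi_def)
  then show ?thesis by (simp add: \<iota>_def component_add M.signed_add assms)
qed

lemma \<iota>_grade: "x \<in> grade A k \<Longrightarrow> \<iota> x = signed A k x"
proof (cases "k \<in> {0..int n}")
  case True
  assume x: "x \<in> grade A k"
  have "\<iota> x = (\<Oplus>j\<in>{0..int n}. if k = j then signed A j x else \<zero>)"
    unfolding \<iota>_def
    by (rule M.finsum_cong') (use grade_carrier[OF x] in \<open>simp_all add: component_grade[OF x] Pi_def\<close>)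
  also have "\<dots> = signed A k x"
    by (rule M.finsum_singleton) (use True grade_carrier[OF x] in auto)
  finally show ?thesis .
next
  case False
  assume "x \<in> grade A k"
  then have "x = \<zero>" using False grade_outside[of k] by auto
  then show ?thesis by (simp add: \<iota>_def)
qed

lemma \<iota>_zero [simp]: "\<iota> \<zero> = \<zero>"
  using \<iota>_grade[OF grade_zero] by simp

lemmas \<iota>_minus = M.additive_zero_minus(2)[of \<iota>, OF \<iota>_closed \<iota>_add]
  and h_minus = M.additive_zero_minus(2)[of h, OF h_closed h_add]
  and P_minus = M.additive_zero_minus(2)[of P, OF P_closed P_add]

lemma \<iota>_smult:
  assumes "x \<in> carrier A" "c \<in> carrier F"
  shows "\<iota> (c \<odot> x) = c \<odot> \<iota> x" (is "?f x = ?g x")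
proof (rule graded_eqI[OF assms(1), where f = ?f and g = ?g and q = "(\<oplus>)"])
  fix j z assume z: "z \<in> grade A j"
  then show "?f z = ?g z" using grade_smult[OF assms(2) z] assms grade_carrier[OF z]
    by (simp add: \<iota>_grade signed_def smult_r_minus)
qed (simp_all add: \<iota>_add assms smult_r_distr)

lemma \<iota>_\<iota>:
  assumes "x \<in> carrier A"
  shows "\<iota> (\<iota> x) = x" (is "?f x = ?g x")
proof (rule graded_eqI[OF assms, where f = ?f and g = ?g and q = "(\<oplus>)"])
  fix j z assume z: "z \<in> grade A j"
  then show "?f z = ?g z" using \<iota>_grade[OF signed_grade[OF z]] grade_carrier[OF z]
    by (simp add: \<iota>_grade M.signed_signed) (simp add: signed_def)
qed (simp_all add: \<iota>_add)

lemma d_\<iota>: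
  assumes "x \<in> carrier A"
  shows "d (\<iota> x) = \<ominus> \<iota> (d x)" (is "?f x = ?g x")
proof (rule graded_eqI[OF assms, where f = ?f and g = ?g and q = "(\<oplus>)"])
  fix j z assume z: "z \<in> grade A j"
  then show "?f z = ?g z" using \<iota>_grade[OF diff_grade[OF z]] grade_carrier[OF z]
    by (simp add: \<iota>_grade signed_def d_minus)
qed (simp_all add: \<iota>_add d_add M.minus_add)

lemma h_\<iota>:
  assumes "x \<in> carrier A"
  shows "h (\<iota> x) = \<ominus> \<iota> (h x)" (is "?f x = ?g x")
proof (rule graded_eqI[OF assms, where f = ?f and g = ?g and q = "(\<oplus>)"])
  fix j z assume z: "z \<in> grade A j"
  then show "?f z = ?g z" using \<iota>_grade[OF h_grade[OF z]] grade_carrier[OF z]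
    by (simp add: \<iota>_grade signed_def h_minus)
qed (simp_all add: \<iota>_add h_add M.minus_add)

lemma P_\<iota>:
  assumes "x \<in> carrier A"
  shows "P (\<iota> x) = \<iota> (P x)" (is "?f x = ?g x")
proof (rule graded_eqI[OF assms, where f = ?f and g = ?g and q = "(\<oplus>)"])
  fix j z assume z: "z \<in> grade A j"
  then show "?f z = ?g z" using \<iota>_grade[OF P_grade[OF z]] grade_carrier[OF z]
    by (simp add: \<iota>_grade signed_def P_minus)
qed (simp_all add: \<iota>_add P_add)

lemma \<iota>_mult:
  assumes "x \<in> carrier A" "y \<in> carrier A"
  shows "\<iota> (x \<otimes> y) = \<iota> x \<otimes> \<iota> y"
proof (rule graded_eqI[OF assms(1), where f = "\<lambda>x. \<iota> (x \<otimes> y)" and g = "\<lambda>x. \<iota> x \<otimes> \<iota> y" and q = "(\<oplus>)"])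
  fix j z assume z: "z \<in> grade A j"
  show "\<iota> (z \<otimes> y) = \<iota> z \<otimes> \<iota> y"
  proof (rule graded_eqI[OF assms(2), where f = "\<lambda>y. \<iota> (z \<otimes> y)" and g = "\<lambda>y. \<iota> z \<otimes> \<iota> y" and q = "(\<oplus>)"])
    fix k y assume y: "y \<in> grade A k"
    show "\<iota> (z \<otimes> y) = \<iota> z \<otimes> \<iota> y"
      using z y \<iota>_grade[OF mult_grade[OF z y]] grade_carrier[OF z] grade_carrier[OF y]
      by (simp add: \<iota>_grade signed_def l_minus r_minus)
  qed (use grade_carrier[OF z] in \<open>simp_all add: \<iota>_add r_distr\<close>)
qed (use assms in \<open>simp_all add: \<iota>_add l_distr\<close>)

lemma d_mult:
  assumes "x \<in> carrier A" "y \<in> carrier A"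
  shows "d (x \<otimes> y) = d x \<otimes> y \<oplus> \<iota> x \<otimes> d y"
proof (rule graded_eqI[OF assms(1), where f = "\<lambda>x. d (x \<otimes> y)"
      and g = "\<lambda>x. d x \<otimes> y \<oplus> \<iota> x \<otimes> d y" and q = "(\<oplus>)"])
  fix j z assume z: "z \<in> grade A j"
  show "d (z \<otimes> y) = d z \<otimes> y \<oplus> \<iota> z \<otimes> d y"
    using Leibniz[OF z assms(2)] grade_carrier[OF z] assms(2)
    by (simp add: \<iota>_grade[OF z] signed_mult_left)
qed (use assms in \<open>simp_all add: d_add \<iota>_add l_distr M.a_ac\<close>)

text \<open>Outside the carrier \<open>\<sigma>\<close> is the identity, to be an involution of the whole type.\<close>

definition \<sigma> where "\<sigma> x = (if x \<in> carrier A then \<ominus> \<iota> x else x)"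

text \<open>The side conditions \<open>h h = 0\<close>, \<open>h P = 0\<close> and
  \<open>P h = 0\<close> hold because \<open>h\<close> takes values in \<open>B\<close> and
  \<open>P\<close> in \<open>H\<close>, while \<open>h\<close> vanishes on both and \<open>P\<close>
  on \<open>B\<close>.\<close>

sublocale transfer_data A d h P \<sigma>
proof
  show "\<sigma> (\<sigma> x) = x" for x by (simp add: \<sigma>_def \<iota>_minus \<iota>_\<iota>)
  show "P (\<sigma> x) = \<sigma> (P x)" for x
    by (cases "x \<in> carrier A") (simp_all add: \<sigma>_def P_minus P_\<iota>, simp add: P_def)
  fix x assume x: "x \<in> carrier A"
  show "x = d (h x) \<oplus> h (d x) \<oplus> P x" using x by (rule homotopy)
  show "h (d (h x)) = h x" using x by (simp add: h_d h_B)
  show "h (\<sigma> x) = \<ominus> \<sigma> (h x)" using x by (simp add: \<sigma>_def h_minus h_\<iota>)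
  show "d (\<sigma> x) = \<ominus> \<sigma> (d x)" using x by (simp add: \<sigma>_def d_minus d_\<iota>)
  show "\<sigma> x \<in> carrier A" using x by (simp add: \<sigma>_def)
  fix y assume y: "y \<in> carrier A"
  show "\<sigma> (x \<oplus> y) = \<sigma> x \<oplus> \<sigma> y" using x y by (simp add: \<sigma>_def \<iota>_add M.minus_add)
  show "\<sigma> (x \<otimes> y) = \<ominus> (\<sigma> x \<otimes> \<sigma> y)" using x y by (simp add: \<sigma>_def \<iota>_mult l_minus r_minus)
  show "d (x \<otimes> y) = d x \<otimes> y \<oplus> \<ominus> (\<sigma> x \<otimes> d y)" using x y by (simp add: \<sigma>_def d_mult l_minus)
qed (simp_all add: d_add h_add P_add diff_diff h_B P_H)

end

section \<open>Transfer with Keller's signs\<close>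

context abelian_group
begin

lemma additive_finsum:
  assumes "\<And>x. x \<in> carrier G \<Longrightarrow> g x \<in> carrier G"
    and "\<And>x y. \<lbrakk>x \<in> carrier G; y \<in> carrier G\<rbrakk> \<Longrightarrow> g (x \<oplus> y) = g x \<oplus> g y"
    and "finite S" "\<And>i. i \<in> S \<Longrightarrow> f i \<in> carrier G"
  shows "g (finsum G f S) = (\<Oplus>i\<in>S. g (f i))"
  using assms(3,4)
proof (induction S)
  case empty
  then show ?case using additive_zero_minus(1)[of g, OF assms(1,2)] by simp
next
  case (insert i S)
  then have "finsum G f (insert i S) = f i \<oplus> finsum G f S"
    "(\<Oplus>i\<in>insert i S. g (f i)) = g (f i) \<oplus> (\<Oplus>i\<in>S. g (f i))"
    by (intro finsum_insert; auto simp: assms(1))+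
  moreover have "finsum G f S \<in> carrier G" by (rule finsum_closed) (use insert in auto)
  ultimately show ?case using insert by (simp add: assms(2))
qed

lemma splits_sum_eq_finsum:
  assumes "\<And>u v. K u v \<in> carrier G"
  shows "splits_sum G w K = (\<Oplus>i\<in>{..length w}. K (take i w) (drop i w))"
  using assms
proof (induction w arbitrary: K)
  case (Cons x w)
  have "(\<Oplus>i\<in>{..length (x # w)}. K (take i (x # w)) (drop i (x # w)))
      = (\<Oplus>i\<in>{..length w}. K (take (Suc i) (x # w)) (drop (Suc i) (x # w))) \<oplus> K [] (x # w)"
    by (simp only: length_Cons, subst finsum_Suc2) (auto simp: Cons.prems)
  then show ?case by (simp add: Cons a_comm)
qed simp

lemma finite_triples: "finite {(r, k, t). r + k + t = (N :: nat) \<and> 1 \<le> k}"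
  by (rule finite_subset[of _ "{..N} \<times> {..N} \<times> {..N}"]) auto

lemma insert_op_eq_finsum:
  assumes "\<And>v. \<phi> v \<in> carrier G"
  shows "insert_op G s b w \<phi> = finsum G
    (\<lambda>(r, k, t). \<phi> (map s (take r w) @ [b (take k (drop r w))] @ drop (r + k) w))
    {(r, k, t). r + k + t = length w \<and> 1 \<le> k}"
  using assms
proof (induction w arbitrary: \<phi>)
  case Nil
  have "{(r, k, t). r + k + t = (0 :: nat) \<and> 1 \<le> k} = {}" by auto
  then show ?case by (simp only: finsum_empty insert_op.simps list.size)
next
  case (Cons x w)
  let ?g = "\<lambda>(r, k, t). \<phi> (map s (take r (x # w)) @ [b (take k (drop r (x # w)))] @ drop (r + k) (x # w))"
  let ?T = "{(r, k, t). r + k + t = length w \<and> 1 \<le> k}"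
  \<comment> \<open>The blocks starting at the first letter, with \<open>i\<close> further letters,
    and the blocks starting later: the two summands in the recursion of
    \<open>insert_op\<close>.\<close>
  let ?S1 = "(\<lambda>i. (0, Suc i, length w - i)) ` {..length w}"
  let ?S2 = "(\<lambda>(r, k, t). (Suc r, k, t)) ` ?T"
  have S: "{(r, k, t). r + k + t = length (x # w) \<and> 1 \<le> k} = ?S1 \<union> ?S2" (is "?S = _")
  proof (rule Set.set_eqI)
    fix a show "a \<in> ?S \<longleftrightarrow> a \<in> ?S1 \<union> ?S2"
    proof (cases a)
      case (fields r k t)
      then show ?thesis
        by (cases r; cases k) (auto simp: image_iff)
    qed
  qed
  have fin: "finite ?S1" "finite ?S2" using finite_triples by auto
  have "finsum G ?g ?S = finsum G ?g ?S1 \<oplus> finsum G ?g ?S2"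
    unfolding S by (rule finsum_Un_disjoint) (use fin Cons.prems in auto)
  also have "finsum G ?g ?S1 = (\<Oplus>i\<in>{..length w}. ?g (0, Suc i, length w - i))"
    by (rule finsum_reindex) (auto simp: Cons.prems inj_on_def)
  also have "\<dots> = splits_sum G w (\<lambda>u v. \<phi> (b (x # u) # v))"
    by (subst splits_sum_eq_finsum) (simp_all add: Cons.prems)
  also have "finsum G ?g ?S2 = finsum G (\<lambda>a. ?g ((\<lambda>(r, k, t). (Suc r, k, t)) a)) ?T"
    by (rule finsum_reindex) (auto simp: Cons.prems inj_on_def)
  also have "\<dots> = insert_op G s b w (\<lambda>v. \<phi> (s x # v))"
    by (subst Cons.IH) (auto simp: Cons.prems intro!: arg_cong2[of _ _ _ _ "finsum G"])
  finally show ?case by simp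
qed

end

text \<open>The locale knows a ring without scalars, so multiplication by a scalar enters as an
  additive map \<open>e\<close> commuting with all of the structure.\<close>

lemma (in transfer_data) letter_hom:
  assumes e: "\<And>x. x \<in> carrier A \<Longrightarrow> e x \<in> carrier A"
    "\<And>x y. \<lbrakk>x \<in> carrier A; y \<in> carrier A\<rbrakk> \<Longrightarrow> e (x \<oplus> y) = e x \<oplus> e y"
    "\<And>x y. \<lbrakk>x \<in> carrier A; y \<in> carrier A\<rbrakk> \<Longrightarrow> e x \<otimes> y = e (x \<otimes> y)"
    "\<And>x y. \<lbrakk>x \<in> carrier A; y \<in> carrier A\<rbrakk> \<Longrightarrow> x \<otimes> e y = e (x \<otimes> y)"
    "\<And>x. x \<in> carrier A \<Longrightarrow> h (e x) = e (h x)"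
    "\<And>x. x \<in> carrier A \<Longrightarrow> p (e x) = e (p x)"
    "\<And>x. x \<in> carrier A \<Longrightarrow> s (e x) = e (s x)"
    and x: "x \<in> carrier A"
  shows "\<tau> (u @ e x # v) = e (\<tau> (u @ x # v)) \<and> \<Lambda> (u @ e x # v) = e (\<Lambda> (u @ x # v))"
proof (induction "length u + length v" arbitrary: u v rule: less_induct)
  case less
  have e0: "e \<zero> = \<zero>" using additive_zero_minus(1)[of e, OF e(1,2)] .
  have 1: "splits_sum A u (\<lambda>a b. s (\<tau> a) \<otimes> \<tau> (b @ e x # v))
    = splits_sum A u (\<lambda>a b. e (s (\<tau> a) \<otimes> \<tau> (b @ x # v)))"
  proof (rule splits_sum_cong)
    fix a b assume "a @ b = u"
    then show "s (\<tau> a) \<otimes> \<tau> (b @ e x # v) = e (s (\<tau> a) \<otimes> \<tau> (b @ x # v))"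
      using less[of b v] by (cases "a = []") (auto simp: e e0)
  qed simp
  have 2: "splits_sum A v (\<lambda>a b. s (\<tau> (u @ e x # a)) \<otimes> \<tau> b)
    = splits_sum A v (\<lambda>a b. e (s (\<tau> (u @ x # a)) \<otimes> \<tau> b))"
  proof (rule splits_sum_cong)
    fix a b assume "a @ b = v"
    then show "s (\<tau> (u @ e x # a)) \<otimes> \<tau> b = e (s (\<tau> (u @ x # a)) \<otimes> \<tau> b)"
      using less[of u a] by (cases "b = []") (auto simp: e e0)
  qed simp
  have L: "\<Lambda> (u @ e x # v) = e (\<Lambda> (u @ x # v))"
    unfolding \<Lambda>_letter 1 2 by (simp add: splits_sum_hom[of _ e] e)
  then show ?case
    by (cases "u = [] \<and> v = []") (auto simp: \<tau>_eq e x Suc_le_eq)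
qed

context hodge_dgca
begin

lemma homogeneous_append: "homogeneous A (u @ v) ds \<longleftrightarrow>
    (\<exists>du dv. ds = du @ dv \<and> homogeneous A u du \<and> homogeneous A v dv)"
  unfolding homogeneous_def list_all2_append1 by (metis list_all2_lengthD)

lemma homogeneous_length: "homogeneous A w ds \<Longrightarrow> length ds = length w"
  unfolding homogeneous_def using list_all2_lengthD by fastforce

lemma \<sigma>_grade: "x \<in> grade A k \<Longrightarrow> \<sigma> x = signed A (k + 1) x"
  by (simp add: \<sigma>_def \<iota>_grade grade_carrier M.minus_signed)

lemma grade_aux:
  "homogeneous A w ds \<Longrightarrow> \<tau> w \<in> grade A (sum_list ds + 1 - int (length w))
    \<and> \<Lambda> w \<in> grade A (sum_list ds + 2 - int (length w))"
proof (induction w arbitrary: ds rule: measure_induct_rule[where f = length])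
  case (less w)
  have L: "\<Lambda> w \<in> grade A (sum_list ds + 2 - int (length w))"
    unfolding \<Lambda>_def
  proof (rule M.splits_sum_mem)
    fix u v assume uv: "u @ v = w"
    then obtain du dv where ds: "ds = du @ dv" "homogeneous A u du" "homogeneous A v dv"
      using less.prems by (auto simp: homogeneous_append)
    show "\<sigma> (\<tau> u) \<otimes> \<tau> v \<in> grade A (sum_list ds + 2 - int (length w))"
    proof (cases "u = [] \<or> v = []")
      case False
      then have "\<tau> u \<in> grade A (sum_list du + 1 - int (length u))" "\<tau> v \<in> grade A (sum_list dv + 1 - int (length v))"
        using less.IH[of u] less.IH[of v] uv ds by auto
      then have "\<sigma> (\<tau> u) \<otimes> \<tau> v \<in> grade A ((sum_list du + 1 - int (length u)) + (sum_list dv + 1 - int (length v)))"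
        by (intro mult_grade) (simp_all add: \<sigma>_grade signed_grade)
      moreover have "(sum_list du + 1 - int (length u)) + (sum_list dv + 1 - int (length v))
          = sum_list ds + 2 - int (length w)" using ds uv by auto
      ultimately show ?thesis by simp
    qed (auto simp: grade_zero)
  qed (rule grade_add)
  moreover have "\<tau> w \<in> grade A (sum_list ds + 1 - int (length w))"
  proof (cases rule: length_less_2_cases[of w])
    case (2 x)
    then show ?thesis using less.prems by (auto simp: homogeneous_def list_all2_Cons1 P_grade)
  next
    case 3
    then show ?thesis using h_grade[OF L] by (simp add: \<tau>_eq algebra_simps)
  qed (simp add: grade_zero)
  ultimately show ?case by simp
qed

lemmas \<tau>_grade = grade_aux[THEN conjunct1] and \<Lambda>_grade = grade_aux[THEN conjunct2]

lemma \<beta>_grade: "homogeneous A w ds \<Longrightarrow> \<beta> w \<in> grade A (sum_list ds + 2 - int (length w))"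
  by (simp add: \<beta>_def grade_minus P_grade \<Lambda>_grade)

lemma \<beta>_H: "\<beta> w \<in> H"
  by (simp add: \<beta>_def H_minus P_H)

text \<open>What the sign lemmas use about \<open>\<tau>\<close> and \<open>\<beta>\<close>, so that
  both are treated at once.\<close>

definition letter_additive where
  "letter_additive \<phi> \<longleftrightarrow> (\<forall>v. \<phi> v \<in> carrier A) \<and>
    (\<forall>u v. \<forall>x\<in>carrier A. \<forall>y\<in>carrier A. \<phi> (u @ (x \<oplus> y) # v) = \<phi> (u @ x # v) \<oplus> \<phi> (u @ y # v))"

lemma letter_additive_\<tau>: "letter_additive \<tau>"
  and letter_additive_\<beta>: "letter_additive \<beta>"
  by (simp_all add: letter_additive_def \<tau>_additive \<beta>_def \<Lambda>_additive M.minus_add)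

lemma letter_signed:
  assumes "letter_additive \<phi>" "x \<in> carrier A"
  shows "\<phi> (u @ signed A e x # v) = signed A e (\<phi> (u @ x # v))"
proof -
  have closed: "\<phi> w \<in> carrier A" for w using assms(1) by (simp add: letter_additive_def)
  have add: "\<phi> (u @ (x \<oplus> y) # v) = \<phi> (u @ x # v) \<oplus> \<phi> (u @ y # v)"
    if "x \<in> carrier A" "y \<in> carrier A" for x y
    using that assms(1) by (simp add: letter_additive_def)
  have "\<phi> (u @ (\<ominus> x) # v) = \<ominus> \<phi> (u @ x # v)"
    using M.additive_zero_minus(2)[of "\<lambda>x. \<phi> (u @ x # v)" x] assms(2) closed add by simp
  then show ?thesis by (simp add: signed_def)
qed

text \<open>A letter of degree \<open>p\<close> has suspended parity \<open>p + 1\<close>; the total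
  is the Koszul sign of moving an odd operator past \<open>u\<close>.\<close>

lemma letter_\<sigma>:
  assumes "letter_additive \<phi>" "homogeneous A u du"
  shows "\<phi> (u' @ map \<sigma> u @ v) = signed A (sum_list du + int (length u)) (\<phi> (u' @ u @ v))"
  using assms(2)
proof (induction u arbitrary: u' du)
  case Nil
  then show ?case by (simp add: homogeneous_def signed_def)
next
  case (Cons x u)
  have closed: "\<phi> w \<in> carrier A" for w using assms(1) by (simp add: letter_additive_def)
  obtain p du' where du: "du = p # du'" "x \<in> grade A p" "homogeneous A u du'"
    using Cons.prems by (auto simp: homogeneous_def list_all2_Cons1)
  have "\<phi> (u' @ map \<sigma> (x # u) @ v) = signed A (p + 1) (\<phi> ((u' @ [x]) @ map \<sigma> u @ v))"
    using letter_signed[OF assms(1) grade_carrier[OF du(2)], of u' "p + 1"]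
    by (simp add: \<sigma>_grade[OF du(2)])
  also have "\<dots> = signed A (p + 1 + (sum_list du' + int (length u))) (\<phi> (u' @ (x # u) @ v))"
    using Cons.IH[OF du(3), of "u' @ [x]"] by (simp add: M.signed_signed closed)
  finally show ?case by (simp add: du algebra_simps)
qed

text \<open>
  Twisting by \<open>\<iota>\<close> turns the operations on suspended words into operations with Keller's signs, and is
  linear also on inhomogeneous elements.  On a word with degrees \<open>ds\<close> it amounts to the sign
  \<open>twist_sign ds\<close>, the Koszul sign of applying $s^{\otimes k}$.
\<close>

primrec twist :: "'a list \<Rightarrow> 'a list" where
  "twist [] = []"
| "twist (x # w) = (\<iota> ^^ length w) x # twist w"

primrec twist_sign :: "int list \<Rightarrow> int" where
  "twist_sign [] = 0"
| "twist_sign (p # ds) = int (length ds) * p + twist_sign ds"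

lemma twist_sign_append:
  "twist_sign (ds @ es) = twist_sign ds + int (length es) * sum_list ds + twist_sign es"
  by (induction ds) (simp_all add: algebra_simps)

lemma \<iota>_power_grade: "x \<in> grade A p \<Longrightarrow> (\<iota> ^^ k) x = signed A (int k * p) x"
proof (induction k)
  case (Suc k)
  then show ?case
    using \<iota>_grade[OF signed_grade, of x p]
    by (simp add: M.signed_signed grade_carrier algebra_simps)
qed (simp add: signed_def)

lemma letter_twist:
  assumes "letter_additive \<phi>" "homogeneous A w ds"
  shows "\<phi> (u @ twist w) = signed A (twist_sign ds) (\<phi> (u @ w))"
  using assms(2)
proof (induction w arbitrary: u ds)
  case Nil
  then show ?case by (simp add: homogeneous_def signed_def)
next
  case (Cons x w)
  have closed: "\<phi> w \<in> carrier A" for w using assms(1) by (simp add: letter_additive_def)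
  obtain p ds' where ds: "ds = p # ds'" "x \<in> grade A p" "homogeneous A w ds'"
    using Cons.prems by (auto simp: homogeneous_def list_all2_Cons1)
  have "\<phi> (u @ twist (x # w)) = signed A (int (length w) * p) (\<phi> ((u @ [x]) @ twist w))"
    using letter_signed[OF assms(1) grade_carrier[OF ds(2)], of u "int (length w) * p"]
    by (simp add: \<iota>_power_grade[OF ds(2)])
  also have "\<dots> = signed A (int (length w) * p + twist_sign ds') (\<phi> (u @ x # w))"
    using Cons.IH[OF ds(3), of "u @ [x]"] by (simp add: M.signed_signed closed)
  finally show ?case by (simp add: ds homogeneous_length[OF ds(3)])
qed

text \<open>Translates the coderivation form of the identities into Keller's form. It serves twice:
  \<open>\<phi> = \<beta>\<close> gives the relations of the algebra, \<open>\<phi> = \<tau>\<close>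
  the left-hand side of the relations of the morphism.\<close>

lemma insertion_sum_twist:
  assumes \<phi>: "letter_additive \<phi>" and xs: "homogeneous A xs ds" and N: "length xs = N"
  shows "insertion_sum A (\<lambda>k w. \<phi> (twist w)) (\<lambda>k w. \<beta> (twist w)) N xs ds
    = signed A (twist_sign ds) (ins xs \<phi>)"
proof -
  have closed: "\<phi> w \<in> carrier A" for w using \<phi> by (simp add: letter_additive_def)
  let ?S = "{(r, k, t). r + k + t = N \<and> 1 \<le> k}"
  let ?f = "\<lambda>(r, k, t). \<phi> (map \<sigma> (take r xs) @ [\<beta> (take k (drop r xs))] @ drop (r + k) xs)"
  have "signed A (twist_sign ds) (ins xs \<phi>) = signed A (twist_sign ds) (finsum A ?f ?S)"
    using N by (simp add: M.insert_op_eq_finsum closed)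
  also have "\<dots> = (\<Oplus>a\<in>?S. signed A (twist_sign ds) (?f a))"
    by (rule M.additive_finsum) (use M.finite_triples[of N] in \<open>auto simp: M.signed_add closed\<close>)
  also have "\<dots> = insertion_sum A (\<lambda>k w. \<phi> (twist w)) (\<lambda>k w. \<beta> (twist w)) N xs ds"
    unfolding insertion_sum_def
  proof (rule M.finsum_cong'; clarsimp simp: closed)
    fix r k t assume "N = r + k + t" "Suc 0 \<le> k"
    define u v w where "u = take r xs" and "v = take k (drop r xs)" and "w = drop (r + k) xs"
    have xs_eq: "xs = u @ v @ w" unfolding u_def v_def w_def
      by (metis append_take_drop_id take_drop drop_drop add.commute append.assoc)
    obtain du dv dw where ds: "ds = du @ dv @ dw"
      and hom: "homogeneous A u du" "homogeneous A v dv" "homogeneous A w dw"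
      using xs unfolding xs_eq homogeneous_append by blast
    have len: "length u = r" "length v = k" "length w = t"
      using \<open>N = r + k + t\<close> N by (auto simp: u_def v_def w_def)
    have take_ds: "take r ds = du" using ds len homogeneous_length[OF hom(1)] by simp
    \<comment> \<open>The degree of \<open>\<beta> v\<close> enters the twist of the contracted
      word; its summand \<open>- int k\<close>, multiplied by the number \<open>t\<close> of letters
      to the right, produces the term \<open>s t\<close> of Keller's sign.\<close>
    define q where "q = sum_list dv + 2 - int k"
    have q: "\<beta> v \<in> grade A q" using \<beta>_grade[OF hom(2)] len by (simp add: q_def)
    have "\<beta> (twist v) = signed A (twist_sign dv) (\<beta> v)"
      using letter_twist[OF letter_additive_\<beta> hom(2), of "[]"] by simp
    moreover have "homogeneous A (u @ [signed A (twist_sign dv) (\<beta> v)] @ w) (du @ [q] @ dw)"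
      using hom q by (auto simp: homogeneous_def list_all2_appendI signed_grade)
    then have "\<phi> (twist (u @ [signed A (twist_sign dv) (\<beta> v)] @ w))
        = signed A (twist_sign (du @ [q] @ dw)) (\<phi> (u @ [signed A (twist_sign dv) (\<beta> v)] @ w))"
      using letter_twist[OF \<phi>, of _ _ "[]"] by simp
    moreover have "\<phi> (u @ [signed A (twist_sign dv) (\<beta> v)] @ w)
        = signed A (twist_sign dv) (\<phi> (u @ \<beta> v # w))"
      using letter_signed[OF \<phi>, of "\<beta> v" u _ w] by simp
    ultimately have 1: "\<phi> (twist (u @ \<beta> (twist v) # w))
        = signed A (twist_sign (du @ [q] @ dw) + twist_sign dv) (\<phi> (u @ \<beta> v # w))"
      by (simp add: M.signed_signed closed)
    have 2: "\<phi> (map \<sigma> u @ \<beta> v # w) = signed A (sum_list du + int r) (\<phi> (u @ \<beta> v # w))"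
      using letter_\<sigma>[OF \<phi> hom(1), of "[]"] len by simp
    \<comment> \<open>After expanding the twists of both concatenations, the difference is
      \<open>- 2 * int t\<close>.\<close>
    have "even ((twist_sign ds + (sum_list du + int r))
        - ((int r + int k * int t + int k * sum_list du) + (twist_sign (du @ [q] @ dw) + twist_sign dv)))"
      using len homogeneous_length[OF hom(1)] homogeneous_length[OF hom(2)] homogeneous_length[OF hom(3)]
      by (simp add: ds twist_sign_append q_def algebra_simps)
    then show "signed A (twist_sign ds) (\<phi> (map \<sigma> (take r xs) @ \<beta> (take k (drop r xs)) # drop (r + k) xs))
      = signed A (int r + int k * int t + int k * sum_list (take r ds))
          (\<phi> (twist (take r xs @ \<beta> (twist (take k (drop r xs))) # drop (r + k) xs)))"
      unfolding u_def[symmetric] v_def[symmetric] w_def[symmetric] take_ds 1 2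
      by (simp add: M.signed_signed closed M.signed_cong)
  qed
  finally show ?thesis by simp
qed

end

section \<open>Cohomology\<close>

context dgca
begin

lemma coh_class_mem: "z \<in> coh_class A x \<longleftrightarrow> (\<exists>a\<in>carrier A. z = diff A a \<oplus>\<^bsub>A\<^esub> x)"
  by (auto simp: coh_class_def coboundaries_def a_r_coset_def r_coset_def)

lemma coh_class_shift:
  assumes "a \<in> carrier A" "x \<in> carrier A"
  shows "coh_class A (diff A a \<oplus>\<^bsub>A\<^esub> x) = coh_class A x"
proof
  note d = linear_mapD[OF diff_linear]
  have sub: "coh_class A (diff A b \<oplus>\<^bsub>A\<^esub> y) \<subseteq> coh_class A y" if "b \<in> carrier A" "y \<in> carrier A" for b y
  proof
    fix z assume "z \<in> coh_class A (diff A b \<oplus>\<^bsub>A\<^esub> y)"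
    then obtain c where c: "c \<in> carrier A" "z = diff A c \<oplus>\<^bsub>A\<^esub> (diff A b \<oplus>\<^bsub>A\<^esub> y)"
      unfolding coh_class_mem by blast
    have "z = diff A (c \<oplus>\<^bsub>A\<^esub> b) \<oplus>\<^bsub>A\<^esub> y"
      unfolding c(2) using c(1) that by (simp add: d M.a_assoc)
    then show "z \<in> coh_class A y"
      unfolding coh_class_mem using c(1) that(1) by blast
  qed
  show "coh_class A (diff A a \<oplus>\<^bsub>A\<^esub> x) \<subseteq> coh_class A x" by (rule sub[OF assms])
  have "diff A (\<ominus>\<^bsub>A\<^esub> a) \<oplus>\<^bsub>A\<^esub> (diff A a \<oplus>\<^bsub>A\<^esub> x) = diff A (\<ominus>\<^bsub>A\<^esub> a \<oplus>\<^bsub>A\<^esub> a) \<oplus>\<^bsub>A\<^esub> x"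
    using assms by (simp only: d M.a_assoc M.a_inv_closed)
  also have "\<dots> = x"
    using assms M.additive_zero_minus(1)[of "diff A", OF d(1,2)] by (simp add: M.l_neg)
  finally show "coh_class A x \<subseteq> coh_class A (diff A a \<oplus>\<^bsub>A\<^esub> x)"
    using sub[of "\<ominus>\<^bsub>A\<^esub> a" "diff A a \<oplus>\<^bsub>A\<^esub> x"] assms by (simp add: d)
qed

lemma coh_class_eqD:
  assumes "coh_class A x = coh_class A y" "x \<in> carrier A" "y \<in> carrier A"
  obtains a where "a \<in> carrier A" "x = diff A a \<oplus>\<^bsub>A\<^esub> y"
proof -
  have "diff A \<zero>\<^bsub>A\<^esub> = \<zero>\<^bsub>A\<^esub>"
    using M.additive_zero_minus(1)[of "diff A", OF linear_mapD(1,2)[OF diff_linear]] .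
  then have "x \<in> coh_class A x" using assms(2)
    by (auto simp: coh_class_mem intro: bexI[of _ "\<zero>\<^bsub>A\<^esub>"])
  then show ?thesis using assms(1) that by (auto simp: coh_class_mem)
qed

lemma carrier_coh_space: "carrier (coh_space A (diff A)) = coh_class A ` cocycles A (diff A)"
  by (simp add: UNION_singleton_eq_range coh_space_def quot_alg_def FactRing_def A_RCOSETS_def RCOSETS_def coh_class_def
      a_r_coset_def r_coset_def)

lemma carrier_cohomology: "carrier (cohomology A) = coh_class A ` cocycles A (diff A)"
  by (simp add: cohomology_def Let_def carrier_coh_space)

lemma grade_cohomology: "grade (cohomology A) k = coh_class A ` (cocycles A (diff A) \<inter> grade A k)"
  by (simp add: cohomology_def Let_def)

lemma zero_cohomology: "\<zero>\<^bsub>cohomology A\<^esub> = coh_class A \<zero>\<^bsub>A\<^esub>"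
proof -
  have "\<zero>\<^bsub>cohomology A\<^esub> = coboundaries A (diff A)"
    by (simp add: cohomology_def Let_def coh_space_def quot_alg_def FactRing_def)
  moreover have "coboundaries A (diff A) = coh_class A \<zero>\<^bsub>A\<^esub>"
    using linear_mapD(1)[OF diff_linear]
    by (intro Set.set_eqI) (simp add: coh_class_mem coboundaries_def image_iff cong: bex_cong)
  ultimately show ?thesis by simp
qed

lemma one_cohomology: "\<one>\<^bsub>cohomology A\<^esub> = coh_class A \<one>\<^bsub>A\<^esub>"
  by (simp add: cohomology_def Let_def coh_space_def quot_alg_def FactRing_def coh_class_def
      a_r_coset_def r_coset_def)

lemma diff_cohomology: "diff (cohomology A) = (\<lambda>_. \<zero>\<^bsub>cohomology A\<^esub>)"
  by (simp add: cohomology_def Let_def)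

lemma add_cohomology:
  assumes "x \<in> carrier A" "y \<in> carrier A"
  shows "coh_class A x \<oplus>\<^bsub>cohomology A\<^esub> coh_class A y = coh_class A (x \<oplus>\<^bsub>A\<^esub> y)"
proof -
  note d = linear_mapD[OF diff_linear]
  have "coh_class A x \<oplus>\<^bsub>cohomology A\<^esub> coh_class A y = coh_class A x <+>\<^bsub>A\<^esub> coh_class A y"
    by (simp add: cohomology_def Let_def coh_space_def quot_alg_def FactRing_def set_add_def set_mult_def)
  also have "\<dots> = coh_class A (x \<oplus>\<^bsub>A\<^esub> y)"
  proof (rule Set.set_eqI)
    fix z
    have "z \<in> coh_class A (x \<oplus>\<^bsub>A\<^esub> y)" if "a \<in> carrier A" "b \<in> carrier A"
      "z = (diff A a \<oplus>\<^bsub>A\<^esub> x) \<oplus>\<^bsub>A\<^esub> (diff A b \<oplus>\<^bsub>A\<^esub> y)" for a b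
      unfolding coh_class_mem
      using that assms by (intro bexI[of _ "a \<oplus>\<^bsub>A\<^esub> b"]) (simp_all add: d M.a_ac)
    moreover have "\<exists>a\<in>carrier A. \<exists>b\<in>carrier A. z = (diff A a \<oplus>\<^bsub>A\<^esub> x) \<oplus>\<^bsub>A\<^esub> (diff A b \<oplus>\<^bsub>A\<^esub> y)"
      if "c \<in> carrier A" "z = diff A c \<oplus>\<^bsub>A\<^esub> (x \<oplus>\<^bsub>A\<^esub> y)" for c
    proof (intro bexI)
      have "diff A \<zero>\<^bsub>A\<^esub> = \<zero>\<^bsub>A\<^esub>" using M.additive_zero_minus(1)[of "diff A", OF d(1,2)] .
      then show "z = (diff A c \<oplus>\<^bsub>A\<^esub> x) \<oplus>\<^bsub>A\<^esub> (diff A \<zero>\<^bsub>A\<^esub> \<oplus>\<^bsub>A\<^esub> y)"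
        using that assms by (simp add: d M.a_assoc)
    qed (use that in simp_all)
    moreover have "z \<in> coh_class A x <+>\<^bsub>A\<^esub> coh_class A y \<longleftrightarrow>
        (\<exists>a\<in>carrier A. \<exists>b\<in>carrier A. z = (diff A a \<oplus>\<^bsub>A\<^esub> x) \<oplus>\<^bsub>A\<^esub> (diff A b \<oplus>\<^bsub>A\<^esub> y))"
      unfolding M.mem_set_add Bex_def coh_class_mem by blast
    ultimately show "z \<in> coh_class A x <+>\<^bsub>A\<^esub> coh_class A y \<longleftrightarrow> z \<in> coh_class A (x \<oplus>\<^bsub>A\<^esub> y)"
      using coh_class_mem[of z "x \<oplus>\<^bsub>A\<^esub> y"] by blast
  qed
  finally show ?thesis .
qed

lemma smult_cohomology:
  assumes "c \<in> carrier F" "x \<in> carrier A"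
  shows "c \<odot>\<^bsub>cohomology A\<^esub> coh_class A x = coh_class A (c \<odot>\<^bsub>A\<^esub> x)"
proof -
  note d = linear_mapD[OF diff_linear]
  have "c \<odot>\<^bsub>cohomology A\<^esub> coh_class A x = (\<Union>y\<in>coh_class A x. coh_class A (c \<odot>\<^bsub>A\<^esub> y))"
    by (simp add: cohomology_def Let_def coh_space_def quot_alg_def coh_class_def a_r_coset_def r_coset_def)
  also have "\<dots> = coh_class A (c \<odot>\<^bsub>A\<^esub> x)"
  proof -
    have "coh_class A (c \<odot>\<^bsub>A\<^esub> y) = coh_class A (c \<odot>\<^bsub>A\<^esub> x)" if y: "y \<in> coh_class A x" for y
    proof -
      obtain a where a: "a \<in> carrier A" "y = diff A a \<oplus>\<^bsub>A\<^esub> x" using y by (auto simp: coh_class_mem)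
      then have "c \<odot>\<^bsub>A\<^esub> y = diff A (c \<odot>\<^bsub>A\<^esub> a) \<oplus>\<^bsub>A\<^esub> c \<odot>\<^bsub>A\<^esub> x"
        using assms by (simp add: d smult_r_distr)
      then show ?thesis using assms a by (simp add: coh_class_shift)
    qed
    moreover have "coh_class A x \<noteq> {}" using assms(2) coh_class_mem[of "diff A \<zero>\<^bsub>A\<^esub> \<oplus>\<^bsub>A\<^esub> x" x] by auto
    ultimately show ?thesis by blast
  qed
  finally show ?thesis .
qed

end

context hodge_dgca
begin

lemma coh_class_d: "a \<in> carrier A \<Longrightarrow> coh_class A (d a) = \<zero>\<^bsub>cohomology A\<^esub>"
  using coh_class_shift[of a \<zero>] by (simp add: zero_cohomology)

lemma cocycles_iff: "x \<in> cocycles A d \<longleftrightarrow> x \<in> carrier A \<and> d x = \<zero>"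
  by (simp add: cocycles_def)

lemma coh_class_P: "x \<in> cocycles A d \<Longrightarrow> coh_class A (P x) = coh_class A x"
proof -
  assume "x \<in> cocycles A d"
  then have x: "x \<in> carrier A" "d x = \<zero>" by (simp_all add: cocycles_iff)
  then have "d (h x) \<oplus> P x = x" using homotopy[of x, symmetric] by simp
  then show ?thesis using coh_class_shift[of "h x" "P x"] x by simp
qed

lemma bij_coh_class: "bij_betw (coh_class A) H (carrier (cohomology A))"
  unfolding bij_betw_def
proof
  show "inj_on (coh_class A) H"
  proof (rule inj_onI)
    fix x y assume xy: "x \<in> H" "y \<in> H" "coh_class A x = coh_class A y"
    then obtain a where a: "a \<in> carrier A" "x = d a \<oplus> y" using coh_class_eqD[of x y] by auto
    have "P x = P y" unfolding a(2) using a(1) xy(2) by (simp add: P_add del: P_of_H)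
    then show "x = y" using xy by simp
  qed
  have "coh_class A x \<in> coh_class A ` H" if "x \<in> cocycles A d" for x
    using coh_class_P[OF that, symmetric] P_H[of x] by (rule image_eqI)
  then show "coh_class A ` H = carrier (cohomology A)"
    by (auto simp: carrier_cohomology cocycles_iff)
qed

lemma coh_class_eq_zero: "x \<in> cocycles A d \<Longrightarrow> coh_class A x = \<zero>\<^bsub>cohomology A\<^esub> \<longleftrightarrow> P x = \<zero>"
proof -
  assume "x \<in> cocycles A d"
  then have "coh_class A x = \<zero>\<^bsub>cohomology A\<^esub> \<longleftrightarrow> coh_class A (P x) = coh_class A \<zero>"
    by (simp add: coh_class_P zero_cohomology)
  also have "\<dots> \<longleftrightarrow> P x = \<zero>"
    using inj_on_eq_iff[OF bij_betw_imp_inj_on[OF bij_coh_class] P_H H_zero] .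
  finally show ?thesis .
qed

lemma mult_cohomology:
  assumes "x \<in> cocycles A d" "y \<in> cocycles A d"
  shows "coh_class A x \<otimes>\<^bsub>cohomology A\<^esub> coh_class A y = coh_class A (x \<otimes> y)"
proof -
  have xy: "x \<in> carrier A" "y \<in> carrier A" "d x = \<zero>" "d y = \<zero>" using assms by (simp_all add: cocycles_iff)
  have "coh_class A x \<otimes>\<^bsub>cohomology A\<^esub> coh_class A y
      = (\<Union>a\<in>coh_class A x. \<Union>b\<in>coh_class A y. coh_class A (a \<otimes> b))"
    by (simp add: cohomology_def Let_def coh_space_def quot_alg_def FactRing_def rcoset_mult_def
        coh_class_def a_r_coset_def r_coset_def)
  also have "\<dots> = coh_class A (x \<otimes> y)"
  proof -
    have "coh_class A (a \<otimes> b) = coh_class A (x \<otimes> y)" if "a \<in> coh_class A x" "b \<in> coh_class A y" for a b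
    proof -
      obtain a' b' where ab: "a' \<in> carrier A" "b' \<in> carrier A" "a = d a' \<oplus> x" "b = d b' \<oplus> y"
        using \<open>a \<in> coh_class A x\<close> \<open>b \<in> coh_class A y\<close> by (auto simp: coh_class_mem)
      then have b: "b \<in> carrier A" "d b = \<zero>" using xy by (simp_all add: d_add diff_diff)
      have "a \<otimes> b = d a' \<otimes> b \<oplus> x \<otimes> b" using ab(1,3) b xy by (simp add: l_distr)
      also have "x \<otimes> b = x \<otimes> d b' \<oplus> x \<otimes> y" using ab(2,4) xy by (simp add: r_distr)
      also have "d a' \<otimes> b = d (a' \<otimes> b)" using ab b by (simp add: d_mult)
      \<comment> \<open>As \<open>x\<close> is closed, only the second term of the Leibniz rule
        remains, and \<open>\<iota>\<close> compensates its sign.\<close>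
      also have "x \<otimes> d b' = d (\<iota> x \<otimes> b')"
        using ab xy by (simp add: d_mult d_\<iota> \<iota>_\<iota>)
      finally show ?thesis using ab(1,2) b xy by (simp add: coh_class_shift)
    qed
    moreover have "coh_class A z \<noteq> {}" for z
      using coh_class_mem[of "d \<zero> \<oplus> z" z] M.zero_closed by blast
    ultimately show ?thesis by (simp cong: SUP_cong)
  qed
  finally show ?thesis .
qed

end

section \<open>The transferred \<open>A\<^sub>\<infinity>\<close>-algebra\<close>

context graded_module
begin

lemma a_inv_restrict:
  assumes "submodule W F V" "x \<in> W"
  shows "\<ominus>\<^bsub>restrict_graded V W\<^esub> x = \<ominus>\<^bsub>V\<^esub> x"
proof -
  have "add_monoid (restrict_graded V W) = (add_monoid V)\<lparr>carrier := W\<rparr>"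
    by (simp add: restrict_graded_def)
  then show ?thesis
    using group.m_inv_consistent[OF M.a_group submodule.axioms(1)[OF assms(1)] assms(2)]
    by (simp add: a_inv_def)
qed

lemma signed_restrict:
  "\<lbrakk>submodule W F V; x \<in> W\<rbrakk> \<Longrightarrow> signed (restrict_graded V W) e x = signed V e x"
  by (simp add: signed_def a_inv_restrict)

lemma insertion_sum_restrict:
  assumes "submodule W F V" "\<And>k w. g k w \<in> W"
  shows "insertion_sum (restrict_graded V W) g m N xs ds = insertion_sum V g m N xs ds"
proof -
  have "signed V e (g k w) \<in> W" for e k w
    using assms submoduleE(3)[OF assms(1)] by (simp add: signed_def)
  then show ?thesis
    unfolding insertion_sum_def using assms
    by (simp add: signed_restrict split_def finsum_restrict)
qed

end

section \<open>DGCAs as A_infinity-algebras\<close>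

context dgca
begin

lemma dga_operations_closed:
  assumes "length w = k" "set w \<subseteq> carrier A"
  shows "dga_operations A k w \<in> carrier A"
proof -
  have "w ! i \<in> carrier A" if "i < k" for i using assms that by (auto simp: set_conv_nth)
  then show ?thesis by (simp add: dga_operations_def linear_mapD[OF diff_linear])
qed

lemma linear_map_zero: "linear_map F A A (\<lambda>x. \<zero>\<^bsub>A\<^esub>)"
  by (simp add: linear_map_def)

lemma multilinear_dga_operations: "multilinear_family F 2 A A (dga_operations A)"
  unfolding multilinear_family_def multilinear_def
proof (intro allI impI conjI)
  fix k j :: nat and xs assume k: "k \<ge> 1" "length xs = k \<and> set xs \<subseteq> carrier A" "j < k"
  then have nth: "xs ! i \<in> carrier A" if "i < k" for i using that by (auto simp: set_conv_nth)
  consider "k = 1" | "k = 2" "j = 0" | "k = 2" "j = 1" | "k \<ge> 3" using k by linarith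
  then show "linear_map F A A (\<lambda>x. dga_operations A k (xs[j := x]))"
  proof cases
    case 1
    then show ?thesis using k diff_linear by (simp add: dga_operations_def linear_map_def)
  next
    case 2
    then show ?thesis using k nth
      by (simp add: dga_operations_def linear_map_def l_distr smult_mult_left)
  next
    case 3
    then show ?thesis using k nth
      by (simp add: dga_operations_def linear_map_def r_distr smult_mult_right)
  next
    case 4
    then show ?thesis using linear_map_zero by (simp add: dga_operations_def)
  qed
next
  fix k :: nat and xs ds assume k: "k \<ge> 1" "length xs = k \<and> homogeneous A xs ds"
  then have len: "length ds = k" by (auto simp: homogeneous_def dest: list_all2_lengthD)
  have grade: "xs ! i \<in> grade A (ds ! i)" if "i < k" for i
    using k that by (auto simp: homogeneous_def dest: list_all2_nthD)
  consider "k = 1" | "k = 2" | "k \<ge> 3" using k by linarith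
  then show "dga_operations A k xs \<in> grade A (sum_list ds + 2 - int k)"
  proof cases
    case 1
    then obtain p where "ds = [p]" using len by (auto simp: length_Suc_conv)
    then show ?thesis using 1 grade[of 0] diff_grade[of "xs ! 0" p]
      by (simp add: dga_operations_def add.commute)
  next
    case 2
    then obtain p q where "ds = [p, q]" using len by (auto simp: length_Suc_conv numeral_2_eq_2)
    then show ?thesis using 2 grade[of 0] grade[of 1] mult_grade[of "xs ! 0" p "xs ! 1" q]
      by (simp add: dga_operations_def)
  next
    case 3
    then show ?thesis by (simp add: dga_operations_def grade_zero)
  qed
qed

text \<open>For \<open>N = 1, 2, 3\<close> the identities are \<open>d d = 0\<close>, the Leibniz
  rule and associativity. In every other term the inner or the outer operation has arity at least
  three, and an inner zero is preserved by \<open>d\<close> and by products.\<close>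

lemma insertion_sum_dga:
  assumes "N \<ge> 1" "length xs = N" "homogeneous A xs ds"
  shows "insertion_sum A (dga_operations A) (dga_operations A) N xs ds = \<zero>\<^bsub>A\<^esub>"
proof -
  note d = linear_mapD[OF diff_linear]
  have d0: "diff A \<zero>\<^bsub>A\<^esub> = \<zero>\<^bsub>A\<^esub>" using M.additive_zero_minus(1)[of "diff A", OF d(1,2)] .
  have hom: "list_all2 (\<lambda>x p. x \<in> grade A p) xs ds" using assms(3) by (simp add: homogeneous_def)
  have carrier: "xs ! i \<in> carrier A" if "i < N" for i
    using list_all2_nthD[OF hom] assms(2) that by (auto dest: grade_carrier)
  let ?g = "\<lambda>(r, s, t). signed A (int r + int s * int t + int s * sum_list (take r ds))
          (dga_operations A (r + 1 + t)
            (take r xs @ [dga_operations A s (take s (drop r xs))] @ drop (r + s) xs))"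
  have zero: "?g (r, s, t) = \<zero>\<^bsub>A\<^esub>" if rst: "N = r + s + t" "1 \<le> s" "N \<ge> 3" "\<not> (N = 3 \<and> s = 2)" for r s t
  proof -
    consider "r + 1 + t \<ge> 3" | "s \<ge> 3" "r + t \<le> 1" using rst by linarith
    then have "dga_operations A (r + 1 + t)
        (take r xs @ [dga_operations A s (take s (drop r xs))] @ drop (r + s) xs) = \<zero>\<^bsub>A\<^esub>"
    proof cases
      case 1
      then show ?thesis by (auto simp: dga_operations_def)
    next
      case 2
      then have inner: "dga_operations A s w = \<zero>\<^bsub>A\<^esub>" for w by (simp add: dga_operations_def)
      consider "r = 0" "t = 0" | "r = 0" "t = 1" | "r = 1" "t = 0" using 2 by linarith
      then show ?thesis unfolding inner
        by cases (use rst assms(2) carrier in \<open>simp_all add: dga_operations_def d0 nth_append\<close>)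
    qed
    then show ?thesis by simp
  qed
  have closed: "?g a \<in> carrier A" if in_S: "a \<in> {(r, s, t). r + s + t = N \<and> 1 \<le> s}" for a
  proof -
    obtain r s t where a: "a = (r, s, t)" "r + s + t = N" "1 \<le> s" using in_S by auto
    have sub: "set xs \<subseteq> carrier A" using carrier assms(2) by (auto simp: set_conv_nth)
    have "dga_operations A s (take s (drop r xs)) \<in> carrier A"
      using sub a assms(2) by (intro dga_operations_closed) (auto dest!: in_set_takeD in_set_dropD)
    then have "dga_operations A (r + 1 + t)
        (take r xs @ [dga_operations A s (take s (drop r xs))] @ drop (r + s) xs) \<in> carrier A"
      using sub a assms(2) by (intro dga_operations_closed) (auto dest!: in_set_takeD in_set_dropD)
    then show ?thesis by (simp add: a)
  qed
  consider "N = 1" | "N = 2" | "N = 3" | "N \<ge> 4" using assms(1) by linarith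
  then show ?thesis
  proof cases
    case 1
    then obtain x p where x: "xs = [x]" "ds = [p]" "x \<in> grade A p"
      using hom assms(2) by (auto simp: length_Suc_conv list_all2_Cons1)
    have "{(r, s, t). r + s + t = N \<and> 1 \<le> s} = {(0, 1, 0)}" using 1 by auto
    then show ?thesis using x grade_carrier[OF x(3)]
      unfolding insertion_sum_def by (simp add: dga_operations_def diff_diff d signed_def)
  next
    case 2
    then obtain x p y q where x: "xs = [x, y]" "ds = [p, q]" "x \<in> grade A p" "y \<in> grade A q"
      using hom assms(2) by (auto simp: length_Suc_conv numeral_2_eq_2 list_all2_Cons1)
    have xy: "x \<in> carrier A" "y \<in> carrier A" using x grade_carrier by auto
    have S: "{(r, s, t). r + s + t = N \<and> 1 \<le> s} = {(0, 2, 0), (0, 1, 1), (1, 1, 0)}"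
      using 2 by auto
    have "insertion_sum A (dga_operations A) (dga_operations A) N xs ds
        = diff A (x \<otimes>\<^bsub>A\<^esub> y) \<oplus>\<^bsub>A\<^esub> (\<ominus>\<^bsub>A\<^esub> (diff A x \<otimes>\<^bsub>A\<^esub> y) \<oplus>\<^bsub>A\<^esub> signed A (1 + p) (x \<otimes>\<^bsub>A\<^esub> diff A y))"
      unfolding insertion_sum_def S using x xy
      by (simp add: dga_operations_def d signed_def)
    also have "signed A (1 + p) (x \<otimes>\<^bsub>A\<^esub> diff A y) = \<ominus>\<^bsub>A\<^esub> signed A p (x \<otimes>\<^bsub>A\<^esub> diff A y)"
      using xy by (simp add: signed_def d)
    finally show ?thesis
      using xy Leibniz[OF x(3) xy(2)] by (simp add: d M.r_neg flip: M.minus_add)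
  next
    case 3
    then obtain x p y q z r where x: "xs = [x, y, z]" "ds = [p, q, r]"
        "x \<in> grade A p" "y \<in> grade A q" "z \<in> grade A r"
      using hom assms(2) by (auto simp: length_Suc_conv numeral_3_eq_3 list_all2_Cons1)
    have xyz: "x \<in> carrier A" "y \<in> carrier A" "z \<in> carrier A" using x grade_carrier by auto
    let ?S = "{(r, s, t). r + s + t = N \<and> 1 \<le> s}"
    have "insertion_sum A (dga_operations A) (dga_operations A) N xs ds = finsum A ?g ?S"
      by (simp add: insertion_sum_def)
    also have "\<dots> = finsum A ?g {(0, 2, 1), (1, 2, 0)}"
    proof (rule M.add.finprod_mono_neutral_cong_right)
      show "finite ?S" by (rule M.finite_triples)
      show "{(0, 2, 1), (1, 2, 0)} \<subseteq> ?S" using 3 by auto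
      show "?g a = \<zero>\<^bsub>A\<^esub>" if in_S: "a \<in> ?S - {(0, 2, 1), (1, 2, 0)}" for a
      proof -
        obtain r s t where a: "a = (r, s, t)" "N = r + s + t" "1 \<le> s" using in_S by auto
        moreover have "s \<noteq> 2"
        proof
          assume "s = 2"
          then have "r = 0 \<and> t = 1 \<or> r = 1 \<and> t = 0" using a 3 by auto
          then show False using in_S a \<open>s = 2\<close> by auto
        qed
        ultimately show ?thesis using zero[of r s t] 3 by simp
      qed
      show "?g \<in> ?S \<rightarrow> carrier A" using closed by blast
    qed simp
    also have "\<dots> = (x \<otimes>\<^bsub>A\<^esub> y) \<otimes>\<^bsub>A\<^esub> z \<oplus>\<^bsub>A\<^esub> \<ominus>\<^bsub>A\<^esub> (x \<otimes>\<^bsub>A\<^esub> (y \<otimes>\<^bsub>A\<^esub> z))"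
      using xyz by (simp add: x dga_operations_def signed_def)
    finally show ?thesis using xyz by (simp add: m_assoc M.r_neg)
  next
    case 4
    show ?thesis
      unfolding insertion_sum_def
      by (rule M.add.finprod_one_eqI) (use zero 4 in auto)
  qed
qed

lemma a_inf_algebra_dga: "a_inf_algebra F A (dga_operations A)"
  unfolding a_inf_algebra_def
  using graded_module_axioms multilinear_dga_operations insertion_sum_dga by blast

text \<open>Needed because \<open>finsum\<close> is zero by convention on infinite index sets; parts
  being positive, a composition of \<open>N\<close> has at most \<open>N\<close> parts.\<close>

lemma finite_compositions: "finite {is. (\<forall>i\<in>set is. 1 \<le> i) \<and> sum_list is = (N :: nat)}"
proof (rule finite_subset[OF _ finite_lists_length_le[of "{..N}" N]])
  have "length is \<le> sum_list is" if "\<forall>i\<in>set is. 1 \<le> i" for "is" :: "nat list"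
    using that by (induction "is") auto
  then show "{is. (\<forall>i\<in>set is. 1 \<le> i) \<and> sum_list is = N} \<subseteq> {xs. set xs \<subseteq> {..N} \<and> length xs \<le> N}"
    using member_le_sum_list by fastforce
qed simp

text \<open>The operations of \<open>A\<close> stop at arity two, so only the compositions
  \<open>[N]\<close> and \<open>[i, N - i]\<close> contribute.\<close>

lemma block_sum_dga:
  assumes N: "N \<ge> 1" "length xs = N" and f: "\<And>k w. f k w \<in> carrier A"
  shows "block_sum A (dga_operations A) f N xs ds = diff A (f N xs) \<oplus>\<^bsub>A\<^esub>
    (\<Oplus>\<^bsub>A\<^esub>i\<in>{1..<N}. signed A (int i - 1 + (int N - int i - 1) * sum_list (take i ds))
      (f i (take i xs) \<otimes>\<^bsub>A\<^esub> f (N - i) (drop i xs)))"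
proof -
  let ?S = "{is. (\<forall>i\<in>set is. 1 \<le> i) \<and> sum_list is = N}"
  let ?T = "insert [N] ((\<lambda>i. [i, N - i]) ` {1..<N})"
  define g where "g = (\<lambda>is. signed A
    (\<Sum>j<length is. (int (length is) - 1 - int j) * (int (is ! j) - 1)
                          + (int (is ! j) - 1) * sum_list (take (sum_list (take j is)) ds))
          (dga_operations A (length is) (map (\<lambda>b. f (length b) b) (split_blocks is xs))))"
  have ops: "dga_operations A k (map (\<lambda>b. f (length b) b) bs) \<in> carrier A" if "length bs = k" for k bs
    using that f by (intro dga_operations_closed) auto
  have split_length: "length (split_blocks is w) = length is" for "is" and w :: "'b list"
    by (induction "is" arbitrary: w) auto
  have closed: "g is \<in> carrier A" for "is"
    by (simp add: g_def ops split_length)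
  have "(\<Oplus>\<^bsub>A\<^esub>is\<in>?T. g is) = (\<Oplus>\<^bsub>A\<^esub>is\<in>?S. g is)"
  proof (rule M.add.finprod_mono_neutral_cong_left)
    show "finite ?S" by (rule finite_compositions)
    show "?T \<subseteq> ?S" using N by auto
    show "g is = \<zero>\<^bsub>A\<^esub>" if "is \<in> ?S - ?T" for "is"
    proof -
      have "length is \<ge> 3"
      proof (rule ccontr)
        assume "\<not> length is \<ge> 3"
        then consider "is = []" | i where "is = [i]" | i j where "is = [i, j]"
          by (cases "is" rule: list.exhaust; cases "tl is"; cases "tl (tl is)") auto
        then show False using that N by cases (auto simp: image_iff)
      qed
      then show ?thesis by (simp add: g_def dga_operations_def)
    qed
  qed (use closed in auto)
  then have "block_sum A (dga_operations A) f N xs ds = (\<Oplus>\<^bsub>A\<^esub>is\<in>?T. g is)"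
    unfolding block_sum_def g_def by simp
  also have "\<dots> = g [N] \<oplus>\<^bsub>A\<^esub> (\<Oplus>\<^bsub>A\<^esub>is\<in>(\<lambda>i. [i, N - i]) ` {1..<N}. g is)"
    by (rule M.finsum_insert) (use closed in auto)
  also have "g [N] = diff A (f N xs)"
    using N by (simp add: g_def dga_operations_def signed_def)
  also have "(\<Oplus>\<^bsub>A\<^esub>is\<in>(\<lambda>i. [i, N - i]) ` {1..<N}. g is) = (\<Oplus>\<^bsub>A\<^esub>i\<in>{1..<N}. g [i, N - i])"
    by (rule M.finsum_reindex) (use closed in \<open>auto simp: inj_on_def\<close>)
  also have "\<dots> = (\<Oplus>\<^bsub>A\<^esub>i\<in>{1..<N}. signed A (int i - 1 + (int N - int i - 1) * sum_list (take i ds))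
      (f i (take i xs) \<otimes>\<^bsub>A\<^esub> f (N - i) (drop i xs)))"
    by (rule M.finsum_cong')
      (use N f in \<open>auto simp: g_def dga_operations_def numeral_2_eq_2 min_def of_nat_diff\<close>)
  finally show ?thesis .
qed

end

section \<open>The transferred operations and their quasi-isomorphism to \<open>A\<close>\<close>

context hodge_dgca
begin

definition transfer_mult :: "nat \<Rightarrow> 'a list \<Rightarrow> 'a" where
  "transfer_mult k w = \<beta> (twist w)"

definition transfer_morphism :: "nat \<Rightarrow> 'a list \<Rightarrow> 'a" where
  "transfer_morphism k w = \<tau> (twist w)"

lemma letter_smult:
  assumes c: "c \<in> carrier F" and x: "x \<in> carrier A"
  shows "\<tau> (u @ (c \<odot> x) # v) = c \<odot> \<tau> (u @ x # v)" and "\<beta> (u @ (c \<odot> x) # v) = c \<odot> \<beta> (u @ x # v)"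
proof -
  have *: "\<tau> (u @ (c \<odot> x) # v) = c \<odot> \<tau> (u @ x # v) \<and> \<Lambda> (u @ (c \<odot> x) # v) = c \<odot> \<Lambda> (u @ x # v)"
    by (rule letter_hom) (use c x in \<open>simp_all add: smult_r_distr smult_mult_left smult_mult_right
      h_smult P_smult \<sigma>_def \<iota>_smult smult_r_minus\<close>)
  then show "\<tau> (u @ (c \<odot> x) # v) = c \<odot> \<tau> (u @ x # v)" by simp
  show "\<beta> (u @ (c \<odot> x) # v) = c \<odot> \<beta> (u @ x # v)"
    using * c by (simp add: \<beta>_def P_smult smult_r_minus)
qed

lemma \<iota>_power:
  "x \<in> carrier A \<Longrightarrow> (\<iota> ^^ k) x \<in> carrier A"
  "\<lbrakk>x \<in> carrier A; y \<in> carrier A\<rbrakk> \<Longrightarrow> (\<iota> ^^ k) (x \<oplus> y) = (\<iota> ^^ k) x \<oplus> (\<iota> ^^ k) y"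
  "\<lbrakk>c \<in> carrier F; x \<in> carrier A\<rbrakk> \<Longrightarrow> (\<iota> ^^ k) (c \<odot> x) = c \<odot> (\<iota> ^^ k) x"
proof -
  show 1: "x \<in> carrier A \<Longrightarrow> (\<iota> ^^ k) x \<in> carrier A" for k x by (induction k) auto
  show "\<lbrakk>x \<in> carrier A; y \<in> carrier A\<rbrakk> \<Longrightarrow> (\<iota> ^^ k) (x \<oplus> y) = (\<iota> ^^ k) x \<oplus> (\<iota> ^^ k) y"
    by (induction k) (simp_all add: \<iota>_add 1)
  show "\<lbrakk>c \<in> carrier F; x \<in> carrier A\<rbrakk> \<Longrightarrow> (\<iota> ^^ k) (c \<odot> x) = c \<odot> (\<iota> ^^ k) x"
    by (induction k) (simp_all add: \<iota>_smult 1)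
qed

text \<open>The power of \<open>\<iota>\<close> at a letter depends only on the number of letters to
  its right. So the rest of the twisted word is independent of \<open>x\<close>, and linearity in
  \<open>x\<close> survives the twist.\<close>

lemma twist_letter: "\<exists>u'. \<forall>x. twist (u @ x # v) = u' @ (\<iota> ^^ length v) x # twist v"
proof (induction u)
  case (Cons y u)
  then obtain u' where "\<And>x. twist (u @ x # v) = u' @ (\<iota> ^^ length v) x # twist v" by blast
  then have "twist ((y # u) @ x # v)
      = ((\<iota> ^^ (length u + Suc (length v))) y # u') @ (\<iota> ^^ length v) x # twist v" for x
    by simp
  then show ?case by blast
qed (intro exI[of _ "[]"], simp)

lemma twist_linear:
  assumes "letter_additive \<phi>"
    and "\<And>u v c x. \<lbrakk>c \<in> carrier F; x \<in> carrier A\<rbrakk> \<Longrightarrow> \<phi> (u @ (c \<odot> x) # v) = c \<odot> \<phi> (u @ x # v)"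
    and "j < length xs"
  shows "\<lbrakk>x \<in> carrier A; y \<in> carrier A\<rbrakk> \<Longrightarrow>
      \<phi> (twist (xs[j := x \<oplus> y])) = \<phi> (twist (xs[j := x])) \<oplus> \<phi> (twist (xs[j := y]))"
    and "\<lbrakk>c \<in> carrier F; x \<in> carrier A\<rbrakk> \<Longrightarrow>
      \<phi> (twist (xs[j := c \<odot> x])) = c \<odot> \<phi> (twist (xs[j := x]))"
proof -
  obtain u where "\<And>x. twist (take j xs @ x # drop (Suc j) xs)
      = u @ (\<iota> ^^ length (drop (Suc j) xs)) x # twist (drop (Suc j) xs)"
    using twist_letter by blast
  then have u: "twist (xs[j := x]) = u @ (\<iota> ^^ length (drop (Suc j) xs)) x # twist (drop (Suc j) xs)" for x
    using assms(3) by (simp add: upd_conv_take_nth_drop)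
  show "\<lbrakk>x \<in> carrier A; y \<in> carrier A\<rbrakk> \<Longrightarrow>
      \<phi> (twist (xs[j := x \<oplus> y])) = \<phi> (twist (xs[j := x])) \<oplus> \<phi> (twist (xs[j := y]))"
    using assms(1) unfolding u by (simp add: letter_additive_def \<iota>_power)
  show "\<lbrakk>c \<in> carrier F; x \<in> carrier A\<rbrakk> \<Longrightarrow>
      \<phi> (twist (xs[j := c \<odot> x])) = c \<odot> \<phi> (twist (xs[j := x]))"
    using assms(2) unfolding u by (simp add: \<iota>_power)
qed

lemma homogeneous_restrict: "homogeneous (restrict_graded A H) xs ds \<Longrightarrow> homogeneous A xs ds"
  unfolding homogeneous_def by (auto simp: restrict_graded_def elim!: list_all2_mono)

lemma a_inf_algebra_transfer: "a_inf_algebra F (restrict_graded A H) transfer_mult"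
  unfolding a_inf_algebra_def multilinear_family_def
proof (intro conjI allI impI)
  show "graded_module F (restrict_graded A H)" using H_graded by (simp add: graded_subspace_def)
next
  fix k :: nat assume "1 \<le> k"
  show "multilinear F k (restrict_graded A H) (restrict_graded A H) (transfer_mult k)"
    unfolding multilinear_def linear_map_def
    using twist_linear[OF letter_additive_\<beta> letter_smult(2)]
    by (auto simp: restrict_graded_def transfer_mult_def \<beta>_H)
next
  fix k :: nat and xs ds
  assume *: "length xs = k \<and> homogeneous (restrict_graded A H) xs ds"
  then have "homogeneous A xs ds" using homogeneous_restrict by blast
  then show "transfer_mult k xs \<in> grade (restrict_graded A H) (sum_list ds + 2 - int k)"
    using * letter_twist[OF letter_additive_\<beta>, of xs ds "[]"] \<beta>_grade[of xs ds] \<beta>_H[of "twist xs"]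
    by (auto simp: restrict_graded_def transfer_mult_def signed_grade)
next
  fix N :: nat and xs ds
  assume *: "1 \<le> N" "length xs = N \<and> homogeneous (restrict_graded A H) xs ds"
  then have hom: "homogeneous A xs ds" using homogeneous_restrict by blast
  have "insertion_sum (restrict_graded A H) transfer_mult transfer_mult N xs ds
      = insertion_sum A (\<lambda>k w. \<beta> (twist w)) (\<lambda>k w. \<beta> (twist w)) N xs ds"
    using insertion_sum_restrict[OF H_sub, of transfer_mult] \<beta>_H
    by (simp add: transfer_mult_def[abs_def])
  also have "\<dots> = \<zero>"
    using insertion_sum_twist[OF letter_additive_\<beta> hom] * by (simp add: ins_\<beta>)
  finally show "insertion_sum (restrict_graded A H) transfer_mult transfer_mult N xs ds
      = \<zero>\<^bsub>restrict_graded A H\<^esub>"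
    by (simp add: restrict_graded_def)
qed

text \<open>This is \<open>d_\<tau>_eq\<close> solved for \<open>ins xs \<tau>\<close>: the term
  \<open>d (\<tau> xs)\<close> matches the composition \<open>[N]\<close>, and
  \<open>\<ominus> \<Lambda> xs\<close> matches the compositions into two parts, the cuts with an
  empty part being zero.\<close>

lemma insertion_sum_eq_block_sum:
  assumes N: "N \<ge> 1" "length xs = N" and hom: "homogeneous A xs ds"
  shows "insertion_sum A transfer_morphism transfer_mult N xs ds
    = block_sum A (dga_operations A) transfer_morphism N xs ds"
proof -
  let ?e = "twist_sign ds"
  have "\<Lambda> xs = (\<Oplus>i\<in>{..N}. \<sigma> (\<tau> (take i xs)) \<otimes> \<tau> (drop i xs))"
    unfolding \<Lambda>_def using N by (simp add: M.splits_sum_eq_finsum)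
  also have "(\<Oplus>i\<in>{..N}. \<sigma> (\<tau> (take i xs)) \<otimes> \<tau> (drop i xs))
      = (\<Oplus>i\<in>{1..<N}. \<sigma> (\<tau> (take i xs)) \<otimes> \<tau> (drop i xs))"
  proof (rule M.add.finprod_mono_neutral_cong_right)
    show "\<sigma> (\<tau> (take i xs)) \<otimes> \<tau> (drop i xs) = \<zero>" if "i \<in> {..N} - {1..<N}" for i
    proof -
      have "i = 0 \<or> i = N" using that by auto
      then show ?thesis using N by auto
    qed
  qed (simp_all add: Pi_def subset_eq)
  finally have "\<ominus> signed A ?e (\<Lambda> xs)
      = \<ominus> signed A ?e (\<Oplus>i\<in>{1..<N}. \<sigma> (\<tau> (take i xs)) \<otimes> \<tau> (drop i xs))" by simp
  also have "\<dots> = (\<Oplus>i\<in>{1..<N}. \<ominus> signed A ?e (\<sigma> (\<tau> (take i xs)) \<otimes> \<tau> (drop i xs)))"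
    by (rule M.additive_finsum[where g = "\<lambda>x. \<ominus> signed A ?e x"]) (simp_all add: M.signed_add M.minus_add)
  also have "\<dots> = (\<Oplus>i\<in>{1..<N}. signed A (int i - 1 + (int N - int i - 1) * sum_list (take i ds))
      (transfer_morphism i (take i xs) \<otimes> transfer_morphism (N - i) (drop i xs)))"
  proof (rule M.finsum_cong')
    fix i assume i: "i \<in> {1..<N}"
    define u v where "u = take i xs" and "v = drop i xs"
    have "homogeneous A (u @ v) ds" using hom by (simp add: u_def v_def)
    then obtain du dv where ds: "ds = du @ dv" "homogeneous A u du" "homogeneous A v dv"
      unfolding homogeneous_append by blast
    have len: "length u = i" "length v = N - i" "length du = i" "length dv = N - i"
      using i N homogeneous_length[OF ds(2)] homogeneous_length[OF ds(3)] by (auto simp: u_def v_def)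
    have "\<sigma> (\<tau> u) = signed A (sum_list du + 2 - int i) (\<tau> u)"
      using \<sigma>_grade[OF \<tau>_grade[OF ds(2)]] len by (simp add: algebra_simps)
    then have 1: "\<ominus> signed A ?e (\<sigma> (\<tau> u) \<otimes> \<tau> v)
        = signed A (1 + ?e + (sum_list du + 2 - int i)) (\<tau> u \<otimes> \<tau> v)"
      by (simp add: signed_mult_left M.signed_signed M.minus_signed add.commute add.left_commute)
    have "\<tau> (twist u) \<otimes> \<tau> (twist v) = signed A (twist_sign du + twist_sign dv) (\<tau> u \<otimes> \<tau> v)"
      using letter_twist[OF letter_additive_\<tau> ds(2), of "[]"] letter_twist[OF letter_additive_\<tau> ds(3), of "[]"]
      by (simp add: signed_mult_left signed_mult_right M.signed_signed add.commute)
    then have 2: "signed A (int i - 1 + (int N - int i - 1) * sum_list du) (\<tau> (twist u) \<otimes> \<tau> (twist v))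
        = signed A (int i - 1 + (int N - int i - 1) * sum_list du + (twist_sign du + twist_sign dv)) (\<tau> u \<otimes> \<tau> v)"
      by (simp add: M.signed_signed)
    \<comment> \<open>The difference is \<open>4 - 2 * int i + 2 * sum_list du\<close>.\<close>
    have ev: "even ((1 + ?e + (sum_list du + 2 - int i))
        - (int i - 1 + (int N - int i - 1) * sum_list du + (twist_sign du + twist_sign dv)))"
      using i len by (simp add: ds twist_sign_append of_nat_diff algebra_simps)
    have take_ds: "take i ds = du" using ds(1) len by simp
    show "\<ominus> signed A ?e (\<sigma> (\<tau> (take i xs)) \<otimes> \<tau> (drop i xs))
        = signed A (int i - 1 + (int N - int i - 1) * sum_list (take i ds))
          (transfer_morphism i (take i xs) \<otimes> transfer_morphism (N - i) (drop i xs))"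
      by (simp only: transfer_morphism_def u_def[symmetric] v_def[symmetric] take_ds 1 2 M.signed_cong[OF ev])
  qed (simp_all add: transfer_morphism_def Pi_def)
  finally have \<Lambda>: "\<ominus> signed A ?e (\<Lambda> xs)
      = (\<Oplus>i\<in>{1..<N}. signed A (int i - 1 + (int N - int i - 1) * sum_list (take i ds))
      (transfer_morphism i (take i xs) \<otimes> transfer_morphism (N - i) (drop i xs)))" .
  have "ins xs \<tau> = d (\<tau> xs) \<oplus> \<ominus> \<Lambda> xs"
    by (simp add: d_\<tau>_eq M.a_assoc M.r_neg)
  then have "signed A ?e (ins xs \<tau>) = signed A ?e (d (\<tau> xs)) \<oplus> \<ominus> signed A ?e (\<Lambda> xs)"
    by (simp add: M.signed_add M.signed_minus)
  moreover have "d (transfer_morphism N xs) = signed A ?e (d (\<tau> xs))"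
    using letter_twist[OF letter_additive_\<tau> hom, of "[]"]
    by (simp add: transfer_morphism_def signed_def d_minus)
  moreover have "insertion_sum A transfer_morphism transfer_mult N xs ds = signed A ?e (ins xs \<tau>)"
    using insertion_sum_twist[OF letter_additive_\<tau> hom N(2)]
    by (simp add: transfer_morphism_def[abs_def] transfer_mult_def[abs_def])
  ultimately show ?thesis
    using block_sum_dga[OF N, of transfer_morphism ds] \<Lambda> by (simp add: transfer_morphism_def)
qed

lemma a_inf_morphism_transfer:
  "a_inf_morphism F (restrict_graded A H) transfer_mult A (dga_operations A) transfer_morphism"
  unfolding a_inf_morphism_def multilinear_family_def
proof (intro conjI allI impI)
  fix k :: nat assume "1 \<le> k"
  show "multilinear F k (restrict_graded A H) A (transfer_morphism k)"
    unfolding multilinear_def linear_map_def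
    using twist_linear[OF letter_additive_\<tau> letter_smult(1)]
    by (auto simp: restrict_graded_def transfer_morphism_def)
next
  fix k :: nat and xs ds
  assume *: "length xs = k \<and> homogeneous (restrict_graded A H) xs ds"
  then have "homogeneous A xs ds" using homogeneous_restrict by blast
  then show "transfer_morphism k xs \<in> grade A (sum_list ds + 1 - int k)"
    using * letter_twist[OF letter_additive_\<tau>, of xs ds "[]"] \<tau>_grade[of xs ds]
    by (auto simp: transfer_morphism_def signed_grade)
next
  fix N :: nat and xs ds
  assume *: "1 \<le> N" "length xs = N \<and> homogeneous (restrict_graded A H) xs ds"
  have "insertion_sum A transfer_morphism transfer_mult N xs ds
    = block_sum A (dga_operations A) transfer_morphism N xs ds"
    using * homogeneous_restrict by (intro insertion_sum_eq_block_sum) auto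
  then show "insertion_sum A transfer_morphism transfer_mult N xs ds
    = block_sum A (dga_operations A) transfer_morphism N xs ds" .
qed (rule a_inf_algebra_transfer a_inf_algebra_dga)+

lemma transfer_mult_1 [simp]: "transfer_mult (Suc 0) [x] = \<zero>"
  by (simp add: transfer_mult_def)

lemma carrier_coh_space_H: "carrier (coh_space (restrict_graded A H) (\<lambda>x. \<zero>)) = (\<lambda>x. {x}) ` H"
proof -
  have "carrier (coh_space (restrict_graded A H) (\<lambda>x. \<zero>)) = (\<Union>x\<in>H. {{\<zero> \<oplus> x}})"
    using H_zero by (simp add: coh_space_def quot_alg_def FactRing_def A_RCOSETS_def RCOSETS_def
        a_r_coset_def r_coset_def restrict_graded_def cocycles_def coboundaries_def image_constant)
  also have "\<dots> = (\<Union>x\<in>H. {{x}})" by (rule SUP_cong) simp_all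
  finally show ?thesis by auto
qed

text \<open>The linear part of the morphism is the inclusion of \<open>H\<close>, because
  \<open>P\<close> fixes \<open>H\<close>; on cohomology it sends a harmonic element to its
  class.\<close>

lemma a_inf_quasi_iso_transfer:
  "a_inf_quasi_iso F (restrict_graded A H) transfer_mult A (dga_operations A) transfer_morphism"
  unfolding a_inf_quasi_iso_def
proof
  have "coh_map A d (\<lambda>x. transfer_morphism 1 [x]) {x} = coh_class A x" if "x \<in> H" for x
    using that by (simp add: coh_map_def transfer_morphism_def coh_class_def)
  moreover have "bij_betw (coh_class A \<circ> the_elem) ((\<lambda>x. {x}) ` H) (carrier (coh_space A d))"
  proof (rule bij_betw_trans)
    show "bij_betw the_elem ((\<lambda>x. {x}) ` H) H"
      by (rule bij_betw_byWitness[where f' = "\<lambda>x. {x}"]) auto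
    show "bij_betw (coh_class A) H (carrier (coh_space A d))"
      using bij_coh_class by (simp add: carrier_cohomology carrier_coh_space)
  qed
  ultimately have "bij_betw (coh_map A d (\<lambda>x. transfer_morphism 1 [x])) ((\<lambda>x. {x}) ` H) (carrier (coh_space A d))"
    by (subst bij_betw_cong[where g = "coh_class A \<circ> the_elem"]) auto
  moreover have "(\<lambda>x. transfer_mult 1 [x]) = (\<lambda>x. \<zero>)" "(\<lambda>x. dga_operations A 1 [x]) = d"
    by (auto simp: dga_operations_def transfer_mult_def)
  ultimately show "bij_betw (coh_map A (\<lambda>x. dga_operations A 1 [x]) (\<lambda>x. transfer_morphism 1 [x]))
     (carrier (coh_space (restrict_graded A H) (\<lambda>x. transfer_mult 1 [x])))
     (carrier (coh_space A (\<lambda>x. dga_operations A 1 [x])))"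
    by (simp add: carrier_coh_space_H)
qed (rule a_inf_morphism_transfer)

end

section \<open>Vanishing for degree reasons\<close>

locale connected_hodge_dgca = hodge_dgca F A n I H B
  for F :: "('f, 'm) ring_scheme" and A :: "('f, 'a) dga" (structure) and n I H B +
  fixes r :: nat
  assumes field: "field F"
    and r: "r > 1"
    and connected: "connected_upto F A (r - 1)"
begin

abbreviation C where "C \<equiv> cohomology A"

lemma poincare_C: "poincare_algebra F C n I"
  using poincare unfolding poincare_dgca_def by blast

sublocale C: graded_comm_algebra F C
  using poincare_C unfolding poincare_algebra_def by blast

lemma I_functional: "linear_functional_on F C (grade C (int n)) I"
  using poincare_C unfolding poincare_algebra_def by blast

lemma component_cocycle: "z \<in> cocycles A d \<Longrightarrow> component A k z \<in> cocycles A d"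
  using component_d[of z "k"] by (simp add: cocycles_iff)

lemma coh_class_carrier: "z \<in> cocycles A d \<Longrightarrow> coh_class A z \<in> carrier C"
  by (simp add: carrier_cohomology)

lemma coh_class_finsum:
  assumes "finite S" "\<And>i. i \<in> S \<Longrightarrow> f i \<in> cocycles A d"
  shows "coh_class A (finsum A f S) = (\<Oplus>\<^bsub>C\<^esub>i\<in>S. coh_class A (f i))"
  using assms
proof (induction S)
  case empty
  then show ?case by (simp add: zero_cohomology)
next
  case (insert i S)
  have f: "f j \<in> carrier A" if "j \<in> insert i S" for j using insert.prems[OF that] by (simp add: cocycles_iff)
  have "finsum A f (insert i S) = f i \<oplus> finsum A f S"
    by (rule M.finsum_insert) (use insert f in auto)
  moreover have "(\<Oplus>\<^bsub>C\<^esub>j\<in>insert i S. coh_class A (f j)) = coh_class A (f i) \<oplus>\<^bsub>C\<^esub> (\<Oplus>\<^bsub>C\<^esub>j\<in>S. coh_class A (f j))"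
    by (rule C.M.finsum_insert) (use insert coh_class_carrier in auto)
  moreover have "finsum A f S \<in> carrier A" by (rule M.finsum_closed) (use f in auto)
  ultimately show ?case
    using insert f[of i] add_cohomology[of "f i" "finsum A f S"] by (simp only: insertI1 insertI2)
qed

lemma component_coh_class:
  assumes z: "z \<in> cocycles A d"
  shows "component C k (coh_class A z) = coh_class A (component A k z)"
proof (rule C.component_eqI, rule C.decompositionI)
  have zA: "z \<in> carrier A" using z by (simp add: cocycles_iff)
  let ?S = "{k. component A k z \<noteq> \<zero>}"
  show "finite ?S" using zA by (rule finite_components)
  show "coh_class A (component A k z) \<in> grade C k" for k
    using component_cocycle[OF z] component_in_grade[OF zA] by (auto simp: grade_cohomology)
  show "coh_class A (component A k z) = \<zero>\<^bsub>C\<^esub>" if "k \<notin> ?S" for k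
    using that by (simp add: zero_cohomology)
  have "z = (\<Oplus>k\<in>?S. component A k z)"
    by (rule decompositionD[OF decomposition_component[OF zA] finite_components[OF zA]]) simp
  then have "coh_class A z = coh_class A (\<Oplus>k\<in>?S. component A k z)" by (rule arg_cong)
  also have "\<dots> = (\<Oplus>\<^bsub>C\<^esub>k\<in>?S. coh_class A (component A k z))"
    by (rule coh_class_finsum) (use finite_components[OF zA] component_cocycle[OF z] in auto)
  finally show "coh_class A z = (\<Oplus>\<^bsub>C\<^esub>k\<in>?S. coh_class A (component A k z))" .
qed

lemma component_mult:
  assumes x: "x \<in> grade A k" and y: "y \<in> carrier A"
  shows "component A l (x \<otimes> y) = x \<otimes> component A (l - k) y"
proof (rule graded_eqI[OF y, where f = "\<lambda>y. component A l (x \<otimes> y)"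
      and g = "\<lambda>y. x \<otimes> component A (l - k) y" and q = "(\<oplus>)"])
  fix j z assume z: "z \<in> grade A j"
  then show "component A l (x \<otimes> z) = x \<otimes> component A (l - k) z"
    using component_grade[OF mult_grade[OF x z]] component_grade[OF z] grade_carrier[OF x] by auto
qed (use grade_carrier[OF x] in \<open>simp_all add: r_distr component_add\<close>)

lemma top_cocycle: "z \<in> grade A (int n) \<Longrightarrow> z \<in> cocycles A d"
  using diff_grade[of z "int n"] grade_outside[of "int n + 1"] grade_carrier by (auto simp: cocycles_iff)

text \<open>The integral on the elements of top degree, which are all closed.\<close>

definition J where "J z = I (coh_class A z)"

lemma J_closed: "z \<in> grade A (int n) \<Longrightarrow> J z \<in> carrier F"
  using I_functional top_cocycle by (auto simp: J_def linear_functional_on_def grade_cohomology)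

lemma J_add: "\<lbrakk>y \<in> grade A (int n); z \<in> grade A (int n)\<rbrakk> \<Longrightarrow> J (y \<oplus> z) = J y \<oplus>\<^bsub>F\<^esub> J z"
  using I_functional top_cocycle[of y] top_cocycle[of z] grade_carrier
  by (auto simp: J_def linear_functional_on_def grade_cohomology simp flip: add_cohomology)

lemma J_smult: "\<lbrakk>c \<in> carrier F; z \<in> grade A (int n)\<rbrakk> \<Longrightarrow> J (c \<odot> z) = c \<otimes>\<^bsub>F\<^esub> J z"
  using I_functional top_cocycle[of z] grade_carrier
  by (auto simp: J_def linear_functional_on_def grade_cohomology simp flip: smult_cohomology)

lemma J_zero: "J \<zero> = \<zero>\<^bsub>F\<^esub>"
  using J_smult[of "\<zero>\<^bsub>F\<^esub>" \<zero>] J_closed grade_zero by simp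

lemma J_minus: "z \<in> grade A (int n) \<Longrightarrow> J z = \<zero>\<^bsub>F\<^esub> \<Longrightarrow> J (\<ominus> z) = \<zero>\<^bsub>F\<^esub>"
  using J_add[of "\<ominus> z" z] J_closed[of "\<ominus> z"] grade_minus[of z] grade_carrier[of z]
  by (simp add: M.l_neg J_zero)

lemma J_signed: "z \<in> grade A (int n) \<Longrightarrow> J z = \<zero>\<^bsub>F\<^esub> \<Longrightarrow> J (signed A e z) = \<zero>\<^bsub>F\<^esub>"
  by (simp add: signed_def J_minus)

lemma J_d: "a \<in> carrier A \<Longrightarrow> J (d a) = \<zero>\<^bsub>F\<^esub>"
  using J_zero by (simp add: J_def coh_class_d zero_cohomology)

lemma J_hodge:
  assumes "x \<in> H \<or> x \<in> B" "y \<in> B" "x \<in> grade A k" "y \<in> grade A l" "k + l = int n"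
  shows "J (x \<otimes> y) = \<zero>\<^bsub>F\<^esub>" "J (y \<otimes> x) = \<zero>\<^bsub>F\<^esub>"
proof -
  have "x \<in> H <+> B"
    using assms(1)
  proof
    assume "x \<in> H"
    then show ?thesis unfolding M.mem_set_add by (intro bexI[of _ x] bexI[of _ \<zero>]) auto
  next
    assume "x \<in> B"
    then show ?thesis unfolding M.mem_set_add by (intro bexI[of _ \<zero>] bexI[of _ x]) auto
  qed
  then have "dgca_pairing A n I x y = \<zero>\<^bsub>F\<^esub>"
    using hodge assms(2) unfolding hodge_decomposition_def by blast
  moreover have xy: "x \<otimes> y \<in> grade A (int n)" using mult_grade[OF assms(3,4)] assms(5) by simp
  ultimately show J: "J (x \<otimes> y) = \<zero>\<^bsub>F\<^esub>"
    by (simp add: dgca_pairing_def pairing_def J_def component_grade[OF xy])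
  show "J (y \<otimes> x) = \<zero>\<^bsub>F\<^esub>"
    using graded_comm[OF assms(4,3)] J_signed[OF xy J] by simp
qed

lemma d_one: "d \<one> = \<zero>"
proof -
  have "\<iota> \<one> = \<one>" using \<iota>_grade[OF one_grade] by (simp add: signed_def)
  then have "d \<one> = d \<one> \<oplus> d \<one>" using d_mult[of \<one> \<one>] by simp
  then show ?thesis by (simp add: M.add.r_cancel_one')
qed

lemma grade_0_H: "z \<in> grade A 0 \<Longrightarrow> d z = \<zero> \<Longrightarrow> z \<in> H"
proof -
  assume z: "z \<in> grade A 0" "d z = \<zero>"
  have "h z = \<zero>" using h_grade[OF z(1)] grade_outside[of "-1"] by simp
  then have "z = P z" using homotopy[OF grade_carrier[OF z(1)]] z grade_carrier[OF z(1)] by simp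
  then show "z \<in> H" using P_H[of z] by simp
qed

lemma one_H: "\<one> \<in> H"
  using grade_0_H[OF one_grade d_one] .

lemma H_grade_0:
  assumes "x \<in> H" "x \<in> grade A 0"
  obtains c where "c \<in> carrier F" "x = c \<odot> \<one>"
proof -
  interpret F: field F by (rule field)
  obtain f where f: "linear_functional_on F C (grade C 0) f" "bij_betw f (grade C 0) (carrier F)"
    using connected unfolding connected_upto_def by blast
  have mem: "coh_class A z \<in> grade C 0" if "z \<in> H" "z \<in> grade A 0" for z
    using that by (auto simp: grade_cohomology cocycles_iff)
  let ?one = "coh_class A \<one>"
  have one: "?one \<in> grade C 0" using mem one_H one_grade by blast
  have x: "coh_class A x \<in> grade C 0" using mem assms by blast
  have f_closed: "f y \<in> carrier F" if "y \<in> grade C 0" for y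
    using f(2) that by (auto simp: bij_betw_def)
  \<comment> \<open>Otherwise injectivity of \<open>f\<close> makes the class of the unit zero,
    hence every class zero, although \<open>f\<close> attains the unit of \<open>F\<close>.\<close>
  have "f ?one \<noteq> \<zero>\<^bsub>F\<^esub>"
  proof
    assume f0: "f ?one = \<zero>\<^bsub>F\<^esub>"
    have "\<one>\<^bsub>F\<^esub> \<in> f ` grade C 0" using f(2) by (auto simp: bij_betw_def)
    then obtain y where y: "y \<in> grade C 0" "f y = \<one>\<^bsub>F\<^esub>" by auto
    have fz: "f \<zero>\<^bsub>C\<^esub> = \<zero>\<^bsub>F\<^esub>"
    proof -
      have "f (\<zero>\<^bsub>F\<^esub> \<odot>\<^bsub>C\<^esub> ?one) = \<zero>\<^bsub>F\<^esub> \<otimes>\<^bsub>F\<^esub> f ?one"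
        using f(1) one unfolding linear_functional_on_def by blast
      then show ?thesis using C.grade_carrier[OF one] f0 by simp
    qed
    then have "?one = \<zero>\<^bsub>C\<^esub>"
      using f(2) one C.grade_zero[of 0] f0 by (auto simp: bij_betw_def inj_on_def)
    then have "y = \<zero>\<^bsub>C\<^esub>"
      using C.r_one[OF C.grade_carrier[OF y(1)]] C.grade_carrier[OF y(1)]
      by (simp add: one_cohomology)
    then show False using y fz by simp
  qed
  then have unit: "f ?one \<in> Units F" using f_closed[OF one] F.field_Units by simp
  define c where "c = f (coh_class A x) \<otimes>\<^bsub>F\<^esub> inv\<^bsub>F\<^esub> f ?one"
  have c: "c \<in> carrier F" using unit f_closed[OF x] by (simp add: c_def)
  have "f (c \<odot>\<^bsub>C\<^esub> ?one) = c \<otimes>\<^bsub>F\<^esub> f ?one"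
    using f(1) one c unfolding linear_functional_on_def by blast
  also have "\<dots> = f (coh_class A x)"
    using unit f_closed[OF x] f_closed[OF one] by (simp add: c_def R.m_assoc)
  finally have "c \<odot>\<^bsub>C\<^esub> ?one = coh_class A x"
    using f(2) x C.grade_smult[OF c one] by (auto simp: bij_betw_def inj_on_def)
  then have "coh_class A (c \<odot> \<one>) = coh_class A x" using smult_cohomology[OF c] by simp
  then have "c \<odot> \<one> = x"
    using bij_coh_class assms(1) H_smult[OF c one_H] by (auto simp: bij_betw_def inj_on_def)
  then show ?thesis using that c by blast
qed

section \<open>Connectedness and Poincare duality on the harmonic subspace\<close>

lemma H_eq_zero: "x \<in> H \<Longrightarrow> coh_class A x = \<zero>\<^bsub>C\<^esub> \<Longrightarrow> x = \<zero>"
  using coh_class_eq_zero[of x] by (simp add: cocycles_iff)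

lemma H_low:
  assumes "x \<in> H" "x \<in> grade A k" "k \<noteq> 0" "k < int r"
  shows "x = \<zero>"
proof (cases "k < 0")
  case True
  then show ?thesis using grade_outside[of k] assms by auto
next
  case False
  then have "grade C k = {\<zero>\<^bsub>C\<^esub>}"
    using connected assms r unfolding connected_upto_def by auto
  moreover have "coh_class A x \<in> grade C k"
    using assms by (auto simp: grade_cohomology cocycles_iff)
  ultimately show ?thesis using H_eq_zero assms(1) by simp
qed

text \<open>Since \<open>x\<close> is homogeneous, only the component of complementary degree of a
  test element reaches degree \<open>n\<close>, and every class has a harmonic
  representative.\<close>

lemma nondegenerate:
  assumes x: "x \<in> H" "x \<in> grade A k"
    and y: "\<And>y. y \<in> H \<Longrightarrow> y \<in> grade A (int n - k) \<Longrightarrow> J (x \<otimes> y) = \<zero>\<^bsub>F\<^esub>"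
  shows "x = \<zero>"
proof -
  have "pairing C n I (coh_class A x) Y = \<zero>\<^bsub>F\<^esub>" if Y: "Y \<in> carrier C" for Y
  proof -
    obtain y' where y': "y' \<in> H" "Y = coh_class A y'"
      using bij_betw_imp_surj_on[OF bij_coh_class] Y by blast
    have "x \<otimes> y' \<in> cocycles A d" using x y' by (simp add: cocycles_iff d_mult)
    then have "pairing C n I (coh_class A x) Y = J (component A (int n) (x \<otimes> y'))"
      using x y' by (simp add: pairing_def mult_cohomology cocycles_iff component_coh_class J_def)
    also have "\<dots> = J (x \<otimes> component A (int n - k) y')"
      using component_mult[OF x(2)] y' by simp
    also have "\<dots> = \<zero>\<^bsub>F\<^esub>"
      using y' by (intro y component_in_subspace[OF H_graded] component_in_grade) auto
    finally show ?thesis .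
  qed
  moreover have "coh_class A x \<in> carrier C" using x by (intro coh_class_carrier) (simp add: cocycles_iff)
  ultimately have "coh_class A x = \<zero>\<^bsub>C\<^esub>"
    using poincare_C unfolding poincare_algebra_def by blast
  then show ?thesis using H_eq_zero x by simp
qed

text \<open>Top degree is dual to degree 0, where \<open>H\<close> consists of the multiples of the
  unit.\<close>

lemma H_top: "x \<in> H \<Longrightarrow> x \<in> grade A (int n) \<Longrightarrow> J x = \<zero>\<^bsub>F\<^esub> \<Longrightarrow> x = \<zero>"
proof (rule nondegenerate)
  fix y assume x: "x \<in> H" "x \<in> grade A (int n)" "J x = \<zero>\<^bsub>F\<^esub>" and y: "y \<in> H" "y \<in> grade A (int n - int n)"
  obtain c where "c \<in> carrier F" "y = c \<odot> \<one>" using H_grade_0[of y] y by auto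
  then show "J (x \<otimes> y) = \<zero>\<^bsub>F\<^esub>" using x by (simp add: smult_mult_right J_smult)
qed

text \<open>Dual to \<open>H_low\<close>: the complementary degree \<open>int n - k\<close> is
  nonzero and below \<open>int r\<close>.\<close>

lemma H_high: "\<lbrakk>x \<in> H; x \<in> grade A k; int n - int r < k; k \<noteq> int n\<rbrakk> \<Longrightarrow> x = \<zero>"
proof (rule nondegenerate)
  fix y assume x: "x \<in> H" "x \<in> grade A k" "int n - int r < k" "k \<noteq> int n"
    and y: "y \<in> H" "y \<in> grade A (int n - k)"
  have "y = \<zero>" using H_low[OF y] x by auto
  then show "J (x \<otimes> y) = \<zero>\<^bsub>F\<^esub>" using x by (simp add: J_zero)
qed

text \<open>In this range \<open>H\<close> survives only in degree \<open>n\<close>, where an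
  element is determined by its integral. Elements of top degree are closed, so \<open>P\<close>
  preserves their class and with it the integral.\<close>

lemma P_high:
  assumes "x \<in> grade A k" "int n - int r < k" "k = int n \<Longrightarrow> J x = \<zero>\<^bsub>F\<^esub>"
  shows "P x = \<zero>"
proof (cases "k = int n")
  case True
  then have x: "x \<in> grade A (int n)" using assms(1) by simp
  have "J (P x) = J x" using coh_class_P[OF top_cocycle[OF x]] by (simp add: J_def)
  then show ?thesis using H_top[OF P_H P_grade[OF x]] assms(3) True by simp
next
  case False
  then show ?thesis using H_high[OF P_H P_grade[OF assms(1)] assms(2)] by blast
qed


text \<open>A summand of \<open>\<Lambda> w\<close> with the unit in a part of length at least two
  vanishes by induction. If one part is \<open>[\<one>]\<close>, the summand is, up to sign,
  \<open>\<tau>\<close> of the other part: \<open>h\<close> always kills it, and \<open>P\<close>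
  kills it unless that part is a single letter. Hence the restriction to three letters for
  \<open>\<beta>\<close>.\<close>

lemma \<tau>_one: "\<one> \<in> set w \<Longrightarrow> length w \<ge> 2 \<Longrightarrow> \<tau> w = \<zero> \<and> (length w \<ge> 3 \<longrightarrow> \<beta> w = \<zero>)"
proof (induction w rule: measure_induct_rule[where f = length])
  case (less w)
  let ?S = "{z \<in> carrier A. h z = \<zero> \<and> (length w \<ge> 3 \<longrightarrow> P z = \<zero>)}"
  have "\<Lambda> w \<in> ?S"
    unfolding \<Lambda>_def
  proof (rule M.splits_sum_mem)
    fix u v assume uv: "u @ v = w"
    show "\<sigma> (\<tau> u) \<otimes> \<tau> v \<in> ?S"
    proof (cases "u = [] \<or> v = []")
      case False
      then have len: "length u < length w" "length v < length w" using uv by auto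
      have P_single: "P \<one> = \<one>" using one_H by simp
      consider "\<one> \<in> set u" "length u \<ge> 2" | "u = [\<one>]" | "\<one> \<in> set v" "length v \<ge> 2" | "v = [\<one>]"
        using less.prems(1) uv False
        by (cases u rule: length_less_2_cases; cases v rule: length_less_2_cases) auto
      then show ?thesis
      proof cases
        case 1
        then show ?thesis using less.IH[OF len(1)] by simp
      next
        case 2
        have "\<sigma> \<one> = \<ominus> \<one>" using \<sigma>_grade[OF one_grade] by (simp add: signed_def)
        moreover have "length w \<ge> 3 \<longrightarrow> P (\<tau> v) = \<zero>" using uv 2 by (auto simp: p_\<tau>)
        ultimately show ?thesis by (simp add: 2 P_single l_minus h_minus P_minus)
      next
        case 3
        then show ?thesis using less.IH[OF len(2)] by simp
      next
        case 4
        moreover have "length w \<ge> 3 \<longrightarrow> P (\<tau> u) = \<zero>" using uv 4 by (auto simp: p_\<tau>)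
        ultimately show ?thesis by (simp add: P_single h_s p_s)
      qed
    qed auto
  qed (auto simp: h_add P_add)
  then show ?case using less.prems by (simp add: \<tau>_eq \<beta>_def)
qed

lemma \<tau>_mem: "w \<noteq> [] \<Longrightarrow> \<tau> w \<in> H \<or> \<tau> w \<in> B" and \<tau>_mem_B: "length w \<ge> 2 \<Longrightarrow> \<tau> w \<in> B"
proof -
  show *: "length w \<ge> 2 \<Longrightarrow> \<tau> w \<in> B" by (simp add: \<tau>_eq h_B)
  show "w \<noteq> [] \<Longrightarrow> \<tau> w \<in> H \<or> \<tau> w \<in> B"
    by (rule length_less_2_cases[of w]) (use * P_H in auto)
qed

text \<open>With at least three letters, one of the two factors comes from a part of length at least
  two and so lies in \<open>B\<close>; the other lies in \<open>H\<close> or in \<open>B\<close>,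
  and the two are orthogonal.\<close>

lemma J_\<Lambda>:
  assumes hom: "homogeneous A w ds" and len: "length w \<ge> 3" and n: "sum_list ds + 2 - int (length w) = int n"
  shows "J (\<Lambda> w) = \<zero>\<^bsub>F\<^esub>"
proof -
  let ?S = "{z \<in> grade A (int n). J z = \<zero>\<^bsub>F\<^esub>}"
  have "\<Lambda> w \<in> ?S"
    unfolding \<Lambda>_def
  proof (rule M.splits_sum_mem)
    fix u v assume uv: "u @ v = w"
    show "\<sigma> (\<tau> u) \<otimes> \<tau> v \<in> ?S"
    proof (cases "u = [] \<or> v = []")
      case True
      then show ?thesis by (auto simp: grade_zero J_zero)
    next
      case False
      obtain du dv where ds: "ds = du @ dv" "homogeneous A u du" "homogeneous A v dv"
        using hom uv homogeneous_append by blast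
      let ?k = "sum_list du + 1 - int (length u)" and ?l = "sum_list dv + 1 - int (length v)"
      have grade: "\<tau> u \<in> grade A ?k" "\<tau> v \<in> grade A ?l" using ds \<tau>_grade by auto
      have sum: "?k + ?l = int n" using n ds(1) uv by auto
      have "length u \<ge> 2 \<or> length v \<ge> 2" using len uv by auto
      then have "J (\<tau> u \<otimes> \<tau> v) = \<zero>\<^bsub>F\<^esub>"
      proof
        assume "length u \<ge> 2"
        then show ?thesis
          using J_hodge(2)[OF \<tau>_mem[of v] \<tau>_mem_B grade(2,1)] False sum by simp
      next
        assume "length v \<ge> 2"
        then show ?thesis
          using J_hodge(1)[OF \<tau>_mem[of u] \<tau>_mem_B grade] False sum by simp
      qed
      moreover have "\<tau> u \<otimes> \<tau> v \<in> grade A (int n)" using mult_grade[OF grade] sum by simp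
      moreover have "\<sigma> (\<tau> u) \<otimes> \<tau> v = signed A (?k + 1) (\<tau> u \<otimes> \<tau> v)"
        using \<sigma>_grade[OF grade(1)] by (simp add: signed_mult_left)
      ultimately show ?thesis by (simp add: signed_grade J_signed)
    qed
  qed (auto simp: grade_add J_add)
  then show ?thesis by simp
qed

lemma \<beta>_vanish_homogeneous:
  assumes hom: "homogeneous A w ds" and H: "set w \<subseteq> H" and len: "length w \<ge> 3"
    and n: "int n < int (length w) * (int r - 1) + 2 + int r"
  shows "\<beta> w = \<zero>"
\<comment> \<open>Zero is set apart because it lies in every graded piece, so that \<open>ds\<close>
  gives no bound for it. A letter of degree 0 is a multiple of the unit.\<close>
proof (cases "\<exists>x\<in>set w. x \<in> grade A 0 \<or> x = \<zero>")
  case True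
  then obtain x u v where x: "w = u @ x # v" "x \<in> grade A 0 \<or> x = \<zero>" by (auto simp: in_set_conv_decomp)
  show ?thesis
  proof (cases "x = \<zero>")
    case True
    then show ?thesis using x by (intro \<beta>_zero_letter) auto
  next
    case False
    then obtain c where c: "c \<in> carrier F" "x = c \<odot> \<one>" using x H H_grade_0[of x] by auto
    have "\<beta> (u @ \<one> # v) = \<zero>" using \<tau>_one[of "u @ \<one> # v"] len x by simp
    then show ?thesis using c letter_smult(2)[OF c(1) one_closed, of u v] x by simp
  qed
next
  case False
  have "int r \<le> ds ! i" if "i < length w" for i
  proof -
    have xi: "w ! i \<in> set w" "w ! i \<in> H" "w ! i \<in> grade A (ds ! i)"
      using hom H that by (auto simp: homogeneous_def dest: list_all2_nthD)
    then have "w ! i \<noteq> \<zero>" "ds ! i \<noteq> 0" using False by auto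
    then show ?thesis using H_low[of "w ! i" "ds ! i"] xi by force
  qed
  then have "\<forall>p\<in>set ds. int r \<le> p"
    using homogeneous_length[OF hom] by (auto simp: in_set_conv_nth)
  then have "int (length ds) * int r \<le> sum_list ds"
    by (induction ds) (auto simp: algebra_simps)
  then have "int (length w) * int r \<le> sum_list ds" using homogeneous_length[OF hom] by simp
  then have deg: "int n - int r < sum_list ds + 2 - int (length w)"
    using n by (simp add: algebra_simps)
  have "P (\<Lambda> w) = \<zero>"
    by (rule P_high[OF \<Lambda>_grade[OF hom] deg]) (use J_\<Lambda>[OF hom len] in auto)
  then show ?thesis by (simp add: \<beta>_def)
qed

text \<open>The degree argument needs homogeneous letters, but the vanishing is claimed on all of
  \<open>H\<close>. Letters are decomposed one at a time, \<open>u\<close> being the prefix already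
  made homogeneous.\<close>

lemma \<beta>_vanish:
  assumes H: "set w \<subseteq> H" and len: "length w \<ge> 3"
    and n: "int n < int (length w) * (int r - 1) + 2 + int r"
  shows "\<beta> w = \<zero>"
proof -
  have "\<beta> (u @ v) = \<zero>"
    if "homogeneous A u ds" "set u \<subseteq> H" "set v \<subseteq> H" "length u + length v = length w" for u v ds
    using that
  proof (induction v arbitrary: u ds)
    case Nil
    then show ?case using \<beta>_vanish_homogeneous[of u ds] len n by simp
  next
    case (Cons x v)
    show ?case
    proof (rule graded_induct[where P = "\<lambda>x. \<beta> (u @ x # v) = \<zero>"])
      show x: "x \<in> carrier A" using Cons.prems by simp
      fix k
      have "component A k x \<in> H" "component A k x \<in> grade A k"
        using component_in_subspace[OF H_graded] component_in_grade[OF x] Cons.prems by auto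
      then show "\<beta> (u @ component A k x # v) = \<zero>"
        using Cons.IH[of "u @ [component A k x]" "ds @ [k]"] Cons.prems
        by (auto simp: homogeneous_def intro: list_all2_appendI)
    next
      fix y z assume "y \<in> carrier A" "z \<in> carrier A" "\<beta> (u @ y # v) = \<zero>" "\<beta> (u @ z # v) = \<zero>"
      then show "\<beta> (u @ (y \<oplus> z) # v) = \<zero>"
        using letter_additive_\<beta> by (simp add: letter_additive_def)
    qed
  qed
  from this[of "[]" "[]" w] show ?thesis using H by (simp add: homogeneous_def)
qed

text \<open>The involution \<open>\<iota>\<close> commutes with \<open>P\<close>, hence preserves
  its image \<open>H\<close>.\<close>

lemma twist_H: "set w \<subseteq> H \<Longrightarrow> set (twist w) \<subseteq> H"
proof (induction w)
  case (Cons x w)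
  have "(\<iota> ^^ k) x \<in> H" for k
  proof (induction k)
    case (Suc k)
    then have "\<iota> ((\<iota> ^^ k) x) = P (\<iota> ((\<iota> ^^ k) x))" by (simp add: P_\<iota>)
    then show ?case using P_H[of "\<iota> ((\<iota> ^^ k) x)"] by simp
  qed (use Cons.prems in simp)
  then show ?case using Cons by simp
qed simp

lemma length_twist: "length (twist w) = length w"
  by (induction w) simp_all

lemma transfer_mult_vanish:
  assumes "set w \<subseteq> H" "length w = k" "k \<ge> 3" "int n < int k * (int r - 1) + 2 + int r"
  shows "transfer_mult k w = \<zero>"
  unfolding transfer_mult_def using assms by (intro \<beta>_vanish twist_H) (simp_all add: length_twist)

end

section \<open>Formality\<close>

text \<open>
  The DGCAs in a zig-zag have to live on a prescribed carrier type, so the subalgebra \<open>S\<close> is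
  transported along an injection \<open>e\<close> into that type.
\<close>

definition dga_copy :: "('a \<Rightarrow> 'b) \<Rightarrow> 'a set \<Rightarrow> ('f, 'a) dga \<Rightarrow> ('f, 'b) dga" where
  "dga_copy e S A =
     \<lparr>carrier = e ` S, mult = (\<lambda>x y. e (inv_into UNIV e x \<otimes>\<^bsub>A\<^esub> inv_into UNIV e y)), one = e \<one>\<^bsub>A\<^esub>,
      zero = e \<zero>\<^bsub>A\<^esub>, add = (\<lambda>x y. e (inv_into UNIV e x \<oplus>\<^bsub>A\<^esub> inv_into UNIV e y)),
      smult = (\<lambda>c x. e (c \<odot>\<^bsub>A\<^esub> inv_into UNIV e x)), grade = (\<lambda>k. e ` (grade A k \<inter> S)),
      diff = (\<lambda>x. e (diff A (inv_into UNIV e x)))\<rparr>"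

locale sub_dgca = dgca F A
  for F :: "('f, 'm) ring_scheme" and A :: "('f, 'a) dga" (structure) +
  fixes S :: "'a set" and e :: "'a \<Rightarrow> 'b"
  assumes inj: "inj e"
    and S_sub: "submodule S F A"
    and S_mult: "\<lbrakk>x \<in> S; y \<in> S\<rbrakk> \<Longrightarrow> x \<otimes> y \<in> S"
    and S_one: "\<one> \<in> S"
    and S_diff: "x \<in> S \<Longrightarrow> diff A x \<in> S"
    and S_component: "x \<in> S \<Longrightarrow> component A k x \<in> S"
begin

abbreviation X where "X \<equiv> dga_copy e S A"

lemma inv_e [simp]: "inv_into UNIV e (e x) = x"
  using inj by simp

lemma e_eq [simp]: "e x = e y \<longleftrightarrow> x = y"
  using inj by (simp add: inj_eq)

lemmas S_carrier [simp] = subsetD[OF submoduleE(1)[OF S_sub]]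
  and S_smult = submoduleE(4)[OF S_sub]
  and S_add = submoduleE(5)[OF S_sub]
  and S_minus = submoduleE(3)[OF S_sub]

lemma S_zero: "\<zero> \<in> S"
  using S_smult[OF R.zero_closed S_one] by simp

lemma X_simps:
  "carrier X = e ` S" "\<one>\<^bsub>X\<^esub> = e \<one>" "\<zero>\<^bsub>X\<^esub> = e \<zero>" "grade X k = e ` (grade A k \<inter> S)"
  "e x \<otimes>\<^bsub>X\<^esub> e y = e (x \<otimes> y)" "e x \<oplus>\<^bsub>X\<^esub> e y = e (x \<oplus> y)" "c \<odot>\<^bsub>X\<^esub> e x = e (c \<odot> x)"
  "diff X (e x) = e (diff A x)"
  by (simp_all add: dga_copy_def)

lemma X_abelian_group: "abelian_group X"
proof (rule abelian_groupI)
  fix x assume "x \<in> carrier X"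
  then obtain a where a: "a \<in> S" "x = e a" by (auto simp: X_simps)
  then show "\<exists>y\<in>carrier X. y \<oplus>\<^bsub>X\<^esub> x = \<zero>\<^bsub>X\<^esub>"
    by (intro bexI[of _ "e (\<ominus> a)"]) (auto simp: X_simps S_minus M.l_neg)
qed (auto simp: X_simps S_add S_zero M.a_ac)

lemma X_ring: "ring X"
proof (rule ringI)
  show "abelian_group X" by (rule X_abelian_group)
  show "monoid X" by (rule monoidI) (auto simp: X_simps S_mult S_one m_assoc)
qed (auto simp: X_simps l_distr r_distr)

lemma X_module: "module F X"
  by (rule moduleI)
    (auto intro: R.is_cring X_abelian_group simp: X_simps S_smult smult_l_distr smult_r_distr smult_assoc1)

lemma X_minus: "x \<in> S \<Longrightarrow> \<ominus>\<^bsub>X\<^esub> e x = e (\<ominus> x)"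
  by (rule abelian_group.minus_equality[OF X_abelian_group]) (auto simp: X_simps S_minus M.l_neg)

lemma X_signed: "x \<in> S \<Longrightarrow> signed X k (e x) = e (signed A k x)"
  by (simp add: signed_def X_minus)

lemma X_finsum:
  assumes "finite K" "\<And>k. k \<in> K \<Longrightarrow> c k \<in> S"
  shows "(\<Oplus>\<^bsub>X\<^esub>k\<in>K. e (c k)) = e (\<Oplus>k\<in>K. c k)"
  using assms
proof (induction K)
  case empty
  interpret X: abelian_group X by (rule X_abelian_group)
  show ?case by (simp add: X_simps)
next
  case (insert k K)
  interpret X: abelian_group X by (rule X_abelian_group)
  have "(\<Oplus>\<^bsub>X\<^esub>k\<in>insert k K. e (c k)) = e (c k) \<oplus>\<^bsub>X\<^esub> (\<Oplus>\<^bsub>X\<^esub>k\<in>K. e (c k))"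
    by (rule X.finsum_insert) (use insert in \<open>auto simp: X_simps\<close>)
  moreover have "(\<Oplus>k\<in>insert k K. c k) = c k \<oplus> (\<Oplus>k\<in>K. c k)"
    by (rule M.finsum_insert) (use insert in auto)
  ultimately show ?case using insert by (simp add: X_simps)
qed

lemma X_decomposition:
  assumes "\<And>k. c k \<in> S"
  shows "decomposition X (e x) (\<lambda>k. e (c k)) \<longleftrightarrow> decomposition A x c"
proof -
  have "(\<forall>k. e (c k) \<in> grade X k) \<longleftrightarrow> (\<forall>k. c k \<in> grade A k)"
    using assms by (simp add: X_simps inj_image_mem_iff[OF inj])
  moreover have "{k. e (c k) \<noteq> \<zero>\<^bsub>X\<^esub>} = {k. c k \<noteq> \<zero>}" by (simp add: X_simps)
  moreover have "e x = (\<Oplus>\<^bsub>X\<^esub>k\<in>{k. c k \<noteq> \<zero>}. e (c k)) \<longleftrightarrow> x = (\<Oplus>k\<in>{k. c k \<noteq> \<zero>}. c k)"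
    if "finite {k. c k \<noteq> \<zero>}"
    using X_finsum[OF that, of c] assms by simp
  ultimately show ?thesis unfolding decomposition_def by auto
qed

lemma X_graded_module: "graded_module F X"
proof (intro graded_module.intro graded_module_axioms.intro)
  show "module F X" by (rule X_module)
  show "submodule (grade X k) F X" for k
    by (rule module.submoduleI[OF X_module])
      (auto simp: X_simps X_minus S_zero S_add S_smult S_minus grade_zero grade_add grade_smult grade_minus)
  fix x assume "x \<in> carrier X"
  then obtain a where a: "a \<in> S" "x = e a" by (auto simp: X_simps)
  show "\<exists>!c. decomposition X x c"
  proof (rule ex1I)
    show "decomposition X x (\<lambda>k. e (component A k a))"
      using a X_decomposition[of "\<lambda>k. component A k a" a] decomposition_component[of a]
      by (simp add: S_component)
    fix c assume c: "decomposition X x c"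
    have "\<forall>k. c k \<in> e ` S" using c unfolding decomposition_def by (auto simp: X_simps)
    then have "\<forall>k. \<exists>b. b \<in> S \<and> c k = e b" by auto
    then obtain b where "\<forall>k. b k \<in> S \<and> c k = e (b k)" by metis
    then have b: "\<And>k. b k \<in> S" and cb: "c = (\<lambda>k. e (b k))" by auto
    then have "decomposition A a b" using c a X_decomposition[of b a] by simp
    then show "c = (\<lambda>k. e (component A k a))" using component_eqI cb by auto
  qed
qed

lemma X_dgca: "dgca F X"
proof (intro dgca.intro dgca_axioms.intro graded_comm_algebra.intro graded_comm_algebra_axioms.intro)
  show "graded_module F X" by (rule X_graded_module)
  show "ring X" by (rule X_ring)
  show "linear_map F X X (diff X)"
    using linear_mapD[OF diff_linear] by (auto simp: linear_map_def X_simps S_diff)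
  show "x \<otimes>\<^bsub>X\<^esub> y \<in> grade X (k + l)" if "x \<in> grade X k" "y \<in> grade X l" for x y k l
    using that mult_grade S_mult by (auto simp: X_simps)
  show "x \<otimes>\<^bsub>X\<^esub> y = signed X (k * l) (y \<otimes>\<^bsub>X\<^esub> x)" if xy: "x \<in> grade X k" "y \<in> grade X l" for x y k l
  proof -
    obtain a b where ab: "a \<in> grade A k" "a \<in> S" "x = e a" "b \<in> grade A l" "b \<in> S" "y = e b"
      using xy by (auto simp: X_simps)
    then show ?thesis using graded_comm[of a k b l] by (simp add: X_simps X_signed S_mult)
  qed
  show "diff X (x \<otimes>\<^bsub>X\<^esub> y) = diff X x \<otimes>\<^bsub>X\<^esub> y \<oplus>\<^bsub>X\<^esub> signed X k (x \<otimes>\<^bsub>X\<^esub> diff X y)"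
    if xy: "x \<in> grade X k" "y \<in> carrier X" for x y k
  proof -
    obtain a b where ab: "a \<in> grade A k" "a \<in> S" "x = e a" "b \<in> S" "y = e b"
      using xy by (auto simp: X_simps)
    then show ?thesis using Leibniz[of a k b] by (simp add: X_simps X_signed S_mult S_diff)
  qed
qed (use nonneg_graded in \<open>auto simp: X_simps S_zero S_one one_grade smult_mult_left smult_mult_right
      diff_grade S_diff diff_diff\<close>)

lemma X_hom: "dgca_hom F X A (inv_into UNIV e)"
  unfolding dgca_hom_def alg_hom_def ring_hom_def linear_map_def
  using X_dgca dgca_axioms by (auto simp: X_simps)

end

section \<open>Maps induced on cohomology\<close>

lemma coh_map_class:
  assumes hom: "dgca_hom F X Y f" and z: "z \<in> carrier X"
  shows "coh_map Y (diff Y) f (coh_class X z) = coh_class Y (f z)"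
proof -
  interpret X: dgca F X using hom by (simp add: dgca_hom_def)
  interpret Y: dgca F Y using hom by (simp add: dgca_hom_def)
  have lin: "linear_map F X Y f" using hom by (simp add: dgca_hom_def alg_hom_def)
  have "coh_class Y (f y) = coh_class Y (f z)" if y: "y \<in> coh_class X z" for y
  proof -
    obtain a where a: "a \<in> carrier X" "y = diff X a \<oplus>\<^bsub>X\<^esub> z" using y unfolding X.coh_class_mem by blast
    then have "f y = diff Y (f a) \<oplus>\<^bsub>Y\<^esub> f z"
      using hom z linear_mapD[OF lin] linear_mapD(1)[OF X.diff_linear] by (simp add: dgca_hom_def)
    then show ?thesis using a z linear_mapD(1)[OF lin] by (simp add: Y.coh_class_shift)
  qed
  moreover have "coh_class X z \<noteq> {}"
    using X.coh_class_mem[of "diff X \<zero>\<^bsub>X\<^esub> \<oplus>\<^bsub>X\<^esub> z" z] X.M.zero_closed by blast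
  ultimately show ?thesis
    unfolding coh_map_def coh_class_def[symmetric] by (simp cong: SUP_cong)
qed

text \<open>The induced map is additive, so injectivity can be tested at zero.\<close>

lemma quasi_isoI:
  assumes hom: "dgca_hom F X Y f"
    and surj: "\<And>y. y \<in> cocycles Y (diff Y) \<Longrightarrow> \<exists>z\<in>cocycles X (diff X). coh_class Y (f z) = coh_class Y y"
    and inj: "\<And>z. \<lbrakk>z \<in> cocycles X (diff X); coh_class Y (f z) = coh_class Y \<zero>\<^bsub>Y\<^esub>\<rbrakk>
      \<Longrightarrow> coh_class X z = coh_class X \<zero>\<^bsub>X\<^esub>"
  shows "quasi_iso F X Y f"
proof -
  interpret X: dgca F X using hom by (simp add: dgca_hom_def)
  interpret Y: dgca F Y using hom by (simp add: dgca_hom_def)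
  have lin: "linear_map F X Y f" using hom by (simp add: dgca_hom_def alg_hom_def)
  note f = linear_mapD[OF lin] and dX = linear_mapD[OF X.diff_linear] and dY = linear_mapD[OF Y.diff_linear]
  have cocycle: "f z \<in> cocycles Y (diff Y)" if "z \<in> cocycles X (diff X)" for z
  proof -
    have "f \<zero>\<^bsub>X\<^esub> = \<zero>\<^bsub>Y\<^esub>"
      using f(3)[of "\<zero>\<^bsub>F\<^esub>" "\<zero>\<^bsub>X\<^esub>"] f(1)[of "\<zero>\<^bsub>X\<^esub>"] by simp
    then show ?thesis using that hom f(1) by (auto simp: cocycles_def dgca_hom_def)
  qed
  have "inj_on (coh_map Y (diff Y) f) (carrier (cohomology X))"
  proof (rule inj_onI)
    fix P Q assume PQ: "P \<in> carrier (cohomology X)" "Q \<in> carrier (cohomology X)"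
      and eq: "coh_map Y (diff Y) f P = coh_map Y (diff Y) f Q"
    obtain p q where p: "p \<in> cocycles X (diff X)" "P = coh_class X p"
      and q: "q \<in> cocycles X (diff X)" "Q = coh_class X q"
      using PQ by (auto simp: X.carrier_cohomology)
    have pq: "p \<in> carrier X" "q \<in> carrier X" using p q by (auto simp: cocycles_def)
    have eq': "coh_class Y (f p) = coh_class Y (f q)"
      using eq p q pq by (simp add: coh_map_class[OF hom])
    obtain a where a: "a \<in> carrier Y" "f p = diff Y a \<oplus>\<^bsub>Y\<^esub> f q"
      using Y.coh_class_eqD[OF eq'] f(1) pq by blast
    \<comment> \<open>The difference of \<open>p\<close> and \<open>q\<close> is written with the
      scalar -1, so that linearity of \<open>f\<close> and of the differentials applies to it
      directly.\<close>
    let ?m = "(\<ominus>\<^bsub>F\<^esub> \<one>\<^bsub>F\<^esub>)"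
    have m: "?m \<in> carrier F" by simp
    let ?z = "p \<oplus>\<^bsub>X\<^esub> ?m \<odot>\<^bsub>X\<^esub> q"
    have mX: "?m \<odot>\<^bsub>X\<^esub> x = \<ominus>\<^bsub>X\<^esub> x" if "x \<in> carrier X" for x using that by (simp add: X.smult_l_minus)
    have mY: "?m \<odot>\<^bsub>Y\<^esub> x = \<ominus>\<^bsub>Y\<^esub> x" if "x \<in> carrier Y" for x using that by (simp add: Y.smult_l_minus)
    have "?z \<in> cocycles X (diff X)"
      using p q m by (auto simp: cocycles_def dX simp del: X.R.add.inv_closed)
    moreover have "f ?z = diff Y a \<oplus>\<^bsub>Y\<^esub> \<zero>\<^bsub>Y\<^esub>"
      using a pq m f(1)[of q] dY(1)[of a] by (simp add: f mY Y.M.a_assoc Y.M.r_neg)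
    then have "coh_class Y (f ?z) = coh_class Y \<zero>\<^bsub>Y\<^esub>" using a Y.coh_class_shift[of a "\<zero>\<^bsub>Y\<^esub>"] by simp
    ultimately have z0: "coh_class X ?z = coh_class X \<zero>\<^bsub>X\<^esub>" by (rule inj)
    obtain b where b: "b \<in> carrier X" "?z = diff X b \<oplus>\<^bsub>X\<^esub> \<zero>\<^bsub>X\<^esub>"
      using X.coh_class_eqD[OF z0] pq m by blast
    have "p = ?z \<oplus>\<^bsub>X\<^esub> q" using pq by (simp add: mX X.M.a_assoc X.M.l_neg)
    also have "\<dots> = diff X b \<oplus>\<^bsub>X\<^esub> q" using b dX(1)[of b] by simp
    finally show "P = Q" using p q pq b X.coh_class_shift by simp
  qed
  moreover have "coh_map Y (diff Y) f ` carrier (cohomology X) = carrier (cohomology Y)"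
  proof
    show "coh_map Y (diff Y) f ` carrier (cohomology X) \<subseteq> carrier (cohomology Y)"
    proof
      fix Q assume "Q \<in> coh_map Y (diff Y) f ` carrier (cohomology X)"
      then obtain z where z: "z \<in> cocycles X (diff X)" "Q = coh_map Y (diff Y) f (coh_class X z)"
        by (auto simp: X.carrier_cohomology)
      then have "Q = coh_class Y (f z)" using coh_map_class[OF hom] by (simp add: cocycles_def)
      then show "Q \<in> carrier (cohomology Y)" using cocycle[OF z(1)] by (simp add: Y.carrier_cohomology)
    qed
    show "carrier (cohomology Y) \<subseteq> coh_map Y (diff Y) f ` carrier (cohomology X)"
    proof
      fix Q assume "Q \<in> carrier (cohomology Y)"
      then obtain y where y: "y \<in> cocycles Y (diff Y)" "Q = coh_class Y y" by (auto simp: Y.carrier_cohomology)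
      obtain z where z: "z \<in> cocycles X (diff X)" "coh_class Y (f z) = coh_class Y y" using surj[OF y(1)] by blast
      then have "Q = coh_map Y (diff Y) f (coh_class X z)"
        using coh_map_class[OF hom] y by (simp add: cocycles_def)
      then show "Q \<in> coh_map Y (diff Y) f ` carrier (cohomology X)"
        using z by (simp add: X.carrier_cohomology)
    qed
  qed
  ultimately show ?thesis using hom by (simp add: quasi_iso_def bij_betw_def)
qed

text \<open>Fits the elements of \<open>A\<close> into the carrier type that
  \<open>equivalent\<close> prescribes for the intermediate DGCAs.\<close>

lemma inj_into_sum: "inj (\<lambda>x. {Inr (Inl x)})"
  by (simp add: inj_on_def)

section \<open>A subalgebra on which the harmonic projection is multiplicative\<close>

locale formal_range = connected_hodge_dgca F A n I H B r
  for F :: "('f, 'm) ring_scheme" and A :: "('f, 'a) dga" (structure) and n I H B r +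
  assumes n: "n \<le> 4 * r - 2"
begin

text \<open>\<open>S\<close> is \<open>H\<close> in degrees below \<open>2 r - 1\<close>, \<open>H \<oplus> B\<close> in degree \<open>2 r - 1\<close> and everything above.\<close>

definition S where
  "S = {x \<in> carrier A. (\<forall>k\<le>2 * int r - 1. h (component A k x) = \<zero>) \<and>
    (\<forall>k\<le>2 * int r - 2. d (component A k x) = \<zero>)}"

lemma S_carrier: "x \<in> S \<Longrightarrow> x \<in> carrier A"
  by (simp add: S_def)

lemma S_add: "\<lbrakk>x \<in> S; y \<in> S\<rbrakk> \<Longrightarrow> x \<oplus> y \<in> S"
  by (simp add: S_def component_add h_add d_add)

lemma S_smult: "\<lbrakk>c \<in> carrier F; x \<in> S\<rbrakk> \<Longrightarrow> c \<odot> x \<in> S"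
  by (simp add: S_def component_smult h_smult d_smult)

lemma H_S: "x \<in> H \<Longrightarrow> x \<in> S"
  using component_in_subspace[OF H_graded] by (simp add: S_def)

lemma S_grade: "x \<in> grade A k \<Longrightarrow> x \<in> S \<longleftrightarrow>
    (k \<le> 2 * int r - 1 \<longrightarrow> h x = \<zero>) \<and> (k \<le> 2 * int r - 2 \<longrightarrow> d x = \<zero>)"
  by (auto simp: S_def component_grade grade_carrier)

lemma S_component: "x \<in> S \<Longrightarrow> component A k x \<in> S"
  using S_grade[OF component_in_grade, of x k] by (simp add: S_def)

text \<open>Here the offset between the two cutoffs in \<open>S\<close> is used: \<open>h\<close>
  kills \<open>S\<close> up to degree \<open>2 * r - 1\<close>, so \<open>d (h x)\<close> has no
  terms from \<open>h x\<close> in degrees up to \<open>2 * r - 2\<close>. Closure under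
  \<open>h\<close> provides primitives inside \<open>S\<close>.\<close>

lemma S_h: "x \<in> S \<Longrightarrow> h x \<in> S"
  by (simp add: S_def component_h h_h)

lemma S_d: "x \<in> S \<Longrightarrow> d x \<in> S"
proof -
  assume x: "x \<in> S"
  have "component A k (d x) = d (component A (k - 1) x)" for k
    using component_d[OF S_carrier[OF x], of "k - 1"] by simp
  then show ?thesis using x by (simp add: S_def diff_diff)
qed

declare S_carrier [simp]

lemma S_minus: "x \<in> S \<Longrightarrow> \<ominus> x \<in> S"
  using S_smult[of "\<ominus>\<^bsub>F\<^esub> \<one>\<^bsub>F\<^esub>" x] by (simp add: smult_l_minus)

lemma S_submodule: "submodule S F A"
  using S_add S_smult S_minus H_S[OF H_zero] by (intro submoduleI) auto

lemma H_of_closed: "\<lbrakk>x \<in> carrier A; h x = \<zero>; d x = \<zero>\<rbrakk> \<Longrightarrow> x \<in> H"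
  using homotopy[of x, symmetric] P_H[of x] by simp

text \<open>In degrees below \<open>r\<close> the subalgebra is part of \<open>H\<close>, which has
  only multiples of the unit there.\<close>

lemma S_cases:
  assumes "x \<in> S" "x \<in> grade A k"
  obtains "x = \<zero>" | c where "k = 0" "c \<in> carrier F" "x = c \<odot> \<one>" | "int r \<le> k"
proof (cases "k < int r")
  case True
  then have "x \<in> H" using assms S_grade[OF assms(2)] r by (intro H_of_closed) auto
  then show ?thesis using that H_grade_0[of x] H_low[of x k] assms True by metis
qed (use that in auto)

text \<open>Two factors of degree at least \<open>r\<close> have a product of degree at least
  \<open>2 * r\<close>, where \<open>S\<close> imposes no condition; the cutoff is chosen for
  this.\<close>

lemma S_mult_homogeneous:
  assumes x: "x \<in> S" "x \<in> grade A k" and y: "y \<in> S" "y \<in> grade A l"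
  shows "x \<otimes> y \<in> S"
proof (rule S_cases[OF x])
  assume "int r \<le> k"
  then show ?thesis
  proof (rule_tac S_cases[OF y])
    assume "int r \<le> l"
    then show ?thesis using \<open>int r \<le> k\<close> S_grade[OF mult_grade[OF x(2) y(2)]] by simp
  qed (use x in \<open>simp_all add: smult_mult_right S_smult H_S[OF H_zero]\<close>)
qed (use y in \<open>simp_all add: smult_mult_left S_smult H_S[OF H_zero]\<close>)

lemma S_mult:
  assumes "x \<in> S" "y \<in> S"
  shows "x \<otimes> y \<in> S"
proof (rule graded_induct[where P = "\<lambda>x. x \<otimes> y \<in> S"])
  show xA: "x \<in> carrier A" using assms by simp
  fix k
  show "component A k x \<otimes> y \<in> S"
  proof (rule graded_induct[where P = "\<lambda>y. component A k x \<otimes> y \<in> S"])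
    show yA: "y \<in> carrier A" using assms by simp
    show "component A k x \<otimes> component A l y \<in> S" for l
      using S_mult_homogeneous[OF S_component component_in_grade S_component component_in_grade] assms xA yA
      by blast
  qed (use xA in \<open>simp_all add: r_distr S_add\<close>)
qed (use assms in \<open>simp_all add: l_distr S_add\<close>)

text \<open>
  If \<open>P x = \<zero>\<close> and \<open>x \<noteq> \<zero>\<close>, then \<open>x\<close> has degree at least \<open>2 r - 1\<close>, so only the top degree \<open>n\<close> matters; for
  \<open>n \<le> 4 r - 2\<close> the factor \<open>y\<close> then lies in \<open>H\<close>, or \<open>x\<close> lies in \<open>B\<close> and \<open>y\<close> in \<open>H \<oplus> B\<close>.
\<close>

lemma P_mult_homogeneous:
  assumes x: "x \<in> S" "x \<in> grade A k" "P x = \<zero>" and y: "y \<in> S" "y \<in> grade A l"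
  shows "P (x \<otimes> y) = \<zero>"
proof (cases "k \<le> 2 * int r - 2")
  case True
  then have "x \<in> H" using S_grade[OF x(2)] x by (intro H_of_closed) auto
  then show ?thesis using x y by simp
next
  case k: False
  show ?thesis
  proof (rule S_cases[OF y])
    assume l: "int r \<le> l"
    have xA: "x \<in> carrier A" and yA: "y \<in> carrier A" using x y by auto
    show ?thesis
    proof (rule P_high[OF mult_grade[OF x(2) y(2)]])
      \<comment> \<open>The sum \<open>k + l\<close> is at least \<open>3 * r - 1\<close>, which
        exceeds \<open>n - r\<close> precisely when \<open>n \<le> 4 * r - 2\<close>.\<close>
      show "int n - int r < k + l" using k l n r by linarith
      assume kl: "k + l = int n"
      note xd = h_grade[OF diff_grade[OF x(2)], simplified] and yd = h_grade[OF diff_grade[OF y(2)], simplified]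
      have xy: "x \<otimes> y \<in> grade A (int n)" using mult_grade[OF x(2) y(2)] kl by simp
      show "J (x \<otimes> y) = \<zero>\<^bsub>F\<^esub>"
      proof (cases "k = 2 * int r - 1")
        case True
        then have "h x = \<zero>" using S_grade[OF x(2)] x by simp
        then have "h (d x) = x" using homotopy[OF xA, symmetric] x xA by simp
        then have xB: "x \<in> B" using h_B[of "d x"] xA by simp
        \<comment> \<open>For \<open>n = 4 * r - 2\<close> both factors can have degree
          \<open>2 * r - 1\<close>. This case works because \<open>B\<close> is orthogonal to itself
          and \<open>S\<close> contains no exact part in that degree.\<close>
        have "l \<le> 2 * int r - 1" using kl True n r by linarith
        then have "h y = \<zero>" using S_grade[OF y(2)] y by simp
        then have y_eq: "h (d y) \<oplus> P y = y" using homotopy[OF yA, symmetric] yA by simp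
        have terms: "x \<otimes> h (d y) \<in> grade A (int n)" "x \<otimes> P y \<in> grade A (int n)"
          using mult_grade[OF x(2) yd] mult_grade[OF x(2) P_grade[OF y(2)]] kl by simp_all
        have "J (x \<otimes> h (d y)) = \<zero>\<^bsub>F\<^esub>"
          by (rule J_hodge(2)[OF _ xB yd x(2)]) (use h_B yA kl in auto)
        moreover have "J (x \<otimes> P y) = \<zero>\<^bsub>F\<^esub>"
          by (rule J_hodge(2)[OF _ xB P_grade[OF y(2)] x(2)]) (use P_H kl in auto)
        moreover have "x \<otimes> y = x \<otimes> h (d y) \<oplus> x \<otimes> P y"
          using xA yA r_distr[of "h (d y)" "P y" x] by (simp add: y_eq)
        ultimately show ?thesis using J_add[OF terms] by simp
      next
        case False
        then have "l \<le> 2 * int r - 2" using k kl n r by linarith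
        then have yH: "y \<in> H" using S_grade[OF y(2)] y by (intro H_of_closed) auto
        have x_eq: "d (h x) \<oplus> h (d x) = x" using homotopy[OF xA, symmetric] x xA by simp
        have exact: "d (h x) \<otimes> y = d (h x \<otimes> y)" using xA yA yH by (simp add: d_mult)
        have dh: "d (h x) \<in> grade A k" using diff_grade[OF h_grade[OF x(2)]] by simp
        have terms: "d (h x) \<otimes> y \<in> grade A (int n)" "h (d x) \<otimes> y \<in> grade A (int n)"
          using mult_grade[OF dh y(2)] mult_grade[OF xd y(2)] kl by simp_all
        have "J (d (h x) \<otimes> y) = \<zero>\<^bsub>F\<^esub>" unfolding exact using xA yA by (simp add: J_d)
        moreover have "J (h (d x) \<otimes> y) = \<zero>\<^bsub>F\<^esub>"
          by (rule J_hodge(2)[OF _ _ y(2) xd]) (use yH h_B xA kl in auto)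
        moreover have "x \<otimes> y = d (h x) \<otimes> y \<oplus> h (d x) \<otimes> y"
          using xA yA l_distr[of "d (h x)" "h (d x)" y] by (simp add: x_eq)
        ultimately show ?thesis using J_add[OF terms] by simp
      qed
    qed
  qed (use x in \<open>simp_all add: smult_mult_right P_smult\<close>)
qed

lemma P_mult_zero:
  assumes x: "x \<in> S" "P x = \<zero>" and y: "y \<in> S"
  shows "P (x \<otimes> y) = \<zero>" and "P (y \<otimes> x) = \<zero>"
proof -
  have xA: "x \<in> carrier A" and yA: "y \<in> carrier A" using x y by auto
  note cx = S_component[OF x(1)] component_in_grade[OF xA] and cy = S_component[OF y] component_in_grade[OF yA]
  have Px: "P (component A k x) = \<zero>" for k using component_P[OF xA, of k] by (simp add: x(2))
  have hom: "P (component A k x \<otimes> component A l y) = \<zero>" for k l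
    by (rule P_mult_homogeneous[OF cx Px cy])
  have hom': "P (component A l y \<otimes> component A k x) = \<zero>" for k l
    using hom[of k l] graded_comm[OF cy(2) cx(2), of l k] xA yA by (simp add: signed_def P_minus)
  show "P (x \<otimes> y) = \<zero>"
  proof (rule graded_induct[OF xA, where P = "\<lambda>x. P (x \<otimes> y) = \<zero>"])
    fix k show "P (component A k x \<otimes> y) = \<zero>"
      by (rule graded_induct[OF yA, where P = "\<lambda>y. P (component A k x \<otimes> y) = \<zero>"])
        (use hom xA in \<open>simp_all add: r_distr P_add\<close>)
  qed (use yA in \<open>simp_all add: l_distr P_add\<close>)
  show "P (y \<otimes> x) = \<zero>"
  proof (rule graded_induct[OF xA, where P = "\<lambda>x. P (y \<otimes> x) = \<zero>"])
    fix k show "P (y \<otimes> component A k x) = \<zero>"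
      by (rule graded_induct[OF yA, where P = "\<lambda>y. P (y \<otimes> component A k x) = \<zero>"])
        (use hom' xA in \<open>simp_all add: l_distr P_add\<close>)
  qed (use yA in \<open>simp_all add: r_distr P_add\<close>)
qed

text \<open>By \<open>P_mult_zero\<close> the kernel of \<open>P\<close> is an ideal of
  \<open>S\<close>, and \<open>x\<close> differs from \<open>P x\<close> by an element of it, since
  \<open>S\<close> contains \<open>H\<close>.\<close>

lemma P_mult:
  assumes x: "x \<in> S" and y: "y \<in> S"
  shows "P (x \<otimes> y) = P (P x \<otimes> P y)"
proof -
  have split: "P z \<oplus> (z \<oplus> \<ominus> P z) = z" "z \<oplus> \<ominus> P z \<in> S" "P (z \<oplus> \<ominus> P z) = \<zero>" if z: "z \<in> S" for z
  proof -
    have "P z \<oplus> (z \<oplus> \<ominus> P z) = z \<oplus> (P z \<oplus> \<ominus> P z)" using z by (simp add: M.a_ac del: M.r_neg)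
    then show "P z \<oplus> (z \<oplus> \<ominus> P z) = z" using z by (simp add: M.r_neg)
    show "z \<oplus> \<ominus> P z \<in> S" using z by (simp add: S_add S_minus H_S P_H)
    show "P (z \<oplus> \<ominus> P z) = \<zero>" using z by (simp add: P_add P_minus P_H M.r_neg)
  qed
  let ?x = "x \<oplus> \<ominus> P x" and ?y = "y \<oplus> \<ominus> P y"
  have xA: "x \<in> carrier A" and yA: "y \<in> carrier A" using x y by auto
  have "x \<otimes> y = P x \<otimes> y \<oplus> ?x \<otimes> y"
    using l_distr[of "P x" ?x y] xA yA by (simp add: split(1)[OF x])
  then have "P (x \<otimes> y) = P (P x \<otimes> y)"
    using P_mult_zero(1)[OF split(2,3)[OF x] y] xA yA by (simp add: P_add)
  moreover have "P x \<otimes> y = P x \<otimes> P y \<oplus> P x \<otimes> ?y"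
    using r_distr[of "P y" ?y "P x"] xA yA by (simp add: split(1)[OF y])
  then have "P (P x \<otimes> y) = P (P x \<otimes> P y)"
    using P_mult_zero(2)[OF split(2,3)[OF y] H_S[OF P_H[of x]]] xA yA by (simp add: P_add)
  ultimately show ?thesis by simp
qed

lemma dgca_C: "dgca F C"
proof (intro dgca.intro dgca_axioms.intro)
  show "graded_comm_algebra F C" by (rule C.graded_comm_algebra_axioms)
  show "grade C k = {\<zero>\<^bsub>C\<^esub>}" if "k < 0" for k
    using poincare_C that by (simp add: poincare_algebra_def)
  show "linear_map F C C (diff C)"
    unfolding diff_cohomology by (rule linear_mapI) simp_all
  show "diff C (x \<otimes>\<^bsub>C\<^esub> y) = diff C x \<otimes>\<^bsub>C\<^esub> y \<oplus>\<^bsub>C\<^esub> signed C k (x \<otimes>\<^bsub>C\<^esub> diff C y)"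
    if "x \<in> grade C k" "y \<in> carrier C" for x y k
    using that C.grade_carrier[OF that(1)] by (simp add: diff_cohomology)
qed (simp_all add: diff_cohomology C.grade_zero)

lemma formal: "formal F A"
proof -
  obtain e :: "'a \<Rightarrow> ('f + 'a + 'a set) set" where e: "inj e"
    using inj_into_sum by blast
  interpret S: sub_dgca F A S e
    by (intro sub_dgca.intro sub_dgca_axioms.intro dgca_axioms e S_submodule S_mult S_d S_component
        H_S[OF one_H])
  interpret X: dgca F S.X by (rule S.X_dgca)
  have cocycle: "\<exists>x\<in>S. z = e x \<and> d x = \<zero>" if "z \<in> cocycles S.X (diff S.X)" for z
    using that by (auto simp: cocycles_def S.X_simps)
  have cocycleI: "e x \<in> cocycles S.X (diff S.X)" if "x \<in> H" for x
    using that H_S by (auto simp: cocycles_def S.X_simps)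
  \<comment> \<open>The homotopy formula gives the primitive \<open>h x\<close>, which stays in
    \<open>S\<close> by \<open>S_h\<close>.\<close>
  have exact: "coh_class S.X (e x) = coh_class S.X \<zero>\<^bsub>S.X\<^esub>" if "x \<in> S" "d x = \<zero>" "P x = \<zero>" for x
  proof -
    have "d (h x) = x" using homotopy[of x, symmetric] that by simp
    then have "e x = diff S.X (e (h x)) \<oplus>\<^bsub>S.X\<^esub> \<zero>\<^bsub>S.X\<^esub>" using that by (simp add: S.X_simps)
    then show ?thesis
      using X.coh_class_shift[of "e (h x)" "\<zero>\<^bsub>S.X\<^esub>"] S_h that by (simp add: S.X_simps S.S_zero)
  qed
  have "quasi_iso F S.X A (inv_into UNIV e)"
  proof (rule quasi_isoI[OF S.X_hom])
    fix y assume y: "y \<in> cocycles A d"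
    show "\<exists>z\<in>cocycles S.X (diff S.X). coh_class A (inv_into UNIV e z) = coh_class A y"
      using cocycleI[OF P_H[of y]] coh_class_P[OF y] by (intro bexI[of _ "e (P y)"]) simp_all
  next
    fix z assume z: "z \<in> cocycles S.X (diff S.X)" "coh_class A (inv_into UNIV e z) = coh_class A \<zero>"
    obtain x where x: "x \<in> S" "z = e x" "d x = \<zero>" using cocycle[OF z(1)] by blast
    then have "P x = \<zero>" using z coh_class_eq_zero[of x] by (simp add: cocycles_iff zero_cohomology)
    then show "coh_class S.X z = coh_class S.X \<zero>\<^bsub>S.X\<^esub>" using exact x by simp
  qed
  then have 1: "quasi_iso_related F A S.X" unfolding quasi_iso_related_def by blast
  let ?q = "\<lambda>z. coh_class A (P (inv_into UNIV e z))"
  have class_P: "coh_class A (P x) \<in> carrier C" for x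
    by (rule coh_class_carrier) (simp add: cocycles_iff P_H)
  have "dgca_hom F S.X C ?q"
    unfolding dgca_hom_def alg_hom_def
  proof (intro conjI allI ballI)
    show "dgca F S.X" "dgca F C" by (rule S.X_dgca dgca_C)+
    show "?q \<in> ring_hom S.X C"
    proof (rule ring_hom_memI)
      fix x y assume "x \<in> carrier S.X" "y \<in> carrier S.X"
      then obtain a b where ab: "a \<in> S" "x = e a" "b \<in> S" "y = e b" by (auto simp: S.X_simps)
      \<comment> \<open>By \<open>P_mult\<close>, \<open>a\<close> and \<open>b\<close> may be
        replaced by their harmonic parts, whose product is closed; on cocycles \<open>P\<close> does
        not change the class.\<close>
      have "coh_class A (P (a \<otimes> b)) = coh_class A (P a) \<otimes>\<^bsub>C\<^esub> coh_class A (P b)"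
        using P_H[of a] P_H[of b]
        by (simp add: P_mult ab mult_cohomology cocycles_iff coh_class_P d_mult)
      then show "?q (x \<otimes>\<^bsub>S.X\<^esub> y) = ?q x \<otimes>\<^bsub>C\<^esub> ?q y" using ab by (simp add: S.X_simps)
      show "?q (x \<oplus>\<^bsub>S.X\<^esub> y) = ?q x \<oplus>\<^bsub>C\<^esub> ?q y" using ab by (simp add: S.X_simps P_add add_cohomology)
    qed (use class_P one_H in \<open>simp_all add: S.X_simps one_cohomology\<close>)
    show "linear_map F S.X C ?q"
      using class_P by (auto simp: linear_map_def S.X_simps P_add add_cohomology P_smult smult_cohomology)
    show "?q ` grade S.X k \<subseteq> grade C k" for k
      by (auto simp: S.X_simps grade_cohomology cocycles_iff P_H P_grade)
    show "?q (diff S.X z) = diff C (?q z)" if "z \<in> carrier S.X" for z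
      using that by (auto simp: S.X_simps diff_cohomology zero_cohomology)
  qed
  then have "quasi_iso F S.X C ?q"
  proof (rule quasi_isoI)
    fix y assume "y \<in> cocycles C (diff C)"
    then have "y \<in> carrier C" by (simp add: cocycles_def)
    then obtain x where "x \<in> H" "y = coh_class A x" using bij_betw_imp_surj_on[OF bij_coh_class] by blast
    then show "\<exists>z\<in>cocycles S.X (diff S.X). coh_class C (?q z) = coh_class C y"
      using cocycleI by (intro bexI[of _ "e x"]) simp_all
  next
    interpret DC: dgca F C by (rule dgca_C)
    fix z assume z: "z \<in> cocycles S.X (diff S.X)" "coh_class C (?q z) = coh_class C \<zero>\<^bsub>C\<^esub>"
    obtain x where x: "x \<in> S" "z = e x" "d x = \<zero>" using cocycle[OF z(1)] by blast
    obtain a where "a \<in> carrier C" "?q z = diff C a \<oplus>\<^bsub>C\<^esub> \<zero>\<^bsub>C\<^esub>"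
      using DC.coh_class_eqD[OF z(2)] class_P by blast
    then have "coh_class A (P x) = \<zero>\<^bsub>C\<^esub>" using x by (simp add: diff_cohomology)
    then have "P x = \<zero>" using H_eq_zero[OF P_H] by simp
    then show "coh_class S.X z = coh_class S.X \<zero>\<^bsub>S.X\<^esub>" using exact x by simp
  qed
  then have "quasi_iso_related F S.X C" unfolding quasi_iso_related_def by blast
  \<comment> \<open>One intermediate DGCA suffices: the copy of \<open>S\<close> serves as both
    \<open>X\<close> and \<open>Y\<close>, with a chain of length zero between them.\<close>
  then show ?thesis
    unfolding formal_def equivalent_def using 1 by blast
qed

end

lemma hodge_dgcaI:
  "\<lbrakk>poincare_dgca F A n I; hodge_decomposition F A n I H B\<rbrakk> \<Longrightarrow> hodge_dgca F A n I H B"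
  by (simp add: hodge_dgca_def hodge_dgca_axioms_def poincare_dgca_def)

theorem theorem4p1:
  fixes F :: "'f ring" and A :: "('f, 'a) dga"
    and I :: "'a set \<Rightarrow> 'f" and H B :: "'a set" and G :: "'a set set" and i0 :: "'a set \<Rightarrow> 'a"
    and n r :: nat
  assumes "char0_field F"
    and "r > 1"
    and "poincare_dgca F A n I"
    and "connected_upto F A (r - 1)"
    and "hodge_decomposition F A n I H B"
    and "generating_subspace F (cohomology A) G"
    and "partial_splitting F A G i0"
    and "adapted F A G i0 H"
  shows "n \<le> 5 * r - 3 \<longrightarrow>
    (\<exists>m. a3_algebra F (restrict_graded A H) m \<and>
         (\<forall>x\<in>H. m 1 [x] = \<zero>\<^bsub>A\<^esub>) \<and>
         a_inf_quasi_isomorphic F (restrict_graded A H) m A (dga_operations A) \<and>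
         (n \<le> 4 * r - 2 \<longrightarrow>
            (\<forall>x\<in>H. \<forall>y\<in>H. \<forall>z\<in>H. m 3 [x, y, z] = \<zero>\<^bsub>A\<^esub>) \<and> formal F A))"
proof
  assume n: "n \<le> 5 * r - 3"
  interpret connected_hodge_dgca F A n I H B r
    using assms hodge_dgcaI
    by (simp add: connected_hodge_dgca_def connected_hodge_dgca_axioms_def char0_field_def)
  have "transfer_mult k w = \<zero>\<^bsub>A\<^esub>" if k: "k \<ge> 4" "length w = k" "set w \<subseteq> H" for k w
  proof (rule transfer_mult_vanish)
    have "4 * (int r - 1) \<le> int k * (int r - 1)"
      using k(1) assms(2) by (intro mult_right_mono) auto
    \<comment> \<open>The right-hand side is \<open>5 * r - 2\<close>, and \<open>r > 1\<close>
      keeps the natural number \<open>5 * r - 3\<close> from being truncated.\<close>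
    moreover have "int n < 4 * (int r - 1) + 2 + int r" using n assms(2) by arith
    ultimately show "int n < int k * (int r - 1) + 2 + int r" by (meson add_right_mono order_less_le_trans)
  qed (use k in auto)
  then have "a3_algebra F (restrict_graded A H) transfer_mult"
    using a_inf_algebra_transfer by (simp add: a3_algebra_def restrict_graded_def)
  moreover have "a_inf_quasi_isomorphic F (restrict_graded A H) transfer_mult A (dga_operations A)"
    unfolding a_inf_quasi_isomorphic_def using a_inf_quasi_iso_transfer by blast
  moreover have "transfer_mult 3 [x, y, z] = \<zero>\<^bsub>A\<^esub>"
    if "n \<le> 4 * r - 2" "x \<in> H" "y \<in> H" "z \<in> H" for x y z
    \<comment> \<open>For arity three the degree condition reads
      \<open>n < 4 * r - 1\<close>.\<close>
    by (rule transfer_mult_vanish) (use that assms(2) in auto)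
  moreover have "formal F A" if "n \<le> 4 * r - 2"
  proof -
    interpret formal_range F A n I H B r
      by unfold_locales (rule that)
    show ?thesis by (rule formal)
  qed
  ultimately show "\<exists>m. a3_algebra F (restrict_graded A H) m \<and>
         (\<forall>x\<in>H. m 1 [x] = \<zero>\<^bsub>A\<^esub>) \<and>
         a_inf_quasi_isomorphic F (restrict_graded A H) m A (dga_operations A) \<and>
         (n \<le> 4 * r - 2 \<longrightarrow>
            (\<forall>x\<in>H. \<forall>y\<in>H. \<forall>z\<in>H. m 3 [x, y, z] = \<zero>\<^bsub>A\<^esub>) \<and> formal F A)"
    by (intro exI[of _ transfer_mult]) simp
qed

end
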